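(* Let $m\ge 3$, $\lambda=(m-2)/2$, and let $\alpha_k\in\mathbb{C}$ ($k\ge0$), $\beta_k\in\mathbb{C}$ ($k\ge1$), with $\beta_0:=0$, be such that the series below converge absolutely and uniformly on compact sets. Let $K_-(\underline{x},\underline{y})=\sum_{k=0}^{\infty}\alpha_k z^{-\lambda}J_{k+\lambda}(z)C_k^{\lambda}(w)+(\underline{x}\wedge\underline{y})\sum_{k=1}^{\infty}\beta_k z^{-\lambda-1}J_{k+\lambda}(z)C_{k-1}^{\lambda+1}(w)$ and $\mathcal{F}_-[f](\underline{y})=\frac{\Gamma(m/2)}{2\pi^{m/2}}\int_{\mathbb{R}^m}K_-(\underline{x},\underline{y})f(\underline{x})\,dV(\underline{x})$. For $k\ge0$ put $$N_k=\Bigl(\tfrac{\lambda}{\lambda+k}\alpha_k-\tfrac{k}{2(\lambda+k)}\beta_k\Bigr)\Bigl(\tfrac{\lambda}{\lambda+k}\alpha_k+\tfrac{k+2\lambda}{2(\lambda+k)}\beta_k\Bigr),$$ assume $N_k\neq0$ for all $k$, and define $$\widetilde{K_-}(\underline{x},\underline{y})=\sum_{k=0}^{\infty}\frac{\alpha_k+\beta_k}{N_k}z^{-\lambda}J_{k+\lambda}(z)C_k^{\lambda}(w)-(\underline{x}\wedge\underline{y})\sum_{k=1}^{\infty}\frac{\beta_k}{N_k}z^{-\lambda-1}J_{k+\lambda}(z)C_{k-1}^{\lambda+1}(w)$$ (assumed convergent in the same sense), and $\mathcal{F}_-^{-1}[f](\underline{y})=\frac{\Gamma(m/2)}{2\pi^{m/2}}\int_{\mathbb{R}^m}\widetilde{K_-}(\underline{x},\underline{y})f(\underline{x})\,dV(\underline{x})$.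 Then $\mathcal{F}_-^{-1}$ is the inverse of $\mathcal{F}_-$ on the basis $\{\psi_{j,k,\ell}\}$, i.e. $\mathcal{F}_-^{-1}[\mathcal{F}_-[\psi_{j,k,\ell}]]=\mathcal{F}_-[\mathcal{F}_-^{-1}[\psi_{j,k,\ell}]]=\psi_{j,k,\ell}$ for all $j,k,\ell$.
   Context: $\mathcal{C}l_{0,m}$ is the real Clifford algebra generated by $e_1,\dots,e_m$ with $e_ie_j+e_je_i=-2\delta_{ij}$; functions take values in $\mathcal{C}l_{0,m}\otimes\mathbb{C}$. $\underline{x}=\sum_j x_je_j$, $\underline{x}\wedge\underline{y}=\sum_{j<k}e_je_k(x_jy_k-x_ky_j)$, $\partial_{\underline{x}}=\sum_je_j\partial_{x_j}$, $z=|\underline{x}||\underline{y}|$, $w=\langle\underline{x}/|\underline{x}|,\underline{y}/|\underline{y}|\rangle$. $J_\nu$ is the Bessel function, $C_k^\lambda$ the Gegenbauer polynomial. $\mathcal{M}_k$ is the space of spherical monogenics of degree $k$ (homogeneous $\mathcal{C}l_{0,m}$-valued polynomials $M$ of degree $k$ with $\partial_{\underline{x}}M=0$) with basis $M_k^{(\ell)}$; $\psi_{2j,k,\ell}(\underline{x})=L_j^{m/2+k-1}(|\underline{x}|^2)M_k^{(\ell)}(\underline{x})e^{-|\underline{x}|^2/2}$, $\psi_{2j+1,k,\ell}(\underline{x})=L_j^{m/2+k}(|\underline{x}|^2)\,\underline{x}\,M_k^{(\ell)}(\underline{x})e^{-|\underline{x}|^2/2}$, with $L_j^\alpha$ the generalized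 Laguerre polynomials.
   Formalization: The integrals defining both transforms of the basis functions and their two compositions are assumed to converge absolutely for every y; convergence of the kernel series on compact sets does not ensure this (e.g. m=4, β_k=0, α_k=√(k!)). *)

theory Defs
  imports "HOL-Analysis.Analysis"
begin

text \<open>An element of the complexified Clifford algebra with generators e_0,...,e_(m-1)
  (standing for e_1,...,e_m) is represented by its coefficients on the basis blades
  e_A = e_a1 ... e_ar (a1 < ... < ar, A a subset of {..<m}); coefficients of sets A not
  contained in {..<m} are irrelevant and are kept 0 by all operations below.\<close>

type_synonym cl = "nat set \<Rightarrow> complex"

definition cl_valued :: "nat \<Rightarrow> cl \<Rightarrow> bool" where
  "cl_valued m u \<longleftrightarrow> (\<forall>A. \<not> A \<subseteq> {..<m} \<longrightarrow> u A = 0)"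

text \<open>sign with e_A e_B = sign A B e_(A symdiff B), using e_i e_i = -1\<close>
definition cl_sign :: "nat set \<Rightarrow> nat set \<Rightarrow> complex" where
  "cl_sign A B = (-1) ^ (card {(a, b). a \<in> A \<and> b \<in> B \<and> b < a} + card (A \<inter> B))"

definition cl_mult :: "nat \<Rightarrow> cl \<Rightarrow> cl \<Rightarrow> cl" where
  "cl_mult m u v = (\<lambda>C. if C \<subseteq> {..<m}
      then (\<Sum>A\<in>Pow {..<m}. cl_sign A ((A - C) \<union> (C - A)) * u A * v ((A - C) \<union> (C - A)))
      else 0)"

definition cl_add :: "cl \<Rightarrow> cl \<Rightarrow> cl" where
  "cl_add u v = (\<lambda>A. u A + v A)"

definition cl_scal :: "complex \<Rightarrow> cl \<Rightarrow> cl" where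
  "cl_scal c u = (\<lambda>A. c * u A)"

definition cl_one :: cl where
  "cl_one = (\<lambda>A. if A = {} then 1 else 0)"

definition cl_gen :: "nat \<Rightarrow> cl" where
  "cl_gen j = (\<lambda>A. if A = {j} then 1 else 0)"

definition vnorm :: "nat \<Rightarrow> (nat \<Rightarrow> real) \<Rightarrow> real" where
  "vnorm m x = sqrt (\<Sum>i<m. (x i)\<^sup>2)"

definition vinner :: "nat \<Rightarrow> (nat \<Rightarrow> real) \<Rightarrow> (nat \<Rightarrow> real) \<Rightarrow> real" where
  "vinner m x y = (\<Sum>i<m. x i * y i)"

definition cl_vec :: "nat \<Rightarrow> (nat \<Rightarrow> real) \<Rightarrow> cl" where
  "cl_vec m x = (\<lambda>A. \<Sum>j<m. complex_of_real (x j) * cl_gen j A)"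

definition cl_wedge :: "nat \<Rightarrow> (nat \<Rightarrow> real) \<Rightarrow> (nat \<Rightarrow> real) \<Rightarrow> cl" where
  "cl_wedge m x y = (\<lambda>A. \<Sum>k<m. \<Sum>j<k.
      complex_of_real (x j * y k - x k * y j) * (if A = {j, k} then 1 else 0))"

definition zz :: "nat \<Rightarrow> (nat \<Rightarrow> real) \<Rightarrow> (nat \<Rightarrow> real) \<Rightarrow> real" where
  "zz m x y = vnorm m x * vnorm m y"

definition ww :: "nat \<Rightarrow> (nat \<Rightarrow> real) \<Rightarrow> (nat \<Rightarrow> real) \<Rightarrow> real" where
  "ww m x y = vinner m (\<lambda>i. x i / vnorm m x) (\<lambda>i. y i / vnorm m y)"

text \<open>Bessel function of the first kind (for real z > 0)\<close>
definition besselJ :: "real \<Rightarrow> real \<Rightarrow> real" where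
  "besselJ \<nu> z = (\<Sum>j. (-1) ^ j / (fact j * Gamma (real j + \<nu> + 1)) * (z / 2) powr (2 * real j + \<nu>))"

text \<open>z^(-a) J_nu(z), for nu >= a, with its continuous extension at z = 0\<close>
definition zJ :: "real \<Rightarrow> real \<Rightarrow> real \<Rightarrow> real" where
  "zJ a \<nu> z = (if z = 0 then (if \<nu> = a then 1 / (2 powr a * Gamma (a + 1)) else 0)
               else z powr (- a) * besselJ \<nu> z)"

definition gegenbauer :: "real \<Rightarrow> nat \<Rightarrow> real \<Rightarrow> real" where
  "gegenbauer lam k w = (\<Sum>j\<le>k div 2. (-1) ^ j * Gamma (real (k - j) + lam)
       / (Gamma lam * fact j * fact (k - 2 * j)) * (2 * w) ^ (k - 2 * j))"

definition laguerre :: "nat \<Rightarrow> real \<Rightarrow> real \<Rightarrow> real" where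
  "laguerre n a t = (\<Sum>i\<le>n. (-1) ^ i * ((real n + a) gchoose (n - i)) * t ^ i / fact i)"

definition multi_idx :: "nat \<Rightarrow> nat \<Rightarrow> (nat \<Rightarrow> nat) set" where
  "multi_idx m k = {\<alpha>. (\<forall>i. m \<le> i \<longrightarrow> \<alpha> i = 0) \<and> (\<Sum>i<m. \<alpha> i) = k}"

definition hom_poly :: "nat \<Rightarrow> nat \<Rightarrow> ((nat \<Rightarrow> real) \<Rightarrow> cl) \<Rightarrow> bool" where
  "hom_poly m k M \<longleftrightarrow> (\<exists>c :: (nat \<Rightarrow> nat) \<Rightarrow> cl. \<forall>x.
      M x = (\<lambda>A. \<Sum>\<alpha>\<in>multi_idx m k. c \<alpha> A * complex_of_real (\<Prod>i<m. x i ^ \<alpha> i)))"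

definition partial :: "nat \<Rightarrow> ((nat \<Rightarrow> real) \<Rightarrow> cl) \<Rightarrow> (nat \<Rightarrow> real) \<Rightarrow> cl" where
  "partial j F x = (\<lambda>A. vector_derivative (\<lambda>t. F (x(j := t)) A) (at (x j)))"

definition dirac :: "nat \<Rightarrow> ((nat \<Rightarrow> real) \<Rightarrow> cl) \<Rightarrow> (nat \<Rightarrow> real) \<Rightarrow> cl" where
  "dirac m F x = (\<lambda>A. \<Sum>j<m. cl_mult m (cl_gen j) (partial j F x) A)"

definition spherical_monogenic :: "nat \<Rightarrow> nat \<Rightarrow> ((nat \<Rightarrow> real) \<Rightarrow> cl) \<Rightarrow> bool" where
  "spherical_monogenic m k M \<longleftrightarrow>
     (\<forall>x. cl_valued m (M x) \<and> (\<forall>A. Im (M x A) = 0)) \<and> hom_poly m k M \<and>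
     (\<forall>x. dirac m M x = (\<lambda>A. 0))"

definition psi :: "nat \<Rightarrow> nat \<Rightarrow> nat \<Rightarrow> ((nat \<Rightarrow> real) \<Rightarrow> cl) \<Rightarrow> (nat \<Rightarrow> real) \<Rightarrow> cl" where
  "psi m J k M x =
     (if even J
      then cl_scal (complex_of_real (laguerre (J div 2) (real m / 2 + real k - 1) ((vnorm m x)\<^sup>2)
                     * exp (- (vnorm m x)\<^sup>2 / 2))) (M x)
      else cl_scal (complex_of_real (laguerre (J div 2) (real m / 2 + real k) ((vnorm m x)\<^sup>2)
                     * exp (- (vnorm m x)\<^sup>2 / 2))) (cl_mult m (cl_vec m x) (M x)))"

definition lam :: "nat \<Rightarrow> real" where
  "lam m = (real m - 2) / 2"

definition serA :: "nat \<Rightarrow> (nat \<Rightarrow> complex) \<Rightarrow> nat \<Rightarrow> (nat \<Rightarrow> real) \<Rightarrow> (nat \<Rightarrow> real) \<Rightarrow> complex" where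
  "serA m a k x y = a k * complex_of_real (zJ (lam m) (real k + lam m) (zz m x y)
                        * gegenbauer (lam m) k (ww m x y))"

definition serB :: "nat \<Rightarrow> (nat \<Rightarrow> complex) \<Rightarrow> nat \<Rightarrow> (nat \<Rightarrow> real) \<Rightarrow> (nat \<Rightarrow> real) \<Rightarrow> complex" where
  "serB m b k x y = b (Suc k) * complex_of_real (zJ (lam m + 1) (real (Suc k) + lam m) (zz m x y)
                        * gegenbauer (lam m + 1) k (ww m x y))"

definition kern :: "nat \<Rightarrow> (nat \<Rightarrow> complex) \<Rightarrow> (nat \<Rightarrow> complex) \<Rightarrow> (nat \<Rightarrow> real) \<Rightarrow> (nat \<Rightarrow> real) \<Rightarrow> cl" where
  "kern m a b x y = cl_add (cl_scal (\<Sum>k. serA m a k x y) cl_one)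
                           (cl_scal (\<Sum>k. serB m b k x y) (cl_wedge m x y))"

text \<open>the series converge absolutely (pointwise) and uniformly on compact subsets of
  R^m x R^m (equivalently on all sets |x| <= R, |y| <= R)\<close>
definition series_conv :: "nat \<Rightarrow> (nat \<Rightarrow> (nat \<Rightarrow> real) \<Rightarrow> (nat \<Rightarrow> real) \<Rightarrow> complex) \<Rightarrow> bool" where
  "series_conv m F \<longleftrightarrow> (\<forall>x y. summable (\<lambda>k. norm (F k x y))) \<and>
     (\<forall>R. uniformly_convergent_on {(x, y). vnorm m x \<le> R \<and> vnorm m y \<le> R}
            (\<lambda>n (x, y). \<Sum>k<n. F k x y))"

definition kern_conv :: "nat \<Rightarrow> (nat \<Rightarrow> complex) \<Rightarrow> (nat \<Rightarrow> complex) \<Rightarrow> bool" where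
  "kern_conv m a b \<longleftrightarrow> series_conv m (serA m a) \<and> series_conv m (serB m b)"

definition lebm :: "nat \<Rightarrow> (nat \<Rightarrow> real) measure" where
  "lebm m = PiM {..<m} (\<lambda>_. lborel)"

definition integrand_ok :: "nat \<Rightarrow> ((nat \<Rightarrow> real) \<Rightarrow> (nat \<Rightarrow> real) \<Rightarrow> cl) \<Rightarrow> ((nat \<Rightarrow> real) \<Rightarrow> cl) \<Rightarrow> bool" where
  "integrand_ok m K f \<longleftrightarrow> (\<forall>y A. integrable (lebm m) (\<lambda>x. cl_mult m (K x y) (f x) A))"

definition transf :: "nat \<Rightarrow> ((nat \<Rightarrow> real) \<Rightarrow> (nat \<Rightarrow> real) \<Rightarrow> cl) \<Rightarrow> ((nat \<Rightarrow> real) \<Rightarrow> cl) \<Rightarrow> (nat \<Rightarrow> real) \<Rightarrow> cl" where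
  "transf m K f y = (\<lambda>A. complex_of_real (Gamma (real m / 2) / (2 * pi powr (real m / 2)))
                         * integral\<^sup>L (lebm m) (\<lambda>x. cl_mult m (K x y) (f x) A))"

definition Nk :: "nat \<Rightarrow> (nat \<Rightarrow> complex) \<Rightarrow> (nat \<Rightarrow> complex) \<Rightarrow> nat \<Rightarrow> complex" where
  "Nk m \<alpha> \<beta> k =
     (of_real (lam m / (lam m + real k)) * \<alpha> k - of_real (real k / (2 * (lam m + real k))) * \<beta> k) *
     (of_real (lam m / (lam m + real k)) * \<alpha> k + of_real ((real k + 2 * lam m) / (2 * (lam m + real k))) * \<beta> k)"

definition Kminus :: "nat \<Rightarrow> (nat \<Rightarrow> complex) \<Rightarrow> (nat \<Rightarrow> complex) \<Rightarrow> (nat \<Rightarrow> real) \<Rightarrow> (nat \<Rightarrow> real) \<Rightarrow> cl" where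
  "Kminus m \<alpha> \<beta> = kern m \<alpha> \<beta>"

definition Kminus_inv :: "nat \<Rightarrow> (nat \<Rightarrow> complex) \<Rightarrow> (nat \<Rightarrow> complex) \<Rightarrow> (nat \<Rightarrow> real) \<Rightarrow> (nat \<Rightarrow> real) \<Rightarrow> cl" where
  "Kminus_inv m \<alpha> \<beta> = kern m (\<lambda>k. (\<alpha> k + \<beta> k) / Nk m \<alpha> \<beta> k) (\<lambda>k. - \<beta> k / Nk m \<alpha> \<beta> k)"

end

theory Submission
  imports Defs "HOL-Probability.Probability"
begin

text \<open>
  Each basis function is a Laguerre polynomial in \<open>|x|\<^sup>2\<close> times a Gaussian times \<open>f\<close>, where \<open>f = M\<close>
  or \<open>f = x M\<close> is a harmonic homogeneous polynomial, say of degree \<open>d\<close>, and an eigenfunction of the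
  Gamma operator, with eigenvalue \<open>\<mu> = - d\<close> or \<open>\<mu> = d + 2\<lambda>\<close>. On it the transform with
  coefficients \<open>a, b\<close> acts as the scalar \<open>(-1)\<^sup>j (\<lambda> a\<^sub>d + \<mu> b\<^sub>d / 2) / (\<lambda> + d)\<close>; the two values at
  \<open>\<mu>\<close> are the factors of \<open>N\<^sub>d\<close>, and the coefficients of the inverse kernel swap them and divide by \<open>N\<^sub>d\<close>.

  Spherical integrals are replaced by Gaussian ones. By Stein's identity, the integral of
  \<open>\<langle>x,y\<rangle>\<^sup>n f(x) exp (-|x|\<^sup>2/2)\<close> is an explicit multiple of \<open>|y|\<^sup>n\<^sup>-\<^sup>d f(y)\<close>, which gives the orthogonality and
  reproducing property of the Gegenbauer terms by a finite-difference identity. If a homogeneous \<open>P\<close> has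
  Gaussian integral zero, then by scaling so has \<open>H(|x|) P(x)\<close> for every \<open>H\<close>; hence over a ball, where
  the kernel series converges uniformly, only the term of degree \<open>d\<close> survives. Its integral over the whole
  space is a Hankel transform of a Laguerre function, computed by expanding the Bessel function in powers
  of \<open>|x|\<^sup>2\<close>.\<close>

section \<open>Homogeneous polynomials\<close>

text \<open>The Gaussian is chosen because it factorises over the coordinates, as
  \<open>lebm\<close> does: every integral of a monomial is a product of one-dimensional moments,
  and neither surface measure nor polar coordinates enter. For a homogeneous polynomial the Gaussian
  integral is the spherical mean times a positive radial factor, so it carries the same information.
  The obstacle is that the kernel series is controlled only on compact sets, while the transform
  integrates over the whole space. The terms must therefore be orthogonal to the basis function on
  each ball, not only under the Gaussian weight; the scaling argument provides this. Two terms
  survive: the Gegenbauer term of degree \<open>d\<close>, and the wedge term whose Gegenbauer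
  factor has degree \<open>d - 1\<close>. Both carry the Bessel function of order
  \<open>d + \<lambda>\<close>, so they merge into one polynomial of degree \<open>2 * d\<close>.
  The wedge term is compared with the scalar one through the fact that the derivative of the
  Gegenbauer polynomial of parameter \<lambda> and degree \<open>n + 1\<close> is
  \<open>2 * \<lambda>\<close> times the one of parameter \<open>\<lambda> + 1\<close> and degree
  \<open>n\<close>; this is the source of the quotient
  \<open>\<mu> / (2 * \<lambda>)\<close>.\<close>

definition mon :: "nat \<Rightarrow> (nat \<Rightarrow> nat) \<Rightarrow> (nat \<Rightarrow> real) \<Rightarrow> complex" where
  "mon m \<alpha> x = (\<Prod>i<m. complex_of_real (x i) ^ \<alpha> i)"

text \<open>A predicate on functions rather than a type of polynomials: values, integrals and
  derivatives are taken directly, and induction goes monomial by monomial. The zero function has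
  every degree, so the truncated degree \<open>d - 1\<close> is right for derivatives even at
  \<open>d = 0\<close>.\<close>

inductive hpoly :: "nat \<Rightarrow> nat \<Rightarrow> ((nat \<Rightarrow> real) \<Rightarrow> complex) \<Rightarrow> bool" for m d where
  zero: "hpoly m d (\<lambda>_. 0)"
| add_mon: "hpoly m d P \<Longrightarrow> sum \<alpha> {..<m} = d \<Longrightarrow> hpoly m d (\<lambda>x. c * mon m \<alpha> x + P x)"

text \<open>The scalar form of \<open>partial\<close>: coefficient by coefficient,
  \<open>partial j F x A\<close> is \<open>pd j (\<lambda>x. F x A) x\<close>.\<close>

definition pd :: "nat \<Rightarrow> ((nat \<Rightarrow> real) \<Rightarrow> complex) \<Rightarrow> (nat \<Rightarrow> real) \<Rightarrow> complex" where
  "pd i P x = vector_derivative (\<lambda>t. P (x(i := t))) (at (x i))"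

lemma hpoly_mon: "sum \<alpha> {..<m} = d \<Longrightarrow> hpoly m d (\<lambda>x. c * mon m \<alpha> x)"
  using hpoly.add_mon[OF hpoly.zero, of \<alpha> m d c] by simp

lemma hpoly_add: "hpoly m d P \<Longrightarrow> hpoly m d Q \<Longrightarrow> hpoly m d (\<lambda>x. P x + Q x)"
proof (induction rule: hpoly.induct)
  case (add_mon P \<alpha> c)
  then show ?case using hpoly.add_mon[of m d "\<lambda>x. P x + Q x" \<alpha> c] by (simp add: add.assoc)
qed simp

lemma hpoly_scale: "hpoly m d P \<Longrightarrow> hpoly m d (\<lambda>x. c * P x)"
proof (induction rule: hpoly.induct)
  case (add_mon P \<alpha> b)
  then show ?case using hpoly.add_mon[of m d "\<lambda>x. c * P x" \<alpha> "c * b"]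
    by (simp add: algebra_simps)
qed (simp add: hpoly.zero)

lemma hpoly_sum: "(\<And>i. i \<in> I \<Longrightarrow> hpoly m d (P i)) \<Longrightarrow> hpoly m d (\<lambda>x. \<Sum>i\<in>I. P i x)"
  by (induction I rule: infinite_finite_induct) (auto simp: hpoly.zero hpoly_add)

lemma hpoly_minus: "hpoly m d P \<Longrightarrow> hpoly m d (\<lambda>x. - P x)"
  using hpoly_scale[of m d P "-1"] by simp

lemma hpoly_diff: "hpoly m d P \<Longrightarrow> hpoly m d Q \<Longrightarrow> hpoly m d (\<lambda>x. P x - Q x)"
  using hpoly_add[OF _ hpoly_minus] by simp

lemma hpoly_const: "hpoly m 0 (\<lambda>_. c)"
  using hpoly_mon[of "\<lambda>_. 0" m 0 c] by (simp add: mon_def)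

lemma hpoly_0_const: "hpoly m 0 P \<Longrightarrow> \<exists>c. P = (\<lambda>_. c)"
proof (induction rule: hpoly.induct)
  case (add_mon P \<alpha> b)
  then have "mon m \<alpha> = (\<lambda>_. 1)" by (auto simp: mon_def fun_eq_iff)
  then show ?case using add_mon by auto
qed auto

lemma mon_mult: "mon m \<alpha> x * mon m \<beta> x = mon m (\<lambda>i. \<alpha> i + \<beta> i) x"
  by (simp add: mon_def power_add prod.distrib)

lemma hpoly_mult:
  assumes "hpoly m d P" "hpoly m e Q"
  shows "hpoly m (d + e) (\<lambda>x. P x * Q x)"
proof -
  have 1: "hpoly m (d + e) (\<lambda>x. mon m \<alpha> x * Q x)" if "sum \<alpha> {..<m} = d" for \<alpha>
    using assms(2)
  proof (induction rule: hpoly.induct)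
    case (add_mon Q \<beta> b)
    have "hpoly m (d + e) (\<lambda>x. b * mon m (\<lambda>i. \<alpha> i + \<beta> i) x + mon m \<alpha> x * Q x)"
      by (rule hpoly.add_mon) (use add_mon that in \<open>auto simp: sum.distrib\<close>)
    then show ?case by (simp add: mon_mult[symmetric] algebra_simps)
  qed (simp add: hpoly.zero)
  show ?thesis using assms(1)
  proof (induction rule: hpoly.induct)
    case (add_mon P \<alpha> b)
    then show ?case using hpoly_add[OF hpoly_scale[OF 1, of \<alpha> b] add_mon.IH]
      by (simp add: algebra_simps)
  qed (simp add: hpoly.zero)
qed

lemma hpoly_coord: "i < m \<Longrightarrow> hpoly m 1 (\<lambda>x. complex_of_real (x i))"
proof -
  assume i: "i < m"
  have "mon m (\<lambda>j. if j = i then 1 else 0) = (\<lambda>x. complex_of_real (x i))"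
  proof
    fix x
    have "mon m (\<lambda>j. if j = i then 1 else 0) x = (\<Prod>j<m. if j = i then complex_of_real (x j) else 1)"
      unfolding mon_def by (intro prod.cong) auto
    then show "mon m (\<lambda>j. if j = i then 1 else 0) x = complex_of_real (x i)"
      using i by (simp add: prod.delta)
  qed
  then show ?thesis using hpoly_mon[of "\<lambda>j. if j = i then 1 else 0" m 1 1] i by (simp add: sum.delta)
qed

lemma hpoly_coord_mult: "i < m \<Longrightarrow> hpoly m d P \<Longrightarrow> hpoly m (Suc d) (\<lambda>x. complex_of_real (x i) * P x)"
  using hpoly_mult[OF hpoly_coord, of i m d P] by simp

lemma hpoly_inner: "hpoly m 1 (\<lambda>x. complex_of_real (vinner m x y))"
proof -
  have "hpoly m 1 (\<lambda>x. \<Sum>i<m. complex_of_real (y i) * complex_of_real (x i))"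
    by (intro hpoly_sum hpoly_scale hpoly_coord) auto
  then show ?thesis by (simp add: vinner_def mult.commute)
qed

lemma hpoly_power: "hpoly m d P \<Longrightarrow> hpoly m (n * d) (\<lambda>x. P x ^ n)"
proof (induction n)
  case (Suc n)
  then show ?case using hpoly_mult[of m d P "n * d"] by simp
qed (simp add: hpoly_const)

lemma vnorm_sq: "(vnorm m x)\<^sup>2 = (\<Sum>i<m. (x i)\<^sup>2)"
  by (simp add: vnorm_def sum_nonneg)

lemma hpoly_normsq: "hpoly m 2 (\<lambda>x. complex_of_real ((vnorm m x)\<^sup>2))"
proof -
  have "hpoly m 2 (\<lambda>x. \<Sum>i<m. complex_of_real (x i) * complex_of_real (x i))"
    using hpoly_mult[OF hpoly_coord hpoly_coord] by (intro hpoly_sum) (simp add: numeral_2_eq_2)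
  then show ?thesis unfolding vnorm_sq by (simp add: power2_eq_square)
qed

lemma hpoly_cnj: "hpoly m d P \<Longrightarrow> hpoly m d (\<lambda>x. cnj (P x))"
proof (induction rule: hpoly.induct)
  case (add_mon P \<alpha> c)
  then show ?case using hpoly.add_mon[of m d "\<lambda>x. cnj (P x)" \<alpha> "cnj c"] by (simp add: mon_def)
qed (simp add: hpoly.zero)

text \<open>Points are functions on all of \<open>nat\<close>, of which only the coordinates below
  \<open>m\<close> count; a point may thus be replaced by its restriction, as happens in
  \<open>dilate\<close>.\<close>

lemma hpoly_cong_coords:
  assumes "hpoly m d P" "\<And>i. i < m \<Longrightarrow> x i = y i"
  shows "P x = P y"
  using assms(1)
proof (induction rule: hpoly.induct)
  case (add_mon P \<alpha> c)
  have "mon m \<alpha> x = mon m \<alpha> y" unfolding mon_def using assms(2) by (intro prod.cong) auto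
  with add_mon show ?case by simp
qed simp

lemma hpoly_homogeneous:
  assumes "hpoly m d P"
  shows "P (\<lambda>i. r * x i) = complex_of_real r ^ d * P x"
  using assms
proof (induction rule: hpoly.induct)
  case (add_mon P \<alpha> c)
  have "mon m \<alpha> (\<lambda>i. r * x i) = complex_of_real r ^ d * mon m \<alpha> x"
    by (simp add: mon_def power_mult_distrib prod.distrib power_sum add_mon(2)[symmetric])
  with add_mon show ?case by (simp add: algebra_simps)
qed simp

section \<open>Partial derivatives of homogeneous polynomials\<close>

lemma mon_deriv:
  assumes "i < m"
  shows "((\<lambda>t. mon m \<alpha> (x(i := t))) has_vector_derivative
           of_nat (\<alpha> i) * mon m (\<alpha>(i := \<alpha> i - 1)) x) (at (x i))"
proof -
  have split: "(\<Prod>j<m. g j) = g i * (\<Prod>j\<in>{..<m}-{i}. g j)" for g :: "nat \<Rightarrow> complex"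
    using assms by (simp add: prod.remove)
  define C where "C = (\<Prod>j\<in>{..<m}-{i}. complex_of_real (x j) ^ \<alpha> j)"
  have 1: "mon m \<alpha> (x(i := t)) = complex_of_real t ^ \<alpha> i * C" for t
    unfolding mon_def split C_def by (auto intro!: arg_cong2[where f="(*)"] prod.cong)
  have 2: "mon m (\<alpha>(i := \<alpha> i - 1)) x = complex_of_real (x i) ^ (\<alpha> i - 1) * C"
    unfolding mon_def split C_def by (auto intro!: arg_cong2[where f="(*)"] prod.cong)
  have "((\<lambda>t. complex_of_real (t ^ \<alpha> i)) has_vector_derivative
          complex_of_real (of_nat (\<alpha> i) * x i ^ (\<alpha> i - 1))) (at (x i))"
    by (intro has_vector_derivative_of_real) (auto intro!: derivative_eq_intros simp: has_real_derivative_iff_has_vector_derivative[symmetric])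
  then have "((\<lambda>t. complex_of_real t ^ \<alpha> i * C) has_vector_derivative
          (of_nat (\<alpha> i) * complex_of_real (x i) ^ (\<alpha> i - 1)) * C) (at (x i))"
    by (intro has_vector_derivative_mult_left) simp
  then show ?thesis unfolding 1 2 by (simp add: mult.assoc)
qed

lemma hpoly_deriv:
  assumes "i < m" "hpoly m d P"
  shows "((\<lambda>t. P (x(i := t))) has_vector_derivative pd i P x) (at (x i))"
proof -
  have "(\<lambda>t. P (x(i := t))) differentiable at (x i)"
    using assms(2)
  proof (induction rule: hpoly.induct)
    case (add_mon P \<alpha> c)
    from mon_deriv[OF assms(1), of \<alpha> x] have "(\<lambda>t. mon m \<alpha> (x(i := t))) differentiable at (x i)"
      by (rule differentiableI_vector)
    with add_mon show ?case by (intro derivative_intros)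
  qed simp
  then show ?thesis unfolding pd_def by (simp add: vector_derivative_works)
qed

lemma pd_eqI: "((\<lambda>t. P (x(i := t))) has_vector_derivative D) (at (x i)) \<Longrightarrow> pd i P x = D"
  unfolding pd_def by (rule vector_derivative_at)

lemma pd_const [simp]: "pd i (\<lambda>_. c) x = 0"
  by (rule pd_eqI) simp

lemma pd_mon: "i < m \<Longrightarrow> pd i (mon m \<alpha>) x = of_nat (\<alpha> i) * mon m (\<alpha>(i := \<alpha> i - 1)) x"
  by (intro pd_eqI mon_deriv)

lemma pd_add:
  "i < m \<Longrightarrow> hpoly m d P \<Longrightarrow> hpoly m e Q \<Longrightarrow> pd i (\<lambda>x. P x + Q x) x = pd i P x + pd i Q x"
  by (intro pd_eqI has_vector_derivative_add hpoly_deriv)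

lemma pd_scale: "i < m \<Longrightarrow> hpoly m d P \<Longrightarrow> pd i (\<lambda>x. c * P x) x = c * pd i P x"
  by (intro pd_eqI has_vector_derivative_mult_right hpoly_deriv)

lemma pd_mult:
  "i < m \<Longrightarrow> hpoly m d P \<Longrightarrow> hpoly m e Q \<Longrightarrow>
    pd i (\<lambda>x. P x * Q x) x = P x * pd i Q x + pd i P x * Q x"
  by (rule pd_eqI) (use has_vector_derivative_mult[OF hpoly_deriv[of i m d P x] hpoly_deriv[of i m e Q x]] in simp)

lemma pd_sum:
  assumes "i < m" "\<And>j. j \<in> I \<Longrightarrow> hpoly m d (P j)"
  shows "pd i (\<lambda>x. \<Sum>j\<in>I. P j x) x = (\<Sum>j\<in>I. pd i (P j) x)"
  by (rule pd_eqI, intro has_vector_derivative_sum hpoly_deriv[OF assms(1)]) (use assms(2) in auto)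

lemma pd_coord: "pd i (\<lambda>x. complex_of_real (x j)) x = (if i = j then 1 else 0)"
  by (rule pd_eqI) (auto intro!: derivative_eq_intros has_vector_derivative_of_real)

lemma pd_mon_add:
  assumes "i < m" "hpoly m d P" "sum \<alpha> {..<m} = d"
  shows "pd i (\<lambda>x. c * mon m \<alpha> x + P x) =
    (\<lambda>x. c * of_nat (\<alpha> i) * mon m (\<alpha>(i := \<alpha> i - 1)) x + pd i P x)"
  using pd_add[OF assms(1) hpoly_mon[OF assms(3)] assms(2)]
    pd_scale[OF assms(1) hpoly_mon[OF assms(3), of 1]] pd_mon[OF assms(1)]
  by (auto simp: fun_eq_iff mult.assoc)

lemma hpoly_pd:
  assumes "i < m" "hpoly m d P"
  shows "hpoly m (d - 1) (pd i P)"
  using assms(2)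
proof (induction rule: hpoly.induct)
  case zero
  have "pd i (\<lambda>_. 0) = (\<lambda>_. 0)" by auto
  then show ?case by (simp add: hpoly.zero)
next
  case (add_mon P \<alpha> c)
  show ?case
  \<comment> \<open>If the exponent is 0, the truncated exponent leaves a monomial of the wrong
    degree, but its coefficient is 0 as well.\<close>
  proof (cases "\<alpha> i = 0")
    case True
    then show ?thesis using add_mon pd_mon_add[OF assms(1) add_mon(1,2)] by simp
  next
    case False
    have "sum (\<alpha>(i := \<alpha> i - 1)) {..<m} = (\<alpha> i - 1) + sum \<alpha> ({..<m} - {i})"
      using assms(1) by (simp add: sum.remove[of _ i])
    also have "\<dots> = d - 1" using assms(1) add_mon(2) False by (simp add: sum.remove[of _ i])
    finally show ?thesis unfolding pd_mon_add[OF assms(1) add_mon(1,2)]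
      using add_mon by (intro hpoly.add_mon) auto
  qed
qed

lemma pd_commute:
  assumes "i < m" "j < m" "hpoly m d P"
  shows "pd i (pd j P) = pd j (pd i P)"
  using assms(3)
proof (induction rule: hpoly.induct)
  case zero
  have "pd i (\<lambda>_. 0) = (\<lambda>_. 0)" for i by auto
  then show ?case by simp
next
  case (add_mon P \<alpha> c)
  have *: "pd i (pd j (\<lambda>x. c * mon m \<alpha> x + P x)) x =
     c * of_nat (\<alpha> j) * of_nat ((\<alpha>(j := \<alpha> j - 1)) i) * mon m (\<alpha>(j := \<alpha> j - 1, i := (\<alpha>(j := \<alpha> j - 1)) i - 1)) x
      + pd i (pd j P) x" if ij: "i < m" "j < m" for i j x
  proof -
    have h: "hpoly m (d - 1) (pd j P)" using hpoly_pd[OF ij(2) add_mon(1)] .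
    have hm: "hpoly m e (\<lambda>x. 1 * mon m \<beta> x)" if "e = sum \<beta> {..<m}" for \<beta> e
      using hpoly_mon that by blast
    have "pd i (\<lambda>x. c * of_nat (\<alpha> j) * mon m (\<alpha>(j := \<alpha> j - 1)) x + pd j P x) x =
      pd i (\<lambda>x. c * of_nat (\<alpha> j) * mon m (\<alpha>(j := \<alpha> j - 1)) x) x + pd i (pd j P) x"
      by (rule pd_add[OF ij(1) hpoly_mon[OF refl] h])
    also have "pd i (\<lambda>x. c * of_nat (\<alpha> j) * mon m (\<alpha>(j := \<alpha> j - 1)) x) x =
       c * of_nat (\<alpha> j) * pd i (mon m (\<alpha>(j := \<alpha> j - 1))) x"
      using pd_scale[OF ij(1) hm[OF refl]] by simp
    finally show ?thesis
      unfolding pd_mon_add[OF ij(2) add_mon(1,2)] pd_mon[OF ij(1)] by (simp only: mult.assoc)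
  qed
  show ?case using *[OF assms(1,2)] *[OF assms(2,1)] add_mon.IH
    by (cases "i = j") (auto simp: fun_eq_iff fun_upd_twist)
qed

lemma euler_identity:
  assumes "hpoly m d P"
  shows "(\<Sum>i<m. complex_of_real (x i) * pd i P x) = of_nat d * P x"
  using assms
proof (induction rule: hpoly.induct)
  case (add_mon P \<alpha> c)
  have 1: "complex_of_real (x i) * (of_nat (\<alpha> i) * mon m (\<alpha>(i := \<alpha> i - 1)) x) = of_nat (\<alpha> i) * mon m \<alpha> x"
    if "i < m" for i
  proof (cases "\<alpha> i")
    case (Suc n)
    have split: "(\<Prod>j<m. g j) = g i * (\<Prod>j\<in>{..<m}-{i}. g j)" for g :: "nat \<Rightarrow> complex"
      using that by (simp add: prod.remove)
    have "(\<Prod>j\<in>{..<m}-{i}. complex_of_real (x j) ^ (\<alpha>(i := n)) j) = (\<Prod>j\<in>{..<m}-{i}. complex_of_real (x j) ^ \<alpha> j)"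
      by (intro prod.cong) auto
    then show ?thesis unfolding mon_def split using Suc by (simp add: algebra_simps)
  qed simp
  have "(\<Sum>i<m. complex_of_real (x i) * pd i (\<lambda>x. c * mon m \<alpha> x + P x) x) =
    (\<Sum>i<m. c * (complex_of_real (x i) * (of_nat (\<alpha> i) * mon m (\<alpha>(i := \<alpha> i - 1)) x)) + complex_of_real (x i) * pd i P x)"
    using fun_cong[OF pd_mon_add[OF _ add_mon(1,2)], of _ c x]
    by (intro sum.cong refl) (simp only: lessThan_iff distrib_left mult_ac)
  also have "\<dots> = (\<Sum>i<m. c * (of_nat (\<alpha> i) * mon m \<alpha> x)) + of_nat d * P x"
    unfolding sum.distrib add_mon.IH using 1 by (intro arg_cong2[where f="(+)"] sum.cong refl) auto
  also have "(\<Sum>i<m. c * (of_nat (\<alpha> i) * mon m \<alpha> x)) = of_nat d * (c * mon m \<alpha> x)"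
    unfolding add_mon(2)[symmetric] of_nat_sum sum_distrib_right by (intro sum.cong) (auto simp: algebra_simps)
  finally show ?case by (simp add: algebra_simps)
qed simp

section \<open>Gaussian integrals of polynomials\<close>

definition gauss :: "nat \<Rightarrow> (nat \<Rightarrow> real) \<Rightarrow> complex" where
  "gauss m x = complex_of_real (exp (- (vnorm m x)\<^sup>2 / 2))"

definition gint :: "nat \<Rightarrow> ((nat \<Rightarrow> real) \<Rightarrow> complex) \<Rightarrow> complex" where
  "gint m P = integral\<^sup>L (lebm m) (\<lambda>x. P x * gauss m x)"

lemma gauss_prod: "gauss m x = (\<Prod>i<m. complex_of_real (exp (- (x i)\<^sup>2 / 2)))"
  by (simp add: gauss_def vnorm_sq exp_sum[symmetric] of_real_prod[symmetric]
      sum_negf[symmetric] sum_divide_distrib del: of_real_prod)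

interpretation lebm: product_sigma_finite "\<lambda>_::nat. lborel :: real measure"
  by standard

definition moment :: "nat \<Rightarrow> complex" where
  "moment k = integral\<^sup>L lborel (\<lambda>t. complex_of_real t ^ k * complex_of_real (exp (- t\<^sup>2 / 2)))"

lemma moment_eq_real:
  "(\<lambda>t. complex_of_real t ^ k * complex_of_real (exp (- t\<^sup>2 / 2))) =
   (\<lambda>t. complex_of_real (sqrt (2 * pi) * (std_normal_density t * t ^ k)))"
  by (auto simp: std_normal_density_def fun_eq_iff real_sqrt_mult)

lemma integrable_moment:
  "integrable lborel (\<lambda>t. complex_of_real t ^ k * complex_of_real (exp (- t\<^sup>2 / 2)))"
  unfolding moment_eq_real
  by (intro integrable_of_real integrable_mult_right integrable_std_normal_moment)

lemma moment_eq: "moment k = complex_of_real (sqrt (2 * pi) * integral\<^sup>L lborel (\<lambda>t. std_normal_density t * t ^ k))"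
  unfolding moment_def moment_eq_real integral_complex_of_real by simp

lemma moment_even: "moment (2 * k) = complex_of_real (sqrt (2 * pi) * (fact (2 * k) / (2 ^ k * fact k)))"
  unfolding moment_eq integral_std_normal_moment_even ..

lemma moment_odd: "moment (2 * k + 1) = 0"
  unfolding moment_eq integral_std_normal_moment_odd by simp

text \<open>Stein's identity in dimension one, read off from the closed form of the normal moments:
  for even \<open>k\<close> both sides vanish, for odd \<open>k\<close> it is a quotient of
  factorials. At \<open>k = 0\<close> the truncated index is multiplied by 0.\<close>

lemma moment_Suc: "moment (Suc k) = of_nat k * moment (k - 1)"
proof (cases "even k")
  case True
  then obtain j where j: "k = 2 * j" by blast
  show ?thesis
  proof (cases j)
    case 0
    then show ?thesis using moment_odd[of 0] j by simp
  next
    case (Suc i)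
    then show ?thesis using moment_odd[of j] moment_odd[of i] j by simp
  qed
next
  case False
  then obtain j where j: "k = 2 * j + 1" using oddE by blast
  have "fact (2 * j + 2) / (2 ^ (j + 1) * fact (j + 1)) =
      (2 * real j + 1) * (fact (2 * j) / (2 ^ j * fact j))"
      proof -
    have 1: "fact (2 * j + 2) = (2 * real j + 2) * ((2 * real j + 1) * fact (2 * j))"
      and 2: "2 ^ (j + 1) * fact (j + 1) = (2 * real j + 2) * (2 ^ j * fact j)"
      by (simp_all add: algebra_simps)
    have 3: "2 * real j + 2 \<noteq> 0" by linarith
    show ?thesis unfolding 1 2 mult_divide_mult_cancel_left[OF 3] times_divide_eq_right ..
  qed
  then show ?thesis using moment_even[of j] moment_even[of "j + 1"] j
    by (simp add: algebra_simps)
qed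

lemma mon_gauss: "mon m \<alpha> x * gauss m x =
    (\<Prod>i<m. complex_of_real (x i) ^ \<alpha> i * complex_of_real (exp (- (x i)\<^sup>2 / 2)))"
  by (simp add: mon_def gauss_prod prod.distrib)

lemma integrable_mon_gauss: "integrable (lebm m) (\<lambda>x. mon m \<alpha> x * gauss m x)"
  unfolding lebm_def mon_gauss by (intro lebm.product_integrable_prod integrable_moment) simp

lemma gint_mon: "gint m (mon m \<alpha>) = (\<Prod>i<m. moment (\<alpha> i))"
  unfolding gint_def lebm_def mon_gauss moment_def
  by (intro lebm.product_integral_prod integrable_moment) simp

lemma integrable_hpoly_gauss: "hpoly m d P \<Longrightarrow> integrable (lebm m) (\<lambda>x. P x * gauss m x)"
proof (induction rule: hpoly.induct)
  case (add_mon P \<alpha> c)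
  have "integrable (lebm m) (\<lambda>x. c * (mon m \<alpha> x * gauss m x) + P x * gauss m x)"
    using add_mon integrable_mon_gauss by (intro Bochner_Integration.integrable_add integrable_mult_right)
  then show ?case by (simp add: algebra_simps)
qed simp

lemma gint_add: "hpoly m d P \<Longrightarrow> hpoly m e Q \<Longrightarrow> gint m (\<lambda>x. P x + Q x) = gint m P + gint m Q"
  unfolding gint_def by (simp add: distrib_right integrable_hpoly_gauss)

lemma gint_scale: "gint m (\<lambda>x. c * P x) = c * gint m P"
  unfolding gint_def by (simp add: mult.assoc)

lemma gint_minus: "gint m (\<lambda>x. - P x) = - gint m P"
  using gint_scale[of m "-1" P] by simp

lemma gint_0 [simp]: "gint m (\<lambda>x. 0) = 0"
  by (simp add: gint_def)

lemma gint_diff: "hpoly m d P \<Longrightarrow> hpoly m e Q \<Longrightarrow> gint m (\<lambda>x. P x - Q x) = gint m P - gint m Q"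
  using gint_add[OF _ hpoly_minus, of m d P e Q] by (simp add: gint_minus)

lemma gint_sum:
  "(\<And>i. i \<in> I \<Longrightarrow> hpoly m (d i) (P i)) \<Longrightarrow> gint m (\<lambda>x. \<Sum>i\<in>I. P i x) = (\<Sum>i\<in>I. gint m (P i))"
  unfolding gint_def sum_distrib_right
  by (rule Bochner_Integration.integral_sum) (rule integrable_hpoly_gauss)

lemma gint_one: "gint m (\<lambda>_. 1) = complex_of_real (sqrt (2 * pi) ^ m)"
  using gint_mon[of m "\<lambda>_. 0"] moment_even[of 0] by (simp add: mon_def[abs_def])

text \<open>Integration by parts against the Gaussian. The integral of a monomial is a product of
  moments in which only the \<open>i\<close>-th factor changes, so \<open>moment_Suc\<close>
  replaces any treatment of boundary terms.\<close>

lemma stein: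
  assumes "hpoly m d P" "i < m"
  shows "gint m (\<lambda>x. complex_of_real (x i) * P x) = gint m (pd i P)"
  using assms(1)
proof (induction rule: hpoly.induct)
  case zero
  have "pd i (\<lambda>_. 0) = (\<lambda>_. 0)" by auto
  then show ?case by simp
next
  case (add_mon P \<alpha> c)
  have split: "(\<Prod>j<m. g j) = g i * (\<Prod>j\<in>{..<m}-{i}. g j)" for g :: "nat \<Rightarrow> complex"
    using assms(2) by (simp add: prod.remove)
  have 1: "complex_of_real (x i) * mon m \<alpha> x = mon m (\<alpha>(i := Suc (\<alpha> i))) x" for x
    unfolding mon_def split by (auto simp: mult.assoc intro!: arg_cong2[where f="(*)"] prod.cong)
  have 2: "gint m (mon m (\<alpha>(i := Suc (\<alpha> i)))) = of_nat (\<alpha> i) * gint m (mon m (\<alpha>(i := \<alpha> i - 1)))"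
  proof -
    have "(\<Prod>j\<in>{..<m} - {i}. moment ((\<alpha>(i := k)) j)) = (\<Prod>j\<in>{..<m} - {i}. moment (\<alpha> j))" for k
      by (intro prod.cong) auto
    then show ?thesis unfolding gint_mon split by (simp add: moment_Suc)
  qed
  have h: "hpoly m (sum \<beta> {..<m}) (\<lambda>x. b * mon m \<beta> x)" for b \<beta> by (rule hpoly_mon) simp
  have "gint m (\<lambda>x. complex_of_real (x i) * (c * mon m \<alpha> x + P x)) =
     gint m (\<lambda>x. c * mon m (\<alpha>(i := Suc (\<alpha> i))) x + complex_of_real (x i) * P x)"
    by (intro arg_cong[where f="gint m"] ext) (simp add: 1[symmetric] algebra_simps)
  also have "\<dots> = c * (of_nat (\<alpha> i) * gint m (mon m (\<alpha>(i := \<alpha> i - 1)))) + gint m (pd i P)"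
    using gint_add[OF h hpoly_coord_mult[OF assms(2) add_mon(1)]] 2 add_mon.IH by (simp add: gint_scale)
  also have "\<dots> = gint m (\<lambda>x. c * of_nat (\<alpha> i) * mon m (\<alpha>(i := \<alpha> i - 1)) x + pd i P x)"
    using gint_add[OF h hpoly_pd[OF assms(2) add_mon(1)], of "c * of_nat (\<alpha> i)"] by (simp add: gint_scale mult.assoc)
  finally show ?case unfolding pd_mon_add[OF assms(2) add_mon(1,2)] .
qed

text \<open>Stein's identity turns \<open>x\<^sub>i * (x\<^sub>i * P)\<close> into
  \<open>x\<^sub>i * pd i P + P\<close>. Summed over \<open>i\<close>, the first part contributes
  \<open>d\<close> by Euler's identity and the second contributes \<open>m\<close>.\<close>

lemma gint_normsq:
  assumes "hpoly m d P"
  shows "gint m (\<lambda>x. complex_of_real ((vnorm m x)\<^sup>2) * P x) = of_nat (d + m) * gint m P"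
proof -
  have h: "hpoly m (Suc d) (\<lambda>x. complex_of_real (x i) * P x)" if "i < m" for i
    using hpoly_coord_mult[OF that assms] .
  have pd1: "pd i (\<lambda>x. complex_of_real (x i) * P x) = (\<lambda>x. complex_of_real (x i) * pd i P x + P x)" if "i < m" for i
    using pd_mult[OF that hpoly_coord[OF that] assms] by (simp add: pd_coord fun_eq_iff)
  have h2: "hpoly m (Suc (d - 1)) (\<lambda>x. complex_of_real (x i) * pd i P x)" if "i < m" for i
    by (rule hpoly_coord_mult[OF that hpoly_pd[OF that assms]])
  have "gint m (\<lambda>x. complex_of_real ((vnorm m x)\<^sup>2) * P x) =
      gint m (\<lambda>x. \<Sum>i<m. complex_of_real (x i) * (complex_of_real (x i) * P x))"
    unfolding vnorm_sq by (simp add: sum_distrib_right power2_eq_square mult.assoc)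
  also have "\<dots> = (\<Sum>i<m. gint m (\<lambda>x. complex_of_real (x i) * (complex_of_real (x i) * P x)))"
    by (rule gint_sum[of _ m "\<lambda>_. Suc (Suc d)"]) (auto intro: hpoly_coord_mult h)
  also have "\<dots> = (\<Sum>i<m. gint m (\<lambda>x. complex_of_real (x i) * pd i P x) + gint m P)"
    by (intro sum.cong refl) (auto simp: stein[OF h] pd1 gint_add[OF h2 assms])
  also have "\<dots> = gint m (\<lambda>x. \<Sum>i<m. complex_of_real (x i) * pd i P x) + of_nat m * gint m P"
    by (subst gint_sum[of _ m "\<lambda>_. Suc (d - 1)"]) (auto simp: sum.distrib h2 simp del: One_nat_def)
  also have "\<dots> = of_nat (d + m) * gint m P"
    by (simp add: euler_identity[OF assms] gint_scale algebra_simps)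
  finally show ?thesis .
qed

text \<open>Each factor |x|^2 raises the degree by 2, so the factors are d + m, d + m + 2, and so
  on. This plays the role of the radial Gamma integral in polar coordinates.\<close>

lemma gint_normsq_power:
  assumes "hpoly m d P"
  shows "gint m (\<lambda>x. complex_of_real ((vnorm m x)\<^sup>2) ^ j * P x) =
     complex_of_real (2 ^ j * pochhammer (real (d + m) / 2) j) * gint m P"
proof (induction j)
  case (Suc j)
  have "hpoly m (j * 2 + d) (\<lambda>x. complex_of_real ((vnorm m x)\<^sup>2) ^ j * P x)"
    by (intro hpoly_mult hpoly_power hpoly_normsq assms)
  from gint_normsq[OF this]
  have "gint m (\<lambda>x. complex_of_real ((vnorm m x)\<^sup>2) ^ Suc j * P x) =
     of_nat (j * 2 + d + m) * (complex_of_real (2 ^ j * pochhammer (real (d + m) / 2) j) * gint m P)"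
    unfolding Suc by (simp add: mult.assoc)
  moreover have "real (j * 2 + d + m) * (2 ^ j * pochhammer (real (d + m) / 2) j)
      = 2 ^ Suc j * pochhammer (real (d + m) / 2) (Suc j)"
    by (simp add: pochhammer_Suc field_simps)
  then have "complex_of_real (real (j * 2 + d + m)) * complex_of_real (2 ^ j * pochhammer (real (d + m) / 2) j)
      = complex_of_real (2 ^ Suc j * pochhammer (real (d + m) / 2) (Suc j))"
    by (metis of_real_mult)
  ultimately show ?case by (simp only: mult.assoc[symmetric] of_real_of_nat_eq)
qed simp

section \<open>Harmonic polynomials against powers of the inner product\<close>

definition harmonic :: "nat \<Rightarrow> ((nat \<Rightarrow> real) \<Rightarrow> complex) \<Rightarrow> bool" where
  "harmonic m P \<longleftrightarrow> (\<forall>x. (\<Sum>i<m. pd i (pd i P) x) = 0)"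

text \<open>Euler's identity writes \<open>d * P\<close> as the sum of
  \<open>x\<^sub>i * pd i P\<close>, and Stein's identity turns the integral of that sum into the
  integral of the Laplacian.\<close>

lemma gint_harmonic_eq_0:
  assumes "hpoly m d P" "harmonic m P" "d > 0"
  shows "gint m P = 0"
proof -
  have h: "hpoly m d (\<lambda>x. complex_of_real (x i) * pd i P x)" if "i < m" for i
    using hpoly_coord_mult[OF that hpoly_pd[OF that assms(1)]] assms(3) by simp
  have "of_nat d * gint m P = gint m (\<lambda>x. \<Sum>i<m. complex_of_real (x i) * pd i P x)"
    by (simp add: euler_identity[OF assms(1)] gint_scale)
  also have "\<dots> = (\<Sum>i<m. gint m (\<lambda>x. complex_of_real (x i) * pd i P x))"
    by (rule gint_sum[of _ m "\<lambda>_. d"]) (auto intro: h)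
  also have "\<dots> = (\<Sum>i<m. gint m (pd i (pd i P)))"
    by (intro sum.cong refl stein[OF hpoly_pd[OF _ assms(1)]]) auto
  also have "\<dots> = gint m (\<lambda>x. \<Sum>i<m. pd i (pd i P) x)"
    by (rule gint_sum[of _ m "\<lambda>_. d - 1 - 1", symmetric]) (rule hpoly_pd[OF _ hpoly_pd[OF _ assms(1)]], auto)
  also have "\<dots> = 0" using assms(2) by (simp add: harmonic_def)
  finally show ?thesis using assms(3) by simp
qed

definition dirder :: "nat \<Rightarrow> (nat \<Rightarrow> real) \<Rightarrow> ((nat \<Rightarrow> real) \<Rightarrow> complex) \<Rightarrow> (nat \<Rightarrow> real) \<Rightarrow> complex" where
  "dirder m y P x = (\<Sum>i<m. complex_of_real (y i) * pd i P x)"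

lemma hpoly_dirder: "hpoly m d P \<Longrightarrow> hpoly m (d - 1) (dirder m y P)"
  unfolding dirder_def by (intro hpoly_sum hpoly_scale hpoly_pd) auto

lemma pd_dirder: "hpoly m d P \<Longrightarrow> j < m \<Longrightarrow> pd j (dirder m y P) = dirder m y (pd j P)"
proof
  fix x assume P: "hpoly m d P" and j: "j < m"
  have h: "hpoly m (d - 1) (pd i P)" if "i < m" for i by (rule hpoly_pd[OF that P])
  have "pd j (\<lambda>x. \<Sum>i<m. complex_of_real (y i) * pd i P x) x =
     (\<Sum>i<m. pd j (\<lambda>x. complex_of_real (y i) * pd i P x) x)"
    by (rule pd_sum[OF j, of _ "d - 1"]) (rule hpoly_scale[OF h], simp)
  also have "\<dots> = (\<Sum>i<m. complex_of_real (y i) * pd i (pd j P) x)"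
    using pd_scale[OF j h] pd_commute[OF _ j P] by (intro sum.cong) auto
  finally show "pd j (dirder m y P) x = dirder m y (pd j P) x"
    by (simp add: dirder_def[abs_def])
qed

text \<open>A derivative in a fixed direction has constant coefficients and commutes with the
  Laplacian. It keeps the induction in \<open>gint_inner_power\<close> within the harmonic
  polynomials.\<close>

lemma harmonic_dirder:
  assumes "hpoly m d P" "harmonic m P"
  shows "harmonic m (dirder m y P)"
proof -
  have h: "hpoly m (d - 1) (pd j P)" if "j < m" for j by (rule hpoly_pd[OF that assms(1)])
  have h2: "hpoly m (d - 1 - 1) (pd j (pd j P))" if "j < m" for j by (rule hpoly_pd[OF that h[OF that]])
  have lap: "(\<lambda>x. \<Sum>j<m. pd j (pd j P) x) = (\<lambda>_. 0)" using assms(2) by (simp add: harmonic_def fun_eq_iff)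
  have "(\<Sum>j<m. pd j (pd j (dirder m y P)) x) = 0" for x
  proof -
    have "(\<Sum>j<m. pd j (pd j (dirder m y P)) x) = (\<Sum>j<m. dirder m y (pd j (pd j P)) x)"
      by (intro sum.cong) (auto simp: pd_dirder[OF assms(1)] pd_dirder[OF h])
    also have "\<dots> = (\<Sum>i<m. complex_of_real (y i) * (\<Sum>j<m. pd i (pd j (pd j P)) x))"
      unfolding dirder_def sum_distrib_left by (rule sum.swap)
    also have "\<dots> = (\<Sum>i<m. complex_of_real (y i) * pd i (\<lambda>x. \<Sum>j<m. pd j (pd j P) x) x)"
      using h2 by (intro sum.cong refl arg_cong2[where f="(*)"] pd_sum[where d = "d - 1 - 1", symmetric]) auto
    also have "\<dots> = 0" unfolding lap by simp
    finally show ?thesis .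
  qed
  then show ?thesis by (simp add: harmonic_def)
qed

lemma pd_inner_power:
  assumes "i < m"
  shows "pd i (\<lambda>x. complex_of_real (vinner m x y) ^ n) x =
     of_nat n * complex_of_real (y i) * complex_of_real (vinner m x y) ^ (n - 1)"
proof -
  have 0: "pd i (\<lambda>x. complex_of_real (vinner m x y)) x = complex_of_real (y i)" for x
  proof -
    have "pd i (\<lambda>x. \<Sum>j<m. complex_of_real (y j) * complex_of_real (x j)) x = (\<Sum>j<m. complex_of_real (y j) * (if i = j then 1 else 0))"
      using pd_scale[OF assms hpoly_coord] by (subst pd_sum[OF assms, of _ 1]) (auto simp: pd_coord intro!: sum.cong hpoly_coord[unfolded One_nat_def] hpoly_scale)
    also have "\<dots> = complex_of_real (y i)" using assms by (simp add: if_distrib cong: if_cong)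
    finally show ?thesis by (simp add: vinner_def mult.commute)
  qed
  show ?thesis
  proof (induction n)
    case (Suc n)
    have "pd i (\<lambda>x. complex_of_real (vinner m x y) * complex_of_real (vinner m x y) ^ n) x =
      complex_of_real (vinner m x y) * (of_nat n * complex_of_real (y i) * complex_of_real (vinner m x y) ^ (n - 1)) +
       complex_of_real (y i) * complex_of_real (vinner m x y) ^ n"
      using pd_mult[OF assms hpoly_inner hpoly_power[OF hpoly_inner]] Suc 0 by simp
    then show ?case by (cases n) (simp_all add: algebra_simps)
  qed simp
qed

text \<open>\<open>fact d\<close> times the number of ways to pair up \<open>n\<close> points and
  leave \<open>d\<close> of them single: the Wick count for \<open>n\<close> factors <x,y>, of which
  \<open>d\<close> are used up on a harmonic polynomial of degree \<open>d\<close>.\<close>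

definition hcoef :: "nat \<Rightarrow> nat \<Rightarrow> real" where
  "hcoef d n = (if d \<le> n \<and> even (n - d) then fact n / (2 ^ ((n - d) div 2) * fact ((n - d) div 2)) else 0)"

text \<open>One of \<open>Suc n\<close> factors is singled out: it is paired with one of the
  \<open>n\<close> others, which produces \<open>v\<^sup>2\<close>, or it meets the polynomial and
  lowers its degree. The powers of \<open>v\<close> are part of the statement since a truncated
  exponent is wrong only where its coefficient vanishes.\<close>

lemma hcoef_rec:
  fixes v :: real
  shows "hcoef d (Suc n) * v ^ (Suc n - d) =
    real n * v\<^sup>2 * (hcoef d (n - 1) * v ^ (n - 1 - d)) + real d * (hcoef (d - 1) n * v ^ (n - (d - 1)))"
proof (cases "d \<le> Suc n \<and> even (Suc n - d)")
  case True
  then obtain i where i: "Suc n = d + 2 * i" by (metis dvdE le_add_diff_inverse)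
  show ?thesis
  proof (cases i)
    case 0
    then have d: "d = Suc n" using i by simp
    have "n = 0 \<or> hcoef d (n - 1) = 0" unfolding hcoef_def using d by auto
    then show ?thesis unfolding d by (auto simp: hcoef_def)
  next
    case (Suc l)
    have n: "n - 1 = d + 2 * l" "n = d + 2 * l + 1" using i Suc by auto
    have 1: "hcoef d (n - 1) = fact (n - 1) / (2 ^ l * fact l)" unfolding hcoef_def n(1) by simp
    have 2: "hcoef d (Suc n) = fact (Suc n) / (2 ^ Suc l * fact (Suc l))" unfolding hcoef_def i Suc by simp
    have 3: "real d * hcoef (d - 1) n = real d * (fact n / (2 ^ Suc l * fact (Suc l)))"
    proof (cases d)
      case (Suc e)
      then have "n - (d - 1) = 2 * Suc l" "d - 1 \<le> n" using n by auto
      then show ?thesis unfolding hcoef_def by simp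
    qed simp
    have e: "Suc n - d = 2 + (n - 1 - d)" "d > 0 \<Longrightarrow> n - (d - 1) = 2 + (n - 1 - d)" using n by auto
    have f: "fact n = real n * fact (n - 1)" using n(2) by (simp add: fact_reduce)
    have A: "hcoef d (Suc n) = real n * hcoef d (n - 1) + real d * hcoef (d - 1) n"
    proof -
      have *: "(b * (N * F)) / (c * B) = N * (F / B) + e * ((N * F) / (c * B))"
        if "B \<noteq> 0" "c \<noteq> 0" "b = e + c" for b c e N F B :: real
        using that by (simp add: field_simps)
      have e: "2 ^ Suc l * fact (Suc l) = (2 * real l + 2) * (2 ^ l * fact l)" by (simp add: algebra_simps)
      have "2 ^ l * fact l \<noteq> (0::real)" "2 * real l + 2 \<noteq> 0" by (simp_all add: add_nonneg_eq_0_iff)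
      moreover have "real (Suc n) = real d + (2 * real l + 2)" using n(2) by simp
      ultimately show ?thesis unfolding 1 2 3 fact_Suc[of n] f e by (intro *)
    qed
    have B: "real d * (hcoef (d - 1) n * v ^ (n - (d - 1))) = real d * hcoef (d - 1) n * v ^ (Suc n - d)"
      using e by (cases "d > 0") auto
    show ?thesis unfolding B unfolding A e(1) power_add by (simp add: algebra_simps)
  qed
next
  case False
  have 1: "hcoef d (Suc n) = 0" using False unfolding hcoef_def by auto
  have 2: "n = 0 \<or> hcoef d (n - 1) = 0" using False unfolding hcoef_def by (cases n) auto
  have 3: "d = 0 \<or> hcoef (d - 1) n = 0" using False unfolding hcoef_def by (cases d) auto
  show ?thesis using 1 2 3 by auto
qed

text \<open>One factor <x,y> is peeled off and turned by Stein's identity into the derivative in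
  direction \<open>y\<close>, which lowers either the power or the degree of \<open>P\<close>; the
  two cases match the two terms of \<open>hcoef_rec\<close>. The degree and the polynomial vary in
  the induction because \<open>P\<close> is replaced by \<open>dirder m y P\<close>.\<close>

lemma gint_inner_power:
  assumes "hpoly m d P" "harmonic m P"
  shows "gint m (\<lambda>x. complex_of_real (vinner m x y) ^ n * P x) =
     complex_of_real (hcoef d n * vnorm m y ^ (n - d)) * P y * gint m (\<lambda>_. 1)"
  using assms
proof (induction n arbitrary: d P rule: less_induct)
  case (less n)
  show ?case
  proof (cases n)
    case 0
    show ?thesis
    proof (cases "d = 0")
      case True
      with less.prems hpoly_0_const obtain c where "P = (\<lambda>_. c)" by blast
      then show ?thesis using 0 True gint_scale[of m c "\<lambda>_. 1"] by (simp add: hcoef_def)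
    next
      case False
      then show ?thesis using 0 gint_harmonic_eq_0[OF less.prems] by (simp add: hcoef_def)
    qed
  next
    case (Suc k)
    let ?s = "\<lambda>x. complex_of_real (vinner m x y)"
    have h: "hpoly m (k * 1 + d) (\<lambda>x. ?s x ^ k * P x)" for k
      by (intro hpoly_mult hpoly_power hpoly_inner less.prems)
    have hD: "hpoly m (k * 1 + (d - 1)) (\<lambda>x. ?s x ^ k * dirder m y P x)"
      by (intro hpoly_mult hpoly_power hpoly_inner hpoly_dirder less.prems)
    have pdP: "pd i (\<lambda>x. ?s x ^ k * P x) x = ?s x ^ k * pd i P x + of_nat k * complex_of_real (y i) * ?s x ^ (k - 1) * P x"
      if "i < m" for i x
      using pd_mult[OF that hpoly_power[OF hpoly_inner] less.prems(1)] pd_inner_power[OF that] by simp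
    have "gint m (\<lambda>x. ?s x ^ n * P x) = gint m (\<lambda>x. \<Sum>i<m. complex_of_real (y i) * (complex_of_real (x i) * (?s x ^ k * P x)))"
      unfolding Suc by (simp add: vinner_def sum_distrib_right sum_distrib_left mult_ac)
    also have "\<dots> = (\<Sum>i<m. gint m (\<lambda>x. complex_of_real (y i) * (complex_of_real (x i) * (?s x ^ k * P x))))"
      by (rule gint_sum[of _ m "\<lambda>_. Suc (k * 1 + d)"]) (intro hpoly_scale hpoly_coord_mult h, simp)
    also have "\<dots> = (\<Sum>i<m. gint m (\<lambda>x. complex_of_real (y i) * pd i (\<lambda>x. ?s x ^ k * P x) x))"
      unfolding gint_scale by (intro sum.cong refl) (simp add: stein[OF h])
    also have "\<dots> = gint m (\<lambda>x. \<Sum>i<m. complex_of_real (y i) * pd i (\<lambda>x. ?s x ^ k * P x) x)"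
      by (rule gint_sum[of _ m "\<lambda>_. k * 1 + d - 1", symmetric]) (intro hpoly_scale hpoly_pd h, simp)
    \<comment> \<open>The product rule: the derivative of <x,y> in direction \<open>y\<close> is
      |y|^2, which leaves the integral as a constant.\<close>
    also have "\<dots> = gint m (\<lambda>x. ?s x ^ k * dirder m y P x + of_nat k * complex_of_real ((vnorm m y)\<^sup>2) * (?s x ^ (k - 1) * P x))"
    proof (intro arg_cong[where f="gint m"] ext)
      fix x
      have "(\<Sum>i<m. complex_of_real (y i) * pd i (\<lambda>x. ?s x ^ k * P x) x) =
        (\<Sum>i<m. ?s x ^ k * (complex_of_real (y i) * pd i P x) + of_nat k * complex_of_real ((y i)\<^sup>2) * (?s x ^ (k - 1) * P x))"
        by (intro sum.cong refl) (subst pdP, simp, simp add: power2_eq_square algebra_simps)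
      then show "(\<Sum>i<m. complex_of_real (y i) * pd i (\<lambda>x. ?s x ^ k * P x) x) =
        ?s x ^ k * dirder m y P x + of_nat k * complex_of_real ((vnorm m y)\<^sup>2) * (?s x ^ (k - 1) * P x)"
        unfolding sum.distrib dirder_def vnorm_sq of_real_sum sum_distrib_left sum_distrib_right .
    qed
    also have "\<dots> = gint m (\<lambda>x. ?s x ^ k * dirder m y P x) +
        of_nat k * complex_of_real ((vnorm m y)\<^sup>2) * gint m (\<lambda>x. ?s x ^ (k - 1) * P x)"
      unfolding gint_add[OF hD hpoly_scale[OF h]] gint_scale ..
    also have "\<dots> = complex_of_real (hcoef (d - 1) k * vnorm m y ^ (k - (d - 1))) * dirder m y P y * gint m (\<lambda>_. 1) +
        of_nat k * complex_of_real ((vnorm m y)\<^sup>2) *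
          (complex_of_real (hcoef d (k - 1) * vnorm m y ^ (k - 1 - d)) * P y * gint m (\<lambda>_. 1))"
    proof (intro arg_cong2[where f="(+)"])
      show "gint m (\<lambda>x. ?s x ^ k * dirder m y P x) =
        complex_of_real (hcoef (d - 1) k * vnorm m y ^ (k - (d - 1))) * dirder m y P y * gint m (\<lambda>_. 1)"
        using Suc by (intro less.IH hpoly_dirder harmonic_dirder[OF less.prems] less.prems) auto
      show "of_nat k * complex_of_real ((vnorm m y)\<^sup>2) * gint m (\<lambda>x. ?s x ^ (k - 1) * P x) =
        of_nat k * complex_of_real ((vnorm m y)\<^sup>2) *
          (complex_of_real (hcoef d (k - 1) * vnorm m y ^ (k - 1 - d)) * P y * gint m (\<lambda>_. 1))"
        using less.IH[OF _ less.prems, of "k - 1"] Suc by (cases k) auto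
    qed
    \<comment> \<open>Euler's identity at the point \<open>y\<close> itself: the derivative of
      \<open>P\<close> at \<open>y\<close> in direction \<open>y\<close> is \<open>d\<close> times
      \<open>P y\<close>. This brings both terms back to the same polynomial.\<close>
    also have "\<dots> = complex_of_real (real k * (vnorm m y)\<^sup>2 * (hcoef d (k - 1) * vnorm m y ^ (k - 1 - d))
        + real d * (hcoef (d - 1) k * vnorm m y ^ (k - (d - 1)))) * P y * gint m (\<lambda>_. 1)"
      using euler_identity[OF less.prems(1), of y] by (simp add: dirder_def algebra_simps)
    finally show ?thesis unfolding Suc hcoef_rec by simp
  qed
qed

section \<open>Clifford multiplication and monogenic polynomials\<close>

definition flip :: "nat \<Rightarrow> nat set \<Rightarrow> nat set" where
  "flip j C = (if j \<in> C then C - {j} else insert j C)"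

definition gsgn :: "nat \<Rightarrow> nat set \<Rightarrow> complex" where
  "gsgn j B = (-1) ^ (card {b \<in> B. b < j} + (if j \<in> B then 1 else 0))"

text \<open>Left multiplication by a generator on coefficients: the blade \<open>C\<close> is
  reached from the single blade \<open>flip j C\<close>, so the sum in \<open>cl_mult\<close>
  collapses. Products with a vector or a bivector on the left reduce to combinations of such
  maps.\<close>

definition gen_mult :: "nat \<Rightarrow> nat \<Rightarrow> cl \<Rightarrow> cl" where
  "gen_mult m j v = (\<lambda>C. if C \<subseteq> {..<m} then gsgn j (flip j C) * v (flip j C) else 0)"

definition vec_mult :: "nat \<Rightarrow> (nat \<Rightarrow> real) \<Rightarrow> cl \<Rightarrow> cl" where
  "vec_mult m x v = (\<lambda>C. \<Sum>j<m. complex_of_real (x j) * gen_mult m j v C)"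

lemma flip_flip [simp]: "flip j (flip j C) = C"
  by (auto simp: flip_def)

lemma flip_commute: "flip i (flip j C) = flip j (flip i C)"
  by (auto simp: flip_def)

lemma mem_flip: "i \<in> flip j C \<longleftrightarrow> (if i = j then i \<notin> C else i \<in> C)"
  by (auto simp: flip_def)

lemma flip_subset: "j < m \<Longrightarrow> flip j C \<subseteq> {..<m} \<longleftrightarrow> C \<subseteq> {..<m}"
  by (auto simp: flip_def)

lemma flip_conv_symdiff: "({j} - C) \<union> (C - {j}) = flip j C"
  by (auto simp: flip_def)

lemma flip_flip_conv_symdiff: "j \<noteq> k \<Longrightarrow> ({j, k} - C) \<union> (C - {j, k}) = flip j (flip k C)"
  by (auto simp: flip_def)

lemma gsgn_flip_same: "gsgn j (flip j B) = - gsgn j B"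
proof -
  have "{b \<in> flip j B. b < j} = {b \<in> B. b < j}" by (auto simp: mem_flip)
  then show ?thesis by (auto simp: gsgn_def mem_flip)
qed

lemma gsgn_flip_greater: "i < j \<Longrightarrow> gsgn i (flip j B) = gsgn i B"
proof -
  assume "i < j"
  then have "{b \<in> flip j B. b < i} = {b \<in> B. b < i}" by (auto simp: mem_flip)
  then show ?thesis using \<open>i < j\<close> by (auto simp: gsgn_def mem_flip)
qed

lemma gsgn_flip_less:
  assumes "i < j"
  shows "gsgn j (flip i B) = - gsgn j B"
proof (cases "i \<in> B")
  case True
  then have "{b \<in> B. b < j} = insert i {b \<in> flip i B. b < j}" "i \<notin> {b \<in> flip i B. b < j}"
    using assms by (auto simp: mem_flip)
  then have "card {b \<in> B. b < j} = Suc (card {b \<in> flip i B. b < j})" by simp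
  then show ?thesis using assms by (auto simp: gsgn_def mem_flip)
next
  case False
  then have "{b \<in> flip i B. b < j} = insert i {b \<in> B. b < j}" "i \<notin> {b \<in> B. b < j}"
    using assms by (auto simp: mem_flip)
  then have "card {b \<in> flip i B. b < j} = Suc (card {b \<in> B. b < j})" by simp
  then show ?thesis using assms by (auto simp: gsgn_def mem_flip)
qed

lemma gsgn_sq: "gsgn j B * gsgn j B = 1"
  unfolding gsgn_def by (rule minus_one_mult_self)

lemma cl_sign_single: "cl_sign {j} B = gsgn j B"
proof -
  have "{(a, b). a \<in> {j} \<and> b \<in> B \<and> b < a} = Pair j ` {b \<in> B. b < j}" by auto
  then have 1: "card {(a, b). a \<in> {j} \<and> b \<in> B \<and> b < a} = card {b \<in> B. b < j}"
    by (simp add: card_image inj_on_def)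
  show ?thesis unfolding cl_sign_def gsgn_def 1 by (simp add: Int_insert_left)
qed

text \<open>The inversions are counted separately for \<open>j\<close> and \<open>k\<close>. Both
  signs are taken at the same \<open>B\<close>, because multiplying by the larger generator first
  does not alter the number of elements below \<open>j\<close>.\<close>

lemma cl_sign_pair:
  assumes "j < k"
  shows "cl_sign {j, k} B = gsgn j B * gsgn k B"
proof -
  have "{(a, b). a \<in> {j, k} \<and> b \<in> B \<and> b < a} = Pair j ` {b \<in> B. b < j} \<union> Pair k ` {b \<in> B. b < k}" by auto
  moreover have "card (Pair j ` {b \<in> B. b < j} \<union> Pair k ` {b \<in> B. b < k}) =
      card (Pair j ` {b \<in> B. b < j}) + card (Pair k ` {b \<in> B. b < k})"
    using assms by (intro card_Un_disjoint) auto
  ultimately have 1: "card {(a, b). a \<in> {j, k} \<and> b \<in> B \<and> b < a} = card {b \<in> B. b < j} + card {b \<in> B. b < k}"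
    by (simp add: card_image inj_on_def)
  show ?thesis unfolding cl_sign_def gsgn_def 1 using assms by (simp add: Int_insert_left power_add)
qed

lemma cl_mult_gen:
  assumes "j < m"
  shows "cl_mult m (cl_gen j) v = gen_mult m j v"
proof
  fix C
  have "(\<Sum>A\<in>Pow {..<m}. cl_sign A ((A - C) \<union> (C - A)) * cl_gen j A * v ((A - C) \<union> (C - A))) =
     (\<Sum>A\<in>Pow {..<m}. if A = {j} then cl_sign {j} (flip j C) * v (flip j C) else 0)"
    by (intro sum.cong refl) (auto simp: cl_gen_def flip_conv_symdiff)
  also have "\<dots> = gsgn j (flip j C) * v (flip j C)"
    using assms by (simp add: sum.delta cl_sign_single)
  finally show "cl_mult m (cl_gen j) v C = gen_mult m j v C"
    by (simp add: cl_mult_def gen_mult_def)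
qed

lemma cl_mult_sum_left:
  "cl_mult m (\<lambda>A. \<Sum>i\<in>I. c i * u i A) v = (\<lambda>C. \<Sum>i\<in>I. c i * cl_mult m (u i) v C)"
proof
  fix C
  have "(\<Sum>A\<in>Pow {..<m}. cl_sign A (A - C \<union> (C - A)) * (\<Sum>i\<in>I. c i * u i A) * v (A - C \<union> (C - A))) =
     (\<Sum>A\<in>Pow {..<m}. \<Sum>i\<in>I. c i * (cl_sign A (A - C \<union> (C - A)) * u i A * v (A - C \<union> (C - A))))"
    by (simp add: sum_distrib_left sum_distrib_right mult_ac)
  also have "\<dots> = (\<Sum>i\<in>I. c i * (\<Sum>A\<in>Pow {..<m}. cl_sign A (A - C \<union> (C - A)) * u i A * v (A - C \<union> (C - A))))"
    by (subst sum.swap) (simp add: sum_distrib_left)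
  finally show "cl_mult m (\<lambda>A. \<Sum>i\<in>I. c i * u i A) v C = (\<Sum>i\<in>I. c i * cl_mult m (u i) v C)"
    by (simp add: cl_mult_def)
qed

lemma cl_mult_vec: "cl_mult m (cl_vec m x) v = vec_mult m x v"
  unfolding cl_vec_def cl_mult_sum_left vec_mult_def by (simp add: cl_mult_gen)

lemma vec_mult_eq_0: "\<not> C \<subseteq> {..<m} \<Longrightarrow> vec_mult m x v C = 0"
  by (simp add: vec_mult_def gen_mult_def)

lemma cl_valued_vec_mult: "cl_valued m (vec_mult m x v)"
  by (simp add: cl_valued_def vec_mult_eq_0)

lemma gen_mult_gen_mult_same:
  "j < m \<Longrightarrow> cl_valued m v \<Longrightarrow> gen_mult m j (gen_mult m j v) C = - v C"
  by (auto simp: gen_mult_def cl_valued_def flip_subset gsgn_flip_same gsgn_sq mult.assoc[symmetric])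

lemma gen_mult_gen_mult_less:
  "i < j \<Longrightarrow> j < m \<Longrightarrow> C \<subseteq> {..<m} \<Longrightarrow> gen_mult m i (gen_mult m j v) C =
     gsgn i (flip i (flip j C)) * gsgn j (flip i (flip j C)) * v (flip i (flip j C))"
  using gsgn_flip_greater[of i j "flip i C"]
  by (simp add: gen_mult_def flip_subset flip_commute[of j i])

text \<open>Flipping the smaller index changes by one the number of elements below the larger index,
  while flipping the larger one leaves the count for the smaller unchanged; the two orders hence
  differ by exactly one sign.\<close>

lemma gen_mult_anticommute:
  assumes "i \<noteq> j" "i < m" "j < m"
  shows "gen_mult m i (gen_mult m j v) C = - gen_mult m j (gen_mult m i v) C"
proof -
  have "gen_mult m i (gen_mult m j v) C = - gen_mult m j (gen_mult m i v) C" if "i < j" "j < m" for i j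
    using that
    by (auto simp: gen_mult_def flip_subset gsgn_flip_same gsgn_flip_less gsgn_flip_greater flip_commute[of j i])
  from this[of i j] this[of j i] assms show ?thesis by (cases "i < j") auto
qed

text \<open>Groups a double sum by unordered pairs and the diagonal, the form in which products of
  anticommuting generators combine or cancel.\<close>

lemma sum_square_split:
  fixes f :: "nat \<Rightarrow> nat \<Rightarrow> 'a::comm_monoid_add"
  shows "(\<Sum>j<m. \<Sum>k<m. f j k) = (\<Sum>k<m. (\<Sum>j<k. f j k + f k j) + f k k)"
proof (induction m)
  case (Suc m)
  have "(\<Sum>j<Suc m. \<Sum>k<Suc m. f j k) = (\<Sum>j<m. \<Sum>k<m. f j k) + ((\<Sum>j<m. f j m + f m j) + f m m)"
    by (simp add: sum.distrib add_ac)
  then show ?case unfolding Suc.IH by simp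
qed simp

lemma gen_mult_sum: "gen_mult m j (\<lambda>C. \<Sum>k\<in>I. c k * v k C) C = (\<Sum>k\<in>I. c k * gen_mult m j (v k) C)"
  by (simp add: gen_mult_def sum_distrib_left mult_ac)

lemma gen_mult_scale: "gen_mult m j (\<lambda>C. c * v C) C = c * gen_mult m j v C"
  by (simp add: gen_mult_def)

lemma vec_mult_scale: "vec_mult m x (\<lambda>C. c * v C) C = c * vec_mult m x v C"
  by (simp add: vec_mult_def gen_mult_scale sum_distrib_left mult_ac)

text \<open>The Clifford relation y x = - <x,y> - (x wedge y), solved for the wedge. The order with
  \<open>y\<close> outermost is the useful one: that factor is constant in \<open>x\<close> and can
  be taken out of the integral.\<close>

lemma wedge_mult:
  assumes "cl_valued m v"
  shows "cl_mult m (cl_wedge m x y) v C =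
     - vec_mult m y (vec_mult m x v) C - complex_of_real (vinner m x y) * v C"
proof (cases "C \<subseteq> {..<m}")
  case True
  let ?S = "\<lambda>j k. gen_mult m j (gen_mult m k v) C"
  have 1: "cl_mult m (\<lambda>A. if A = {j, k} then 1 else 0) v C = ?S j k" if "j < k" "k < m" for j k
  proof -
    have "(\<Sum>A\<in>Pow {..<m}. cl_sign A ((A - C) \<union> (C - A)) * (if A = {j, k} then 1 else 0) * v ((A - C) \<union> (C - A))) =
       (\<Sum>A\<in>Pow {..<m}. if A = {j, k} then cl_sign {j, k} (flip j (flip k C)) * v (flip j (flip k C)) else 0)"
      by (intro sum.cong refl) (use that flip_flip_conv_symdiff[of j k C] in auto)
    also have "\<dots> = cl_sign {j, k} (flip j (flip k C)) * v (flip j (flip k C))"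
      using that by simp
    also have "\<dots> = ?S j k"
      unfolding cl_sign_pair[OF that(1)] gen_mult_gen_mult_less[OF that True] ..
    finally show ?thesis unfolding cl_mult_def using True by simp
  qed
  have W: "cl_mult m (cl_wedge m x y) v C = (\<Sum>k<m. \<Sum>j<k. complex_of_real (x j * y k - x k * y j) * ?S j k)"
  proof -
    have "cl_mult m (\<lambda>A. \<Sum>k<m. 1 * (\<Sum>j<k. complex_of_real (x j * y k - x k * y j) * (if A = {j, k} then 1 else 0))) v C =
      (\<Sum>k<m. 1 * (\<Sum>j<k. complex_of_real (x j * y k - x k * y j) * cl_mult m (\<lambda>A. if A = {j, k} then 1 else 0) v C))"
      unfolding cl_mult_sum_left ..
    also have "\<dots> = (\<Sum>k<m. \<Sum>j<k. complex_of_real (x j * y k - x k * y j) * ?S j k)"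
      unfolding mult_1 by (intro sum.cong refl) (auto simp: 1)
    finally show ?thesis unfolding cl_wedge_def mult_1 .
  qed
  have "vec_mult m y (vec_mult m x v) C = (\<Sum>j<m. \<Sum>k<m. complex_of_real (y j * x k) * ?S j k)"
    by (simp add: vec_mult_def gen_mult_sum sum_distrib_left mult.assoc)
  then have "vec_mult m y (vec_mult m x v) C =
     (\<Sum>k<m. (\<Sum>j<k. complex_of_real (y j * x k) * ?S j k + complex_of_real (y k * x j) * ?S k j) + complex_of_real (y k * x k) * ?S k k)"
    by (simp only: sum_square_split)
  also have "\<dots> = (\<Sum>k<m. (\<Sum>j<k. - (complex_of_real (x j * y k - x k * y j) * ?S j k)) - complex_of_real (x k * y k) * v C)"
  proof (intro sum.cong refl)
    fix k assume k: "k \<in> {..<m}"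
    have "(\<Sum>j<k. complex_of_real (y j * x k) * ?S j k + complex_of_real (y k * x j) * ?S k j) =
       (\<Sum>j<k. - (complex_of_real (x j * y k - x k * y j) * ?S j k))"
    proof (intro sum.cong refl)
      fix j assume "j \<in> {..<k}"
      then have "?S k j = - ?S j k" using k by (intro gen_mult_anticommute) auto
      then show "complex_of_real (y j * x k) * ?S j k + complex_of_real (y k * x j) * ?S k j =
        - (complex_of_real (x j * y k - x k * y j) * ?S j k)" by (simp add: algebra_simps)
    qed
    moreover have "?S k k = - v C" using k assms by (intro gen_mult_gen_mult_same) auto
    ultimately show "(\<Sum>j<k. complex_of_real (y j * x k) * ?S j k + complex_of_real (y k * x j) * ?S k j) + complex_of_real (y k * x k) * ?S k k =
      (\<Sum>j<k. - (complex_of_real (x j * y k - x k * y j) * ?S j k)) - complex_of_real (x k * y k) * v C"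
      by (simp add: mult.commute)
  qed
  finally have "vec_mult m y (vec_mult m x v) C =
     - (\<Sum>k<m. \<Sum>j<k. complex_of_real (x j * y k - x k * y j) * ?S j k) - complex_of_real (vinner m x y) * v C"
    unfolding vinner_def by (simp only: sum_subtractf sum_negf of_real_sum sum_distrib_right)
  then show ?thesis unfolding W by simp
next
  case False
  then show ?thesis using assms by (simp add: cl_mult_def vec_mult_eq_0 cl_valued_def)
qed

lemma vec_mult_self:
  assumes "cl_valued m v"
  shows "vec_mult m x (vec_mult m x v) C = - complex_of_real ((vnorm m x)\<^sup>2) * v C"
proof -
  have "cl_wedge m x x = (\<lambda>_. 0)" by (simp add: cl_wedge_def fun_eq_iff)
  then have "cl_mult m (cl_wedge m x x) v C = 0" by (simp add: cl_mult_def)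
  moreover have "vinner m x x = (vnorm m x)\<^sup>2" unfolding vnorm_sq by (simp add: vinner_def power2_eq_square)
  ultimately have "- vec_mult m x (vec_mult m x v) C = complex_of_real ((vnorm m x)\<^sup>2) * v C"
    using wedge_mult[OF assms, of x x C] by simp
  from arg_cong[OF this, of uminus] show ?thesis by simp
qed

lemma gint_gen_mult: "gint m (\<lambda>x. gen_mult m j (F x) C) = gen_mult m j (\<lambda>C. gint m (\<lambda>x. F x C)) C"
  by (simp add: gen_mult_def gint_scale)

lemma hpoly_gen_mult: "(\<And>C. hpoly m d (\<lambda>x. F x C)) \<Longrightarrow> hpoly m d (\<lambda>x. gen_mult m j (F x) C)"
  by (cases "C \<subseteq> {..<m}") (simp_all add: gen_mult_def hpoly_scale hpoly.zero)

lemma hpoly_vec_mult_const: "(\<And>C. hpoly m d (\<lambda>x. F x C)) \<Longrightarrow> hpoly m d (\<lambda>x. vec_mult m y (F x) C)"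
  unfolding vec_mult_def by (intro hpoly_sum hpoly_scale hpoly_gen_mult)

lemma hpoly_vec_mult: "(\<And>C. hpoly m d (\<lambda>x. F x C)) \<Longrightarrow> hpoly m (Suc d) (\<lambda>x. vec_mult m x (F x) C)"
  unfolding vec_mult_def by (intro hpoly_sum hpoly_coord_mult hpoly_gen_mult) auto

lemma gint_vec_mult:
  assumes "\<And>C. hpoly m d (\<lambda>x. F x C)"
  shows "gint m (\<lambda>x. vec_mult m y (F x) C) = vec_mult m y (\<lambda>C. gint m (\<lambda>x. F x C)) C"
proof -
  have "gint m (\<lambda>x. vec_mult m y (F x) C) = (\<Sum>j<m. gint m (\<lambda>x. complex_of_real (y j) * gen_mult m j (F x) C))"
    unfolding vec_mult_def by (rule gint_sum) (rule hpoly_scale, rule hpoly_gen_mult[OF assms])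
  then show ?thesis by (simp add: vec_mult_def gint_scale gint_gen_mult)
qed

lemma pd_gen_mult:
  assumes "i < m" "\<And>C. hpoly m d (\<lambda>x. F x C)"
  shows "pd i (\<lambda>x. gen_mult m j (F x) C) x = gen_mult m j (\<lambda>C. pd i (\<lambda>x. F x C) x) C"
  using pd_scale[OF assms(1) assms(2)] by (simp add: gen_mult_def)

section \<open>Monogenic polynomials as eigenfunctions of the Gamma operator\<close>

definition monogenic :: "nat \<Rightarrow> nat \<Rightarrow> ((nat \<Rightarrow> real) \<Rightarrow> cl) \<Rightarrow> bool" where
  "monogenic m k M \<longleftrightarrow> (\<forall>x. cl_valued m (M x)) \<and> (\<forall>C. hpoly m k (\<lambda>x. M x C)) \<and>
     (\<forall>x C. (\<Sum>j<m. gen_mult m j (\<lambda>C. pd j (\<lambda>x. M x C) x) C) = 0)"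

lemma spherical_monogenic_imp_monogenic:
  assumes "spherical_monogenic m k M"
  shows "monogenic m k M"
proof -
  from assms obtain c where c: "\<And>x. M x = (\<lambda>A. \<Sum>\<alpha>\<in>multi_idx m k. c \<alpha> A * complex_of_real (\<Prod>i<m. x i ^ \<alpha> i))"
    unfolding spherical_monogenic_def hom_poly_def by blast
  have "hpoly m k (\<lambda>x. \<Sum>\<alpha>\<in>multi_idx m k. c \<alpha> C * mon m \<alpha> x)" for C
    by (intro hpoly_sum hpoly_mon) (simp add: multi_idx_def)
  then have "hpoly m k (\<lambda>x. M x C)" for C by (simp add: c mon_def)
  moreover have "(\<Sum>j<m. gen_mult m j (\<lambda>C. pd j (\<lambda>x. M x C) x) C) = 0" for x C
  proof -
    have "dirac m M x C = 0" using assms by (simp add: spherical_monogenic_def)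
    then show ?thesis by (simp add: dirac_def cl_mult_gen partial_def pd_def)
  qed
  ultimately show ?thesis using assms by (simp add: monogenic_def spherical_monogenic_def)
qed

text \<open>The square of the Dirac operator is minus the Laplacian: off the diagonal, symmetric
  second derivatives meet anticommuting generators, and on the diagonal each generator squares to
  -1.\<close>

lemma monogenic_harmonic:
  assumes "monogenic m k M"
  shows "harmonic m (\<lambda>x. M x C)"
proof -
  have cv: "cl_valued m (M x)" for x using assms by (simp add: monogenic_def)
  have h: "hpoly m k (\<lambda>x. M x C)" for C using assms by (simp add: monogenic_def)
  have h1: "hpoly m (k - 1) (pd j (\<lambda>x. M x C))" if "j < m" for j C by (rule hpoly_pd[OF that h])
  have z: "M x C = 0" if "\<not> C \<subseteq> {..<m}" for x C using cv that by (auto simp: cl_valued_def)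
  have D: "(\<lambda>x. \<Sum>j<m. gen_mult m j (\<lambda>C. pd j (\<lambda>x. M x C) x) C) = (\<lambda>_. 0)" for C
    using assms by (simp add: monogenic_def)
  let ?H = "\<lambda>i j x C. pd i (pd j (\<lambda>x. M x C)) x"
  have zH: "cl_valued m (?H i j x)" for i j x
    unfolding cl_valued_def using z by (auto simp: pd_const[abs_def])
  have "(\<Sum>i<m. ?H i i x C) = 0" for x
  proof -
    have "0 = (\<Sum>i<m. gen_mult m i (\<lambda>C. pd i (\<lambda>x. \<Sum>j<m. gen_mult m j (\<lambda>C. pd j (\<lambda>x. M x C) x) C) x) C)"
      unfolding D by (cases "C \<subseteq> {..<m}") (simp_all add: gen_mult_def)
    also have "\<dots> = (\<Sum>i<m. \<Sum>j<m. gen_mult m i (gen_mult m j (?H i j x)) C)"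
    proof (intro sum.cong refl)
      fix i assume i: "i \<in> {..<m}"
      have "pd i (\<lambda>x. \<Sum>j<m. gen_mult m j (\<lambda>C. pd j (\<lambda>x. M x C) x) C) x =
        (\<Sum>j<m. 1 * gen_mult m j (?H i j x) C)" for C
      proof -
        have "pd i (\<lambda>x. \<Sum>j<m. gen_mult m j (\<lambda>C. pd j (\<lambda>x. M x C) x) C) x =
          (\<Sum>j<m. pd i (\<lambda>x. gen_mult m j (\<lambda>C. pd j (\<lambda>x. M x C) x) C) x)"
          using i by (intro pd_sum[where d = "k - 1"]) (auto intro!: hpoly_gen_mult h1[unfolded One_nat_def])
        also have "\<dots> = (\<Sum>j<m. 1 * gen_mult m j (?H i j x) C)"
          using i by (intro sum.cong refl) (subst pd_gen_mult[where d = "k - 1"], auto intro: h1[unfolded One_nat_def])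
        finally show ?thesis .
      qed
      then show "gen_mult m i (\<lambda>C. pd i (\<lambda>x. \<Sum>j<m. gen_mult m j (\<lambda>C. pd j (\<lambda>x. M x C) x) C) x) C =
        (\<Sum>j<m. gen_mult m i (gen_mult m j (?H i j x)) C)" by (simp only: gen_mult_sum) simp
    qed
    also have "\<dots> = (\<Sum>k<m. - ?H k k x C)"
    proof (unfold sum_square_split, intro sum.cong refl)
      fix k assume k: "k \<in> {..<m}"
      have "(\<Sum>j<k. gen_mult m j (gen_mult m k (?H j k x)) C + gen_mult m k (gen_mult m j (?H k j x)) C) = 0"
      proof (intro sum.neutral ballI)
        fix j assume j: "j \<in> {..<k}"
        have "?H j k x = ?H k j x" using pd_commute[OF _ _ h] j k by simp
        moreover have "gen_mult m j (gen_mult m k (?H k j x)) C = - gen_mult m k (gen_mult m j (?H k j x)) C"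
          using j k by (intro gen_mult_anticommute) auto
        ultimately show "gen_mult m j (gen_mult m k (?H j k x)) C + gen_mult m k (gen_mult m j (?H k j x)) C = 0" by simp
      qed
      then show "(\<Sum>j<k. gen_mult m j (gen_mult m k (?H j k x)) C + gen_mult m k (gen_mult m j (?H k j x)) C) +
         gen_mult m k (gen_mult m k (?H k k x)) C = - ?H k k x C"
        using gen_mult_gen_mult_same[OF _ zH] k by simp
    qed
    finally show ?thesis by (simp add: sum_negf)
  qed
  then show ?thesis by (simp add: harmonic_def)
qed

lemma pd_coord_mult:
  assumes "i < m" "j < m" "hpoly m d Q"
  shows "pd i (\<lambda>x. complex_of_real (x j) * Q x) = (\<lambda>x. complex_of_real (x j) * pd i Q x + (if i = j then Q x else 0))"
  using pd_mult[OF assms(1) hpoly_coord[OF assms(2)] assms(3)] by (auto simp: pd_coord fun_eq_iff)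

lemma pd_pd_coord_mult:
  assumes "i < m" "j < m" "hpoly m d Q"
  shows "pd i (pd i (\<lambda>x. complex_of_real (x j) * Q x)) x = complex_of_real (x j) * pd i (pd i Q) x + (if i = j then 2 * pd i Q x else 0)"
proof -
  have h: "hpoly m (d - 1) (pd i Q)" by (rule hpoly_pd[OF assms(1,3)])
  have "pd i (\<lambda>x. complex_of_real (x j) * pd i Q x + (if i = j then Q x else 0)) x =
     pd i (\<lambda>x. complex_of_real (x j) * pd i Q x) x + pd i (\<lambda>x. if i = j then Q x else 0) x"
    by (rule pd_add[OF assms(1) hpoly_coord_mult[OF assms(2) h], where e = d]) (cases "i = j"; use assms(3) in \<open>simp add: hpoly.zero\<close>)
  then show ?thesis
    unfolding pd_coord_mult[OF assms] pd_coord_mult[OF assms(1,2) h] by auto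
qed

text \<open>The Laplacian of \<open>x\<^sub>j\<close> times a function is \<open>x\<^sub>j\<close>
  times its Laplacian plus twice its \<open>j\<close>-th derivative. Summed with the generators, the
  second part is twice the Dirac operator applied to \<open>M\<close>.\<close>

lemma monogenic_vec_mult_harmonic:
  assumes "monogenic m k M"
  shows "harmonic m (\<lambda>x. vec_mult m x (M x) C)"
proof -
  have h: "hpoly m k (\<lambda>x. M x C)" for C using assms by (simp add: monogenic_def)
  have hg: "hpoly m k (\<lambda>x. gen_mult m j (M x) C)" for j by (rule hpoly_gen_mult[OF h])
  have lap0: "(\<Sum>i<m. pd i (pd i (\<lambda>x. gen_mult m j (M x) C)) x) = 0" for j x
  proof -
    have "pd i (pd i (\<lambda>x. gen_mult m j (M x) C)) x = gen_mult m j (\<lambda>C. pd i (pd i (\<lambda>x. M x C)) x) C" if "i < m" for i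
      unfolding pd_gen_mult[OF that h] by (rule pd_gen_mult[OF that hpoly_pd[OF that h]])
    then have "(\<Sum>i<m. pd i (pd i (\<lambda>x. gen_mult m j (M x) C)) x) = gen_mult m j (\<lambda>C. \<Sum>i<m. 1 * pd i (pd i (\<lambda>x. M x C)) x) C"
      by (simp only: gen_mult_sum) simp
    also have "\<dots> = 0" using monogenic_harmonic[OF assms] by (simp add: harmonic_def gen_mult_def)
    finally show ?thesis .
  qed
  have "(\<Sum>i<m. pd i (pd i (\<lambda>x. \<Sum>j<m. complex_of_real (x j) * gen_mult m j (M x) C)) x) = 0" for x
  proof -
    have hj: "hpoly m (Suc k) (\<lambda>x. complex_of_real (x j) * gen_mult m j (M x) C)" if "j < m" for j
      by (rule hpoly_coord_mult[OF that hg])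
    have "(\<Sum>i<m. pd i (pd i (\<lambda>x. \<Sum>j<m. complex_of_real (x j) * gen_mult m j (M x) C)) x) =
      (\<Sum>i<m. \<Sum>j<m. complex_of_real (x j) * pd i (pd i (\<lambda>x. gen_mult m j (M x) C)) x + (if i = j then 2 * pd i (\<lambda>x. gen_mult m j (M x) C) x else 0))"
    proof (intro sum.cong refl)
      fix i assume i: "i \<in> {..<m}"
      have 1: "pd i (\<lambda>x. \<Sum>j<m. complex_of_real (x j) * gen_mult m j (M x) C) =
        (\<lambda>x. \<Sum>j<m. pd i (\<lambda>x. complex_of_real (x j) * gen_mult m j (M x) C) x)"
        using i hj by (intro ext pd_sum) auto
      have "pd i (\<lambda>x. \<Sum>j<m. pd i (\<lambda>x. complex_of_real (x j) * gen_mult m j (M x) C) x) x =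
        (\<Sum>j<m. pd i (pd i (\<lambda>x. complex_of_real (x j) * gen_mult m j (M x) C)) x)"
        using i hpoly_pd[OF _ hj] by (intro pd_sum[where d = "Suc k - 1"]) auto
      also have "\<dots> = (\<Sum>j<m. complex_of_real (x j) * pd i (pd i (\<lambda>x. gen_mult m j (M x) C)) x + (if i = j then 2 * pd i (\<lambda>x. gen_mult m j (M x) C) x else 0))"
        using i by (intro sum.cong refl pd_pd_coord_mult[OF _ _ hg]) auto
      finally show "pd i (pd i (\<lambda>x. \<Sum>j<m. complex_of_real (x j) * gen_mult m j (M x) C)) x =
        (\<Sum>j<m. complex_of_real (x j) * pd i (pd i (\<lambda>x. gen_mult m j (M x) C)) x + (if i = j then 2 * pd i (\<lambda>x. gen_mult m j (M x) C) x else 0))"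
        unfolding 1 .
    qed
    also have "\<dots> = (\<Sum>j<m. complex_of_real (x j) * (\<Sum>i<m. pd i (pd i (\<lambda>x. gen_mult m j (M x) C)) x)) +
       (\<Sum>i<m. 2 * pd i (\<lambda>x. gen_mult m i (M x) C) x)"
      unfolding sum.distrib by (subst sum.swap) (simp add: sum_distrib_left)
    also have "\<dots> = 2 * (\<Sum>i<m. gen_mult m i (\<lambda>C. pd i (\<lambda>x. M x C) x) C)"
      unfolding lap0 sum_distrib_left using pd_gen_mult[OF _ h] by simp
    also have "\<dots> = 0" using assms by (simp add: monogenic_def)
    finally show ?thesis .
  qed
  then show ?thesis by (simp add: harmonic_def vec_mult_def)
qed

text \<open>The number \<open>\<mu>\<close> is the eigenvalue of the Gamma operator \<open>\<Gamma> = - (\<Sum>j<k. e\<^sub>j e\<^sub>k (x\<^sub>j \<partial>\<^sub>k - x\<^sub>k \<partial>\<^sub>j))\<close> on \<open>f\<close>;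
  the last conjunct is what integration by parts makes of \<open>\<Gamma> f = \<mu> f\<close>.\<close>
definition gamma_eigen :: "nat \<Rightarrow> nat \<Rightarrow> real \<Rightarrow> ((nat \<Rightarrow> real) \<Rightarrow> cl) \<Rightarrow> bool" where
  "gamma_eigen m d \<mu> f \<longleftrightarrow> (\<forall>x. cl_valued m (f x)) \<and> (\<forall>C. hpoly m d (\<lambda>x. f x C)) \<and>
     (\<forall>C. harmonic m (\<lambda>x. f x C)) \<and> (d = 0 \<longrightarrow> \<mu> = 0) \<and>
     (\<forall>p y C. gint m (\<lambda>x. complex_of_real (vinner m x y) ^ p * cl_mult m (cl_wedge m x y) (f x) C) =
        complex_of_real (\<mu> / real (Suc p)) * gint m (\<lambda>x. complex_of_real (vinner m x y) ^ Suc p * f x C))"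

lemma hpoly_wedge_mult:
  assumes "\<And>x. cl_valued m (f x)" "\<And>C. hpoly m d (\<lambda>x. f x C)"
  shows "hpoly m (Suc d) (\<lambda>x. cl_mult m (cl_wedge m x y) (f x) C)"
proof -
  have "hpoly m (Suc d) (\<lambda>x. - vec_mult m y (vec_mult m x (f x)) C - complex_of_real (vinner m x y) * f x C)"
    using hpoly_mult[OF hpoly_inner assms(2)]
    by (intro hpoly_diff hpoly_minus hpoly_vec_mult_const hpoly_vec_mult assms(2)) simp
  then show ?thesis by (simp add: wedge_mult[OF assms(1)])
qed

lemma hcoef_Suc_Suc: "hcoef (Suc k) (Suc p) = real (Suc p) * hcoef k p"
  by (auto simp: hcoef_def)

text \<open>With \<open>Suc p = k + 2 * i\<close> the quotient of the two coefficients is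
  \<open>2 * i / Suc p\<close>. It compares the integrals of x M and of M in the next lemma.\<close>

lemma hcoef_shift:
  fixes v :: real
  shows "hcoef (Suc k) p * v ^ (p - Suc k) * v\<^sup>2 =
    (1 - real k / real (Suc p)) * (hcoef k (Suc p) * v ^ (Suc p - k))"
proof (cases "k \<le> Suc p \<and> even (Suc p - k)")
  case True
  then obtain i where i: "Suc p = k + 2 * i" by (metis dvdE le_add_diff_inverse)
  show ?thesis
  proof (cases i)
    case 0
    then show ?thesis using i by (simp add: hcoef_def)
  next
    case (Suc l)
    have p: "p = Suc k + 2 * l" using i Suc by simp
    have 1: "hcoef (Suc k) p = fact p / (2 ^ l * fact l)" by (simp add: hcoef_def p)
    have e: "2 ^ Suc l * fact (Suc l) = (2 * real l + 2) * (2 ^ l * fact l)" by (simp add: algebra_simps)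
    have 2: "hcoef k (Suc p) = real (Suc p) * fact p / ((2 * real l + 2) * (2 ^ l * fact l))"
      unfolding hcoef_def i Suc fact_Suc[of p, symmetric] e[symmetric] using i Suc by simp
    have "1 - real k / real (Suc p) = (2 * real l + 2) / real (Suc p)" using i Suc by (simp add: field_simps)
    moreover have "(2 * real l + 2) / real (Suc p) * (real (Suc p) * fact p / ((2 * real l + 2) * (2 ^ l * fact l))) = fact p / (2 ^ l * fact l)"
      by (simp add: field_simps add_nonneg_eq_0_iff)
    ultimately have "(1 - real k / real (Suc p)) * hcoef k (Suc p) = hcoef (Suc k) p" unfolding 1 2 by simp
    moreover have "Suc p - k = (p - Suc k) + 2" using p by simp
    ultimately show ?thesis by (simp only: power_add mult.assoc[symmetric])
  qed
next
  case False
  then have "hcoef k (Suc p) = 0" "hcoef (Suc k) p = 0" by (auto simp: hcoef_def)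
  then show ?thesis by simp
qed

text \<open>After \<open>wedge_mult\<close> the integrals involve the harmonic polynomials x M and
  M, and \<open>gint_inner_power\<close> evaluates both. By \<open>hcoef_shift\<close> their
  combination is (1 - k/(p+1)) - 1, which leaves the eigenvalue -k over p+1.\<close>

lemma gamma_eigen_monogenic:
  assumes "monogenic m k M"
  shows "gamma_eigen m k (- real k) M"
proof -
  have cv: "cl_valued m (M x)" for x using assms by (simp add: monogenic_def)
  have h: "hpoly m k (\<lambda>x. M x C)" for C using assms by (simp add: monogenic_def)
  have "gint m (\<lambda>x. complex_of_real (vinner m x y) ^ p * cl_mult m (cl_wedge m x y) (M x) C) =
        complex_of_real (- real k / real (Suc p)) * gint m (\<lambda>x. complex_of_real (vinner m x y) ^ Suc p * M x C)" for p y C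
  proof -
    let ?s = "\<lambda>x. complex_of_real (vinner m x y)" and ?g = "gint m (\<lambda>_. 1)" and ?v = "vnorm m y"
    have h1: "hpoly m (p * 1 + Suc k) (\<lambda>x. ?s x ^ p * vec_mult m x (M x) C)" for C
      by (intro hpoly_mult hpoly_power hpoly_inner hpoly_vec_mult h)
    have h2: "hpoly m (Suc p * 1 + k) (\<lambda>x. ?s x ^ Suc p * M x C)"
      by (intro hpoly_mult hpoly_power hpoly_inner h)
    have "gint m (\<lambda>x. ?s x ^ p * cl_mult m (cl_wedge m x y) (M x) C) =
      gint m (\<lambda>x. - vec_mult m y (\<lambda>C. ?s x ^ p * vec_mult m x (M x) C) C - ?s x ^ Suc p * M x C)"
      by (intro arg_cong[where f="gint m"] ext) (simp only: wedge_mult[OF cv] vec_mult_scale, simp add: algebra_simps)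
    also have "\<dots> = - vec_mult m y (\<lambda>C. gint m (\<lambda>x. ?s x ^ p * vec_mult m x (M x) C)) C - gint m (\<lambda>x. ?s x ^ Suc p * M x C)"
      unfolding gint_diff[OF hpoly_minus[OF hpoly_vec_mult_const[OF h1]] h2] gint_minus gint_vec_mult[OF h1] ..
    also have "(\<lambda>C. gint m (\<lambda>x. ?s x ^ p * vec_mult m x (M x) C)) =
       (\<lambda>C. (complex_of_real (hcoef (Suc k) p * ?v ^ (p - Suc k)) * ?g) * vec_mult m y (M y) C)"
      using gint_inner_power[OF hpoly_vec_mult[OF h] monogenic_vec_mult_harmonic[OF assms]] by (simp add: mult_ac)
    \<comment> \<open>One factor \<open>y\<close> comes from the wedge, the other from the value of
      x M at \<open>y\<close>; together they give - |y|^2.\<close>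
    also have "- vec_mult m y \<dots> C = complex_of_real (hcoef (Suc k) p * ?v ^ (p - Suc k) * ?v\<^sup>2) * M y C * ?g"
      by (simp add: vec_mult_scale vec_mult_self[OF cv])
    also have "gint m (\<lambda>x. ?s x ^ Suc p * M x C) = complex_of_real (hcoef k (Suc p) * ?v ^ (Suc p - k)) * M y C * ?g"
      by (rule gint_inner_power[OF h monogenic_harmonic[OF assms]])
    also have "complex_of_real (hcoef (Suc k) p * ?v ^ (p - Suc k) * ?v\<^sup>2) * M y C * ?g -
        complex_of_real (hcoef k (Suc p) * ?v ^ (Suc p - k)) * M y C * ?g =
        complex_of_real (- real k / real (Suc p)) * (complex_of_real (hcoef k (Suc p) * ?v ^ (Suc p - k)) * M y C * ?g)"
      unfolding hcoef_shift of_real_mult[of "1 - real k / real (Suc p)"] by (simp add: algebra_simps)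
    finally show ?thesis
      unfolding gint_inner_power[OF h monogenic_harmonic[OF assms]] .
  qed
  then show ?thesis unfolding gamma_eigen_def using cv h monogenic_harmonic[OF assms] by auto
qed

text \<open>Here x (x M) = - |x|^2 M, so the wedge product is |x|^2 y M - <x,y> x M. The first part
  integrates to the factor p + k + m and the second to p + 1, with a common remainder. The
  difference k + m - 1 equals d + 2 \<lambda> for the degree d = k + 1.\<close>

lemma gamma_eigen_vec_mult_monogenic:
  assumes "monogenic m k M"
  shows "gamma_eigen m (Suc k) (real k + real m - 1) (\<lambda>x. vec_mult m x (M x))"
proof -
  have cv: "cl_valued m (M x)" for x using assms by (simp add: monogenic_def)
  have h: "hpoly m k (\<lambda>x. M x C)" for C using assms by (simp add: monogenic_def)
  have "gint m (\<lambda>x. complex_of_real (vinner m x y) ^ p * cl_mult m (cl_wedge m x y) (vec_mult m x (M x)) C) =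
        complex_of_real ((real k + real m - 1) / real (Suc p)) * gint m (\<lambda>x. complex_of_real (vinner m x y) ^ Suc p * vec_mult m x (M x) C)" for p y C
  proof -
    let ?s = "\<lambda>x. complex_of_real (vinner m x y)" and ?g = "gint m (\<lambda>_. 1)" and ?v = "vnorm m y"
    have h0: "hpoly m (p * 1 + k) (\<lambda>x. ?s x ^ p * M x C)" for C
      by (intro hpoly_mult hpoly_power hpoly_inner h)
    have h1: "hpoly m (2 + (p * 1 + k)) (\<lambda>x. complex_of_real ((vnorm m x)\<^sup>2) * (?s x ^ p * M x C))" for C
      by (intro hpoly_mult[OF hpoly_normsq] h0)
    have h2: "hpoly m (Suc p * 1 + Suc k) (\<lambda>x. ?s x ^ Suc p * vec_mult m x (M x) C)"
      by (intro hpoly_mult hpoly_power hpoly_inner hpoly_vec_mult h)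
    have 1: "cl_mult m (cl_wedge m x y) (vec_mult m x (M x)) C =
        complex_of_real ((vnorm m x)\<^sup>2) * vec_mult m y (M x) C - ?s x * vec_mult m x (M x) C" for x
    proof -
      have "vec_mult m x (vec_mult m x (M x)) = (\<lambda>C. - complex_of_real ((vnorm m x)\<^sup>2) * M x C)"
        by (rule ext) (rule vec_mult_self[OF cv])
      then show ?thesis by (simp only: wedge_mult[OF cl_valued_vec_mult] vec_mult_scale) simp
    qed
    have "gint m (\<lambda>x. ?s x ^ p * cl_mult m (cl_wedge m x y) (vec_mult m x (M x)) C) =
      gint m (\<lambda>x. vec_mult m y (\<lambda>C. complex_of_real ((vnorm m x)\<^sup>2) * (?s x ^ p * M x C)) C - ?s x ^ Suc p * vec_mult m x (M x) C)"
      by (intro arg_cong[where f="gint m"] ext) (simp only: 1 vec_mult_scale, simp add: algebra_simps)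
    also have "\<dots> = vec_mult m y (\<lambda>C. gint m (\<lambda>x. complex_of_real ((vnorm m x)\<^sup>2) * (?s x ^ p * M x C))) C - gint m (\<lambda>x. ?s x ^ Suc p * vec_mult m x (M x) C)"
      unfolding gint_diff[OF hpoly_vec_mult_const[OF h1] h2] gint_vec_mult[OF h1] ..
    also have "(\<lambda>C. gint m (\<lambda>x. complex_of_real ((vnorm m x)\<^sup>2) * (?s x ^ p * M x C))) =
       (\<lambda>C. (of_nat (p + k + m) * complex_of_real (hcoef k p * ?v ^ (p - k)) * ?g) * M y C)"
      unfolding gint_normsq[OF h0] gint_inner_power[OF h monogenic_harmonic[OF assms]] by (simp add: mult_ac)
    also have "gint m (\<lambda>x. ?s x ^ Suc p * vec_mult m x (M x) C) =
        complex_of_real (real (Suc p) * hcoef k p * ?v ^ (p - k)) * vec_mult m y (M y) C * ?g"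
      using gint_inner_power[OF hpoly_vec_mult[OF h] monogenic_vec_mult_harmonic[OF assms], where n="Suc p"]
      by (simp add: hcoef_Suc_Suc)
    also have "vec_mult m y (\<lambda>C. (of_nat (p + k + m) * complex_of_real (hcoef k p * ?v ^ (p - k)) * ?g) * M y C) C -
         complex_of_real (real (Suc p) * hcoef k p * ?v ^ (p - k)) * vec_mult m y (M y) C * ?g
      = complex_of_real (real k + real m - 1) * (complex_of_real (hcoef k p * ?v ^ (p - k)) * vec_mult m y (M y) C * ?g)"
      unfolding vec_mult_scale by (simp add: algebra_simps)
    also have "complex_of_real (real k + real m - 1) = complex_of_real ((real k + real m - 1) / real (Suc p)) * complex_of_real (real (Suc p))"
      by (simp flip: of_real_mult del: of_nat_Suc)
    finally show ?thesis
      using gint_inner_power[OF hpoly_vec_mult[OF h] monogenic_vec_mult_harmonic[OF assms], where n="Suc p"]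
      by (simp only: hcoef_Suc_Suc of_real_mult mult.assoc diff_Suc_Suc)
  qed
  then show ?thesis unfolding gamma_eigen_def using cl_valued_vec_mult hpoly_vec_mult[OF h] monogenic_vec_mult_harmonic[OF assms] by auto
qed

section \<open>Zonal polynomials and Bessel functions\<close>

definition gcoef :: "real \<Rightarrow> nat \<Rightarrow> nat \<Rightarrow> real" where
  "gcoef a n j = (-1) ^ j * Gamma (real (n - j) + a) / (Gamma a * fact j * fact (n - 2 * j)) * 2 ^ (n - 2 * j)"

text \<open>The homogeneous polynomial \<open>|x|\<^sup>n |y|\<^sup>n C\<^sub>n\<^sup>a(w)\<close>.\<close>
definition zonal :: "nat \<Rightarrow> real \<Rightarrow> nat \<Rightarrow> (nat \<Rightarrow> real) \<Rightarrow> (nat \<Rightarrow> real) \<Rightarrow> complex" where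
  "zonal m a n y x = (\<Sum>j\<le>n div 2. complex_of_real (gcoef a n j * ((vnorm m y)\<^sup>2) ^ j) *
     (complex_of_real ((vnorm m x)\<^sup>2) ^ j * complex_of_real (vinner m x y) ^ (n - 2 * j)))"

lemma hpoly_zonal: "hpoly m n (zonal m a n y)"
proof -
  have "hpoly m n (\<lambda>x. complex_of_real ((vnorm m x)\<^sup>2) ^ j * complex_of_real (vinner m x y) ^ (n - 2 * j))"
    if "j \<le> n div 2" for j
  proof -
    have "j * 2 + (n - 2 * j) * 1 = n" using that by auto
    moreover have "hpoly m (j * 2 + (n - 2 * j) * 1) (\<lambda>x. complex_of_real ((vnorm m x)\<^sup>2) ^ j * complex_of_real (vinner m x y) ^ (n - 2 * j))"
      by (intro hpoly_mult hpoly_power hpoly_normsq hpoly_inner)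
    ultimately show ?thesis by (simp only:)
  qed
  then show ?thesis unfolding zonal_def[abs_def] by (intro hpoly_sum hpoly_scale) auto
qed

section \<open>Finite differences and orthogonality of the zonal polynomials\<close>

lemma alternating_binomial_sum_Suc:
  fixes F :: "nat \<Rightarrow> real"
  shows "(\<Sum>j\<le>Suc N. (-1) ^ j * real (Suc N choose j) * F j) =
    (\<Sum>j\<le>N. (-1) ^ j * real (N choose j) * (F j - F (Suc j)))"
proof -
  have 1: "(\<Sum>j\<le>Suc N. (-1) ^ j * real (N choose j) * F j) =
     F 0 + (\<Sum>j\<le>N. (-1) ^ Suc j * real (N choose Suc j) * F (Suc j))"
    by (subst sum.atMost_Suc_shift) simp
  have "(\<Sum>j\<le>Suc N. (-1) ^ j * real (Suc N choose j) * F j) =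
    F 0 + (\<Sum>j\<le>N. (-1) ^ Suc j * real (N choose Suc j) * F (Suc j) - (-1) ^ j * real (N choose j) * F (Suc j))"
    by (subst sum.atMost_Suc_shift) (simp, intro sum.cong refl, simp add: algebra_simps)
  also have "\<dots> = (\<Sum>j\<le>Suc N. (-1) ^ j * real (N choose j) * F j) - (\<Sum>j\<le>N. (-1) ^ j * real (N choose j) * F (Suc j))"
    unfolding 1 sum_subtractf by simp
  also have "(\<Sum>j\<le>Suc N. (-1) ^ j * real (N choose j) * F j) = (\<Sum>j\<le>N. (-1) ^ j * real (N choose j) * F j)"
    by simp
  finally show ?thesis by (simp only: sum_subtractf right_diff_distrib)
qed

lemma pochhammer_diff:
  fixes x :: real
  shows "pochhammer x k - pochhammer (x - 1) k = real k * pochhammer x (k - 1)"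
proof (cases k)
  case (Suc n)
  then show ?thesis using pochhammer_rec[of "x - 1" n] pochhammer_rec'[of x n]
    by (simp add: algebra_simps)
qed simp

text \<open>An \<open>N\<close>-th finite difference of a polynomial in \<open>j\<close> of degree
  \<open>k < N\<close>. Each difference lowers both \<open>N\<close> and \<open>k\<close> and
  produces the factor \<open>real k\<close>, which finally is 0.\<close>

lemma alternating_pochhammer_sum:
  assumes "k < N"
  shows "(\<Sum>j\<le>N. (-1) ^ j * real (N choose j) * pochhammer (b - real j) k) = 0"
  using assms
proof (induction N arbitrary: k)
  case (Suc N)
  have "(\<Sum>j\<le>Suc N. (-1) ^ j * real (Suc N choose j) * pochhammer (b - real j) k) =
     (\<Sum>j\<le>N. (-1) ^ j * real (N choose j) * (real k * pochhammer (b - real j) (k - 1)))"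
    unfolding alternating_binomial_sum_Suc
  proof (intro sum.cong refl arg_cong2[where f="(*)"])
    fix j show "pochhammer (b - real j) k - pochhammer (b - real (Suc j)) k = real k * pochhammer (b - real j) (k - 1)"
      using pochhammer_diff[of "b - real j" k] by (simp add: diff_diff_add add.commute)
  qed
  also have "\<dots> = real k * (\<Sum>j\<le>N. (-1) ^ j * real (N choose j) * pochhammer (b - real j) (k - 1))"
    unfolding sum_distrib_left by (intro sum.cong refl) simp
  also have "\<dots> = 0" using Suc.IH[of "k - 1"] Suc.prems by (cases k) auto
  finally show ?case .
qed simp

lemma Gamma_pochhammer: "z > 0 \<Longrightarrow> Gamma (z + real n) = pochhammer z n * Gamma (z :: real)"
proof -
  assume z: "z > 0"
  then have "z \<notin> \<int>\<^sub>\<le>\<^sub>0" by (auto elim!: nonpos_Ints_cases)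
  moreover have "Gamma z \<noteq> 0" using Gamma_real_pos[OF z] by simp
  ultimately show ?thesis using pochhammer_Gamma[of z n] by simp
qed

lemma Gamma_real_nonzero: "z > 0 \<Longrightarrow> Gamma (z :: real) \<noteq> 0"
  using Gamma_real_pos[of z] by linarith

text \<open>These are the coefficients left when the zonal polynomial is integrated term by term
  against a harmonic polynomial of degree \<open>d\<close>. For \<open>n = d + 2 * N\<close> with
  \<open>N > 0\<close> the sum is an \<open>N\<close>-th difference of a polynomial of degree
  \<open>N - 1\<close>; for \<open>N = 0\<close> a single term remains. If \<open>n < d\<close> or
  the parities differ, every \<open>hcoef\<close> vanishes.\<close>

lemma zonal_coefficient_sum:
  assumes "a > 0"
  shows "(\<Sum>j\<le>n div 2. gcoef a n j * v ^ (2 * j) * 2 ^ j * pochhammer (real (n - 2 * j + d) / 2 + a + 1) j *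
      (hcoef d (n - 2 * j) * v ^ (n - 2 * j - d))) =
    (if n = d then 2 ^ d * Gamma (real d + a) / Gamma a else 0)"
proof (cases "d \<le> n \<and> even (n - d)")
  case False
  then have "hcoef d (n - 2 * j) = 0" if "j \<le> n div 2" for j
    using that by (auto simp: hcoef_def)
  then show ?thesis using False by (auto intro!: sum.neutral)
next
  case True
  then obtain N where n: "n = d + 2 * N" by (metis dvdE le_add_diff_inverse)
  \<comment> \<open>All factors that do not depend on \<open>j\<close>, after the Pochhammer symbol
    is written as a Gamma quotient and the factorials are collected into a binomial
    coefficient.\<close>
  define C where "C = 2 ^ (d + N) * Gamma (real d + real N + a + 1) * v ^ (2 * N) / (Gamma a * fact N)"
  have pos: "Gamma a > 0" using assms by simp
  have "(\<Sum>j\<le>n div 2. gcoef a n j * v ^ (2 * j) * 2 ^ j * pochhammer (real (n - 2 * j + d) / 2 + a + 1) j *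
      (hcoef d (n - 2 * j) * v ^ (n - 2 * j - d))) =
    (\<Sum>j\<le>N. gcoef a n j * v ^ (2 * j) * 2 ^ j * pochhammer (real (n - 2 * j + d) / 2 + a + 1) j *
      (hcoef d (n - 2 * j) * v ^ (n - 2 * j - d)))"
    \<comment> \<open>For \<open>j > N\<close> fewer than \<open>d\<close> factors <x,y> remain, so
      \<open>hcoef\<close> is 0.\<close>
    by (rule sum.mono_neutral_right) (use n in \<open>auto simp: hcoef_def\<close>)
  also have "\<dots> = (\<Sum>j\<le>N. C * ((-1) ^ j * real (N choose j) *
      (Gamma (real d + 2 * real N - real j + a) / Gamma (real d + real N - real j + a + 1))))"
  proof (intro sum.cong refl)
    fix j assume "j \<in> {..N}"
    then obtain i where i: "N = j + i" by (metis atMost_iff le_iff_add)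
    have p: "n - 2 * j = d + 2 * i" using n i by simp
    have pz: "real d + real i + a + 1 > 0" using assms by linarith
    have "real (n - 2 * j + d) / 2 + a + 1 = real d + real i + a + 1" unfolding p by (simp add: field_simps)
    moreover have "pochhammer (real d + real i + a + 1) j = Gamma (real d + real i + a + 1 + real j) / Gamma (real d + real i + a + 1)"
      unfolding Gamma_pochhammer[OF pz]
      by (rule nonzero_mult_div_cancel_right[OF Gamma_real_nonzero[OF pz], symmetric])
    moreover have "real d + real i + a + 1 + real j = real d + real N + a + 1" "real d + real i + a + 1 = real d + real N - real j + a + 1"
      using i by simp_all
    ultimately have 1: "pochhammer (real (n - 2 * j + d) / 2 + a + 1) j =
       Gamma (real d + real N + a + 1) / Gamma (real d + real N - real j + a + 1)"
      by (simp only:)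
    have 2: "hcoef d (n - 2 * j) = fact (d + 2 * i) / (2 ^ i * fact i)" unfolding hcoef_def p by simp
    have 3: "gcoef a n j = (-1) ^ j * Gamma (real d + 2 * real N - real j + a) / (Gamma a * fact j * fact (d + 2 * i)) * 2 ^ (d + 2 * i)"
      unfolding gcoef_def p using n i by (simp add: of_nat_diff algebra_simps)
    have 4: "real (N choose j) = fact N / (fact j * fact i)" using i by (simp add: binomial_fact)
    have 5: "n - 2 * j - d = 2 * i" using p by simp
    define G where "G = Gamma (real d + 2 * real N - real j + a)"
    define H where "H = Gamma (real d + real N - real j + a + 1)"
    have H: "H > 0" unfolding H_def using i assms by (intro Gamma_real_pos) auto
    show "gcoef a n j * v ^ (2 * j) * 2 ^ j * pochhammer (real (n - 2 * j + d) / 2 + a + 1) j *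
      (hcoef d (n - 2 * j) * v ^ (n - 2 * j - d)) = C * ((-1) ^ j * real (N choose j) *
      (Gamma (real d + 2 * real N - real j + a) / Gamma (real d + real N - real j + a + 1)))"
    proof -
      have alg: "(s * G / (Ga * fj * fp) * (D * P * P)) * V * J * (K / H) * ((fp / (P * fi)) * W) =
         (D * J * P * K * (V * W) / (Ga * fN)) * (s * (fN / (fj * fi)) * (G / H))"
        if "Ga \<noteq> 0" "fj \<noteq> 0" "fp \<noteq> 0" "P \<noteq> 0" "fi \<noteq> 0" "fN \<noteq> 0" "H \<noteq> 0"
        for s G Ga fj fp D P V J K H fi W fN :: real
        using that by (simp add: field_simps)
      have pw: "2 ^ (d + 2 * i) = 2 ^ d * 2 ^ i * (2 ^ i :: real)" "2 ^ (d + N) = 2 ^ d * 2 ^ j * (2 ^ i :: real)"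
        "v ^ (2 * N) = v ^ (2 * j) * v ^ (2 * i)"
        by (simp_all add: i power_add[symmetric] mult_2)
      show ?thesis unfolding 1 2 3 4 5 C_def G_def[symmetric] H_def[symmetric] pw
        by (rule alg) (use H pos in auto)
    qed
  qed
  also have "\<dots> = C * (\<Sum>j\<le>N. (-1) ^ j * real (N choose j) *
      (Gamma (real d + 2 * real N - real j + a) / Gamma (real d + real N - real j + a + 1)))"
    by (simp add: sum_distrib_left)
  also have "\<dots> = (if n = d then 2 ^ d * Gamma (real d + a) / Gamma a else 0)"
  proof (cases N)
    case 0
    have "Gamma (real d + a + 1) \<noteq> 0" using assms by (intro Gamma_real_nonzero) simp
    then show ?thesis using 0 n by (simp add: C_def)
  next
    case (Suc k)
    \<comment> \<open>The arguments differ by \<open>N - 1\<close>, so the quotient of Gamma values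
      is a polynomial in \<open>j\<close> of that degree.\<close>
    have "Gamma (real d + 2 * real N - real j + a) / Gamma (real d + real N - real j + a + 1)
       = pochhammer (real d + real N + a + 1 - real j) k" if "j \<le> N" for j
    proof -
      have z: "real d + real N - real j + a + 1 > 0" using that assms by linarith
      have "real d + 2 * real N - real j + a = real d + real N - real j + a + 1 + real k"
        "real d + real N + a + 1 - real j = real d + real N - real j + a + 1" using Suc by simp_all
      moreover have "Gamma (real d + real N - real j + a + 1 + real k) / Gamma (real d + real N - real j + a + 1) =
         pochhammer (real d + real N - real j + a + 1) k"
        unfolding Gamma_pochhammer[OF z] by (rule nonzero_mult_div_cancel_right[OF Gamma_real_nonzero[OF z]])
      ultimately show ?thesis by (simp only:)
    qed
    then have "(\<Sum>j\<le>N. (-1) ^ j * real (N choose j) *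
      (Gamma (real d + 2 * real N - real j + a) / Gamma (real d + real N - real j + a + 1))) =
      (\<Sum>j\<le>N. (-1) ^ j * real (N choose j) * pochhammer (real d + real N + a + 1 - real j) k)"
      by (intro sum.cong) auto
    also have "\<dots> = 0" by (rule alternating_pochhammer_sum) (use Suc in simp)
    finally show ?thesis using Suc n by simp
  qed
  finally show ?thesis .
qed

lemma hpoly_normsq_inner_mult:
  assumes "hpoly m d P"
  shows "hpoly m (j * 2 + (p * 1 + d)) (\<lambda>x. complex_of_real ((vnorm m x)\<^sup>2) ^ j * (complex_of_real (vinner m x y) ^ p * P x))"
  by (intro hpoly_mult hpoly_power hpoly_normsq hpoly_inner assms)

lemma gint_zonal_mult:
  assumes "hpoly m d P"
  shows "gint m (\<lambda>x. zonal m a n y x * P x) =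
    (\<Sum>j\<le>n div 2. complex_of_real (gcoef a n j * ((vnorm m y)\<^sup>2) ^ j) *
      gint m (\<lambda>x. complex_of_real ((vnorm m x)\<^sup>2) ^ j * (complex_of_real (vinner m x y) ^ (n - 2 * j) * P x)))"
proof -
  have "gint m (\<lambda>x. zonal m a n y x * P x) = gint m (\<lambda>x. \<Sum>j\<le>n div 2. complex_of_real (gcoef a n j * ((vnorm m y)\<^sup>2) ^ j) *
     (complex_of_real ((vnorm m x)\<^sup>2) ^ j * (complex_of_real (vinner m x y) ^ (n - 2 * j) * P x)))"
    unfolding zonal_def sum_distrib_right by (simp only: mult.assoc)
  also have "\<dots> = (\<Sum>j\<le>n div 2. gint m (\<lambda>x. complex_of_real (gcoef a n j * ((vnorm m y)\<^sup>2) ^ j) *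
     (complex_of_real ((vnorm m x)\<^sup>2) ^ j * (complex_of_real (vinner m x y) ^ (n - 2 * j) * P x))))"
    by (rule gint_sum) (rule hpoly_scale, rule hpoly_normsq_inner_mult[OF assms])
  finally show ?thesis unfolding gint_scale .
qed

lemma gint_normsq_inner_mult:
  assumes "hpoly m d P"
  shows "gint m (\<lambda>x. complex_of_real ((vnorm m x)\<^sup>2) ^ j * (complex_of_real (vinner m x y) ^ p * P x)) =
    complex_of_real (2 ^ j * pochhammer (real (p + d + m) / 2) j) * gint m (\<lambda>x. complex_of_real (vinner m x y) ^ p * P x)"
  using gint_normsq_power[OF hpoly_mult[OF hpoly_power[OF hpoly_inner] assms], of j y p] by simp

text \<open>Orthogonality and the reproducing property of Gegenbauer polynomials on the sphere, in
  Gaussian form. The constant is \<open>gcoef (lam m) d 0 * hcoef d d\<close>. The parameter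
  \<lambda> fits the dimension through m/2 = \<lambda> + 1, which enters by the moments of
  |x|^2.\<close>

lemma gint_zonal_harmonic:
  assumes "m \<ge> 3" "hpoly m d P" "harmonic m P"
  shows "gint m (\<lambda>x. zonal m (lam m) n y x * P x) =
    (if n = d then complex_of_real (2 ^ d * Gamma (real d + lam m) / Gamma (lam m)) * P y * gint m (\<lambda>_. 1) else 0)"
proof -
  have a: "lam m > 0" using assms(1) by (simp add: lam_def)
  have m: "real (p + d + m) / 2 = real (p + d) / 2 + lam m + 1" for p by (simp add: lam_def field_simps)
  have "gint m (\<lambda>x. zonal m (lam m) n y x * P x) =
    (\<Sum>j\<le>n div 2. complex_of_real (gcoef (lam m) n j * vnorm m y ^ (2 * j) * 2 ^ j * pochhammer (real (n - 2 * j + d) / 2 + lam m + 1) j *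
      (hcoef d (n - 2 * j) * vnorm m y ^ (n - 2 * j - d))) * (P y * gint m (\<lambda>_. 1)))"
    unfolding gint_zonal_mult[OF assms(2)] gint_normsq_inner_mult[OF assms(2)] gint_inner_power[OF assms(2,3)] m power_mult[symmetric]
    by (intro sum.cong refl) (simp add: mult_ac)
  also have "\<dots> = complex_of_real (if n = d then 2 ^ d * Gamma (real d + lam m) / Gamma (lam m) else 0) * (P y * gint m (\<lambda>_. 1))"
    unfolding sum_distrib_right[symmetric] of_real_sum[symmetric] zonal_coefficient_sum[OF a] ..
  finally show ?thesis by auto
qed

text \<open>The coefficient form of the derivative rule for Gegenbauer polynomials: differentiation
  raises the parameter, lowers the degree and multiplies by \<open>2 * a\<close>.\<close>

lemma gcoef_Suc:
  assumes "a > 0" "j \<le> n div 2"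
  shows "gcoef (a + 1) n j / real (Suc (n - 2 * j)) = gcoef a (Suc n) j / (2 * a)"
proof -
  have 1: "Suc n - 2 * j = Suc (n - 2 * j)" "Suc n - j = Suc (n - j)" using assms(2) by auto
  have 2: "Gamma (a + 1) = a * Gamma a" using assms(1) Gamma_pochhammer[of a 1] by simp
  have 3: "real (n - j) + (a + 1) = real (Suc (n - j)) + a" by simp
  have "Gamma a > 0" using assms(1) by simp
  then show ?thesis unfolding gcoef_def 1 2 3 fact_Suc[of "n - 2 * j"] power_Suc[of 2 "n - 2 * j"]
    using assms(1) by (simp add: divide_simps)
qed

text \<open>The eigenvalue relation produces \<mu>/(p+1) for the power p of <x,y>. By
  \<open>gcoef_Suc\<close> the denominator is absorbed by the change of parameter, so all terms
  share the factor \<mu>/(2 \<lambda>) and add up to a zonal polynomial one degree higher.\<close>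

lemma gint_zonal_wedge:
  assumes "m \<ge> 3" "gamma_eigen m d \<mu> f"
  shows "gint m (\<lambda>x. zonal m (lam m + 1) n y x * cl_mult m (cl_wedge m x y) (f x) C) =
     complex_of_real (\<mu> / (2 * lam m)) * gint m (\<lambda>x. zonal m (lam m) (Suc n) y x * f x C)"
proof -
  have a: "lam m > 0" using assms(1) by (simp add: lam_def)
  have cv: "\<And>x. cl_valued m (f x)" and h: "\<And>C. hpoly m d (\<lambda>x. f x C)" and H: "\<And>C. harmonic m (\<lambda>x. f x C)"
    and mu0: "d = 0 \<Longrightarrow> \<mu> = 0"
    and ev: "\<And>p C. gint m (\<lambda>x. complex_of_real (vinner m x y) ^ p * cl_mult m (cl_wedge m x y) (f x) C) =
        complex_of_real (\<mu> / real (Suc p)) * gint m (\<lambda>x. complex_of_real (vinner m x y) ^ Suc p * f x C)"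
    using assms(2) by (auto simp: gamma_eigen_def)
  note hW = hpoly_wedge_mult[OF cv h]
  let ?t = "\<lambda>j. complex_of_real (gcoef (lam m) (Suc n) j * ((vnorm m y)\<^sup>2) ^ j) *
      gint m (\<lambda>x. complex_of_real ((vnorm m x)\<^sup>2) ^ j * (complex_of_real (vinner m x y) ^ (Suc n - 2 * j) * f x C))"
  have "gint m (\<lambda>x. zonal m (lam m + 1) n y x * cl_mult m (cl_wedge m x y) (f x) C) =
     (\<Sum>j\<le>n div 2. complex_of_real (\<mu> / (2 * lam m)) * ?t j)"
    unfolding gint_zonal_mult[OF hW]
  proof (intro sum.cong refl)
    fix j assume "j \<in> {..n div 2}"
    then have j: "j \<le> n div 2" and p: "Suc n - 2 * j = Suc (n - 2 * j)" by auto
    define q where "q = n - 2 * j"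
    have "gcoef (lam m + 1) n j * (\<mu> / real (Suc q)) = \<mu> / (2 * lam m) * gcoef (lam m) (Suc n) j"
      using arg_cong[OF gcoef_Suc[OF a j], of "(*) \<mu>"] unfolding q_def by (simp add: mult.commute)
    then have e: "complex_of_real (gcoef (lam m + 1) n j) * complex_of_real (\<mu> / real (Suc q)) =
        complex_of_real (\<mu> / (2 * lam m)) * complex_of_real (gcoef (lam m) (Suc n) j)"
      by (simp only: of_real_mult[symmetric])
    have g: "gint m (\<lambda>x. complex_of_real ((vnorm m x)\<^sup>2) ^ j * (complex_of_real (vinner m x y) ^ q * cl_mult m (cl_wedge m x y) (f x) C)) =
      complex_of_real (\<mu> / real (Suc q)) * gint m (\<lambda>x. complex_of_real ((vnorm m x)\<^sup>2) ^ j * (complex_of_real (vinner m x y) ^ Suc q * f x C))"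
      unfolding gint_normsq_inner_mult[OF hW] gint_normsq_inner_mult[OF h] ev by simp
    show "complex_of_real (gcoef (lam m + 1) n j * ((vnorm m y)\<^sup>2) ^ j) *
       gint m (\<lambda>x. complex_of_real ((vnorm m x)\<^sup>2) ^ j * (complex_of_real (vinner m x y) ^ (n - 2 * j) * cl_mult m (cl_wedge m x y) (f x) C)) =
      complex_of_real (\<mu> / (2 * lam m)) * ?t j"
    proof -
      have comm: "a' * b * (c * G) = M' * (a'' * b * G)" if "a' * c = M' * a''" for a' b c G M' a'' :: complex
        using arg_cong[OF that, of "\<lambda>u. u * (b * G)"] by (simp only: mult_ac)
      show ?thesis unfolding p q_def[symmetric] g of_real_mult[of "gcoef _ _ _"] using e by (rule comm)
    qed
  qed
  \<comment> \<open>For odd \<open>n\<close> the sum on the right has one more term, with no factor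
    <x,y> left. It is a multiple of \<mu> times the Gaussian integral of \<open>f\<close>, which
    vanishes by harmonicity if \<open>d > 0\<close> and by \<mu> = 0 if
    \<open>d = 0\<close>.\<close>
  also have "\<dots> = (\<Sum>j\<le>Suc n div 2. complex_of_real (\<mu> / (2 * lam m)) * ?t j)"
  proof (rule sum.mono_neutral_left)
    show "\<forall>j\<in>{..Suc n div 2} - {..n div 2}. complex_of_real (\<mu> / (2 * lam m)) * ?t j = 0"
    proof
      fix j assume "j \<in> {..Suc n div 2} - {..n div 2}"
      then have p: "Suc n - 2 * j = 0" by auto
      have "\<mu> = 0 \<or> gint m (\<lambda>x. f x C) = 0" using mu0 gint_harmonic_eq_0[OF h H] by (cases "d = 0") auto
      then show "complex_of_real (\<mu> / (2 * lam m)) * ?t j = 0"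
        unfolding p gint_normsq_inner_mult[OF h] by auto
    qed
  qed (auto simp: div_le_mono)
  also have "\<dots> = complex_of_real (\<mu> / (2 * lam m)) * gint m (\<lambda>x. zonal m (lam m) (Suc n) y x * f x C)"
    unfolding gint_zonal_mult[OF h] sum_distrib_left ..
  finally show ?thesis .
qed

text \<open>\<open>bess \<nu> (z\<^sup>2) = z\<^sup>-\<^sup>\<nu> J\<^sub>\<nu>(z)\<close>, an entire function of \<open>z\<^sup>2\<close>.\<close>
definition bess :: "real \<Rightarrow> real \<Rightarrow> real" where
  "bess \<nu> t = (\<Sum>i. 2 powr (- \<nu>) * ((- t / 4) ^ i / (fact i * Gamma (real i + \<nu> + 1))))"

lemma bess_summable:
  assumes "\<nu> \<ge> 0"
  shows "summable (\<lambda>i. 2 powr (- \<nu>) * ((- t / 4) ^ i / (fact i * Gamma (real i + \<nu> + 1))))"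
proof -
  have G: "Gamma (real i + \<nu> + 1) \<ge> Gamma (\<nu> + 1)" for i
  proof -
    have "Gamma (real i + \<nu> + 1) = pochhammer (\<nu> + 1) i * Gamma (\<nu> + 1)"
      using Gamma_pochhammer[of "\<nu> + 1" i] assms by (simp add: add_ac)
    moreover have "pochhammer (\<nu> + 1) i \<ge> 1"
      unfolding pochhammer_prod by (rule prod_ge_1) (use assms in auto)
    ultimately show ?thesis using Gamma_real_pos[of "\<nu> + 1"] assms by simp
  qed
  have G0: "Gamma (\<nu> + 1) > 0" using assms by simp
  have "summable (\<lambda>i. 1 / Gamma (\<nu> + 1) * (inverse (fact i) * \<bar>t / 4\<bar> ^ i))"
    by (intro summable_mult summable_exp)
  then have "summable (\<lambda>i. (- t / 4) ^ i / (fact i * Gamma (real i + \<nu> + 1)))"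
  proof (rule summable_comparison_test'[where N = 0])
    fix i
    have "norm ((- t / 4) ^ i / (fact i * Gamma (real i + \<nu> + 1))) = \<bar>t / 4\<bar> ^ i / (fact i * Gamma (real i + \<nu> + 1))"
      using G[of i] G0 by (simp add: abs_mult power_abs power_divide)
    also have "\<dots> \<le> \<bar>t / 4\<bar> ^ i / (fact i * Gamma (\<nu> + 1))"
      using G[of i] G0 by (intro divide_left_mono mult_left_mono mult_pos_pos) auto
    finally show "norm ((- t / 4) ^ i / (fact i * Gamma (real i + \<nu> + 1))) \<le> 1 / Gamma (\<nu> + 1) * (inverse (fact i) * \<bar>t / 4\<bar> ^ i)"
      by (simp add: field_simps)
  qed
  then show ?thesis by (rule summable_mult)
qed

text \<open>For z > 0 the powers of z are regrouped term by term. At z = 0 the prescribed value of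
  \<open>zJ\<close> has to agree: its order equals \<open>a\<close> exactly when
  \<open>n = 0\<close>, and for \<open>n > 0\<close> the factor \<open>z ^ n\<close>
  vanishes.\<close>

lemma zJ_eq_bess:
  assumes "a > 0" "z \<ge> 0"
  shows "zJ a (real n + a) z = z ^ n * bess (real n + a) (z\<^sup>2)"
proof (cases "z = 0")
  case True
  have "bess a 0 = 1 / (2 powr a * Gamma (a + 1))"
  proof -
    have "bess a 0 = (\<Sum>i. if i = 0 then 2 powr (- a) / Gamma (a + 1) else 0)"
      unfolding bess_def by (intro arg_cong[where f=suminf] ext) (simp add: power_0_left)
    also have "\<dots> = 2 powr (- a) / Gamma (a + 1)"
      by (subst suminf_finite[where N = "{0}"]) auto
    finally show ?thesis by (simp add: powr_minus field_simps)
  qed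
  then show ?thesis using True by (cases n) (auto simp: zJ_def)
next
  case False
  then have z: "z > 0" using assms(2) by simp
  let ?\<nu> = "real n + a"
  have "z ^ n * bess ?\<nu> (z\<^sup>2) = (\<Sum>i. z ^ n * (2 powr (- ?\<nu>) * ((- z\<^sup>2 / 4) ^ i / (fact i * Gamma (real i + ?\<nu> + 1)))))"
    unfolding bess_def using assms by (intro suminf_mult[symmetric] bess_summable) simp
  also have eq: "(\<lambda>i. z ^ n * (2 powr (- ?\<nu>) * ((- z\<^sup>2 / 4) ^ i / (fact i * Gamma (real i + ?\<nu> + 1))))) =
    (\<lambda>i. z powr (- a) * ((-1) ^ i / (fact i * Gamma (real i + ?\<nu> + 1)) * (z / 2) powr (2 * real i + ?\<nu>)))"
  proof
    fix i
    have "(z / 2) powr (2 * real i + ?\<nu>) = (z / 2) ^ (2 * i) * ((z / 2) powr ?\<nu>)"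
      using z by (simp add: powr_add powr_realpow[symmetric])
    also have "(z / 2) powr ?\<nu> = z ^ n * z powr a * 2 powr (- ?\<nu>)"
      unfolding powr_minus divide_inverse[symmetric] using z by (simp add: powr_divide powr_add powr_realpow)
    also have "(z / 2) ^ (2 * i) = (z\<^sup>2 / 4) ^ i" by (simp add: power_mult power_divide)
    finally have 1: "(z / 2) powr (2 * real i + ?\<nu>) = (z\<^sup>2 / 4) ^ i * (z ^ n * z powr a * 2 powr (- ?\<nu>))" .
    have 2: "(- z\<^sup>2 / 4) ^ i = (-1) ^ i * (z\<^sup>2 / 4) ^ i" by (simp add: power_mult_distrib[symmetric])
    have 3: "z powr (- a) * z powr a = 1" using z by (simp add: powr_add[symmetric])
    have "z powr (- a) * ((-1) ^ i / (fact i * Gamma (real i + ?\<nu> + 1)) * ((z\<^sup>2 / 4) ^ i * (z ^ n * z powr a * 2 powr (- ?\<nu>)))) =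
      (z powr (- a) * z powr a) * (z ^ n * (2 powr (- ?\<nu>) * (((-1) ^ i * (z\<^sup>2 / 4) ^ i) / (fact i * Gamma (real i + ?\<nu> + 1)))))"
      by simp
    then show "z ^ n * (2 powr (- ?\<nu>) * ((- z\<^sup>2 / 4) ^ i / (fact i * Gamma (real i + ?\<nu> + 1)))) =
      z powr (- a) * ((-1) ^ i / (fact i * Gamma (real i + ?\<nu> + 1)) * (z / 2) powr (2 * real i + ?\<nu>))"
      unfolding 1 2 3 mult_1 by (rule sym)
  qed
  also have "(\<Sum>i. z powr (- a) * ((-1) ^ i / (fact i * Gamma (real i + ?\<nu> + 1)) * (z / 2) powr (2 * real i + ?\<nu>))) = z powr (- a) * besselJ ?\<nu> z"
  proof -
    have "summable (\<lambda>i. z powr (- a) * ((-1) ^ i / (fact i * Gamma (real i + ?\<nu> + 1)) * (z / 2) powr (2 * real i + ?\<nu>)))"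
      unfolding eq[symmetric] using assms by (intro summable_mult bess_summable) simp
    from summable_mult_D[OF this] show ?thesis unfolding besselJ_def using z by (intro suminf_mult) simp
  qed
  finally show ?thesis using z by (simp add: zJ_def)
qed

section \<open>Kernel terms as radial functions times homogeneous polynomials\<close>

lemma vnorm_nonneg [simp]: "vnorm m x \<ge> 0"
  by (simp add: vnorm_def sum_nonneg)

lemma vnorm_eq_0_iff: "vnorm m x = 0 \<longleftrightarrow> (\<forall>i<m. x i = 0)"
proof -
  have "vnorm m x = 0 \<longleftrightarrow> (vnorm m x)\<^sup>2 = 0" by simp
  then show ?thesis unfolding vnorm_sq by (subst (asm) sum_nonneg_eq_0_iff) auto
qed

lemma zz_power_gegenbauer:
  assumes "a > 0"
  shows "complex_of_real (zz m x y ^ n * gegenbauer a n (ww m x y)) = zonal m a n y x"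
\<comment> \<open>In this case \<open>ww\<close> divides by 0 and has no meaning of its own; the
  factor \<open>zz m x y ^ n\<close> removes it for \<open>n > 0\<close>, and for
  \<open>n = 0\<close> both sides are 1.\<close>
proof (cases "zz m x y = 0")
  case True
  then have "vnorm m x = 0 \<or> vnorm m y = 0" by (simp add: zz_def)
  then have v: "vinner m x y = 0" by (auto simp: vnorm_eq_0_iff vinner_def)
  show ?thesis
  proof (cases "n = 0")
    case True
    have "Gamma a \<noteq> 0" using assms by (rule Gamma_real_nonzero)
    then show ?thesis using True by (simp add: gegenbauer_def zonal_def gcoef_def)
  next
    case False
    have "complex_of_real (gcoef a n j * ((vnorm m y)\<^sup>2) ^ j) *
     (complex_of_real ((vnorm m x)\<^sup>2) ^ j * complex_of_real (vinner m x y) ^ (n - 2 * j)) = 0" for j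
      using \<open>vnorm m x = 0 \<or> vnorm m y = 0\<close> v False by (cases "j = 0") auto
    then have "zonal m a n y x = 0" unfolding zonal_def by (intro sum.neutral) blast
    then show ?thesis using True False by simp
  qed
next
  case False
  then have v: "vnorm m x \<noteq> 0" "vnorm m y \<noteq> 0" by (auto simp: zz_def)
  have w: "vinner m x y = zz m x y * ww m x y"
    unfolding vinner_def ww_def zz_def sum_distrib_left using v by (intro sum.cong) auto
  have "zz m x y ^ n * gegenbauer a n (ww m x y) =
     (\<Sum>j\<le>n div 2. gcoef a n j * ((vnorm m y)\<^sup>2) ^ j * (((vnorm m x)\<^sup>2) ^ j * vinner m x y ^ (n - 2 * j)))"
    unfolding gegenbauer_def sum_distrib_left
  proof (intro sum.cong refl)
    fix j assume "j \<in> {..n div 2}"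
    then have n: "n = 2 * j + (n - 2 * j)" by auto
    have "zz m x y ^ n = ((vnorm m x)\<^sup>2) ^ j * ((vnorm m y)\<^sup>2) ^ j * zz m x y ^ (n - 2 * j)"
      by (subst n, unfold power_add) (simp add: zz_def power_mult power_mult_distrib)
    then show "zz m x y ^ n * ((- 1) ^ j * Gamma (real (n - j) + a) / (Gamma a * fact j * fact (n - 2 * j)) * (2 * ww m x y) ^ (n - 2 * j)) =
      gcoef a n j * ((vnorm m y)\<^sup>2) ^ j * (((vnorm m x)\<^sup>2) ^ j * vinner m x y ^ (n - 2 * j))"
      unfolding gcoef_def w power_mult_distrib by (simp add: mult_ac)
  qed
  then show ?thesis unfolding zonal_def by simp
qed

lemma zJ_gegenbauer:
  assumes "a > 0"
  shows "complex_of_real (zJ a (real n + a) (zz m x y) * gegenbauer a n (ww m x y)) =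
    complex_of_real (bess (real n + a) ((vnorm m x)\<^sup>2 * (vnorm m y)\<^sup>2)) * zonal m a n y x"
proof -
  have "zz m x y \<ge> 0" by (simp add: zz_def)
  then show ?thesis unfolding zz_power_gegenbauer[OF assms, symmetric]
    by (simp add: zJ_eq_bess[OF assms] zz_def power_mult_distrib)
qed

text \<open>For fixed \<open>y\<close> a kernel term is thus a function of |x| times a homogeneous
  polynomial in \<open>x\<close>, the only shape that the integrals below handle.\<close>

lemma serA_eq:
  assumes "m \<ge> 3"
  shows "serA m a k x y = a k * complex_of_real (bess (real k + lam m) ((vnorm m x)\<^sup>2 * (vnorm m y)\<^sup>2)) * zonal m (lam m) k y x"
proof -
  have "lam m > 0" using assms by (simp add: lam_def)
  then show ?thesis unfolding serA_def by (simp only: zJ_gegenbauer mult.assoc)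
qed

lemma serB_eq:
  assumes "m \<ge> 3"
  shows "serB m b k x y = b (Suc k) * complex_of_real (bess (real (Suc k) + lam m) ((vnorm m x)\<^sup>2 * (vnorm m y)\<^sup>2)) * zonal m (lam m + 1) k y x"
proof -
  have "lam m + 1 > 0" using assms by (simp add: lam_def field_simps)
  moreover have "real (Suc k) + lam m = real k + (lam m + 1)" by simp
  ultimately show ?thesis unfolding serB_def by (simp only: zJ_gegenbauer mult.assoc)
qed

section \<open>Radial integrals of homogeneous functions\<close>

lemma measurable_coord [measurable]: "i < m \<Longrightarrow> (\<lambda>x. x i) \<in> borel_measurable (lebm m)"
  unfolding lebm_def using measurable_component_singleton[of i "{..<m}" "\<lambda>_. lborel :: real measure"] by simp

lemma measurable_vnorm [measurable]: "vnorm m \<in> borel_measurable (lebm m)"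
  unfolding vnorm_def[abs_def] by measurable

lemma measurable_hpoly: "hpoly m d P \<Longrightarrow> P \<in> borel_measurable (lebm m)"
proof (induction rule: hpoly.induct)
  case (add_mon P \<alpha> c)
  have "mon m \<alpha> \<in> borel_measurable (lebm m)" unfolding mon_def[abs_def]
    by (intro borel_measurable_prod borel_measurable_power borel_measurable_of_real measurable_coord) auto
  with add_mon show ?case by measurable
qed simp

text \<open>The restriction to \<open>{..<m}\<close> keeps the image in the space of
  \<open>lebm m\<close>, which consists of extensional functions.\<close>

definition dilate :: "nat \<Rightarrow> real \<Rightarrow> (nat \<Rightarrow> real) \<Rightarrow> nat \<Rightarrow> real" where
  "dilate m r x = (\<lambda>i\<in>{..<m}. r * x i)"

lemma measurable_dilate [measurable]: "dilate m r \<in> measurable (lebm m) (lebm m)"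
  unfolding dilate_def[abs_def] lebm_def by measurable

lemma emeasure_lborel_dilate:
  assumes "r > 0" "A \<in> sets borel"
  shows "ennreal r * emeasure lborel ((\<lambda>t. r * t) -` A) = emeasure lborel A"
proof -
  have "emeasure lborel A = emeasure (density (distr lborel borel (\<lambda>x. 0 + r * x)) (\<lambda>_. ennreal \<bar>r\<bar>)) A"
    using lborel_real_affine[of r 0] assms(1) by simp
  also have "\<dots> = ennreal r * emeasure lborel ((\<lambda>t. r * t) -` A)"
    using assms by (subst emeasure_density_const) (auto simp: emeasure_distr)
  finally show ?thesis ..
qed

text \<open>The change of variables as an equality of measures: a product measure is determined by
  boxes, and there the claim is one-dimensional.\<close>

lemma lebm_dilate:
  assumes "r > 0"
  shows "scale_measure (ennreal (r ^ m)) (distr (lebm m) (lebm m) (dilate m r)) = lebm m"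
  unfolding lebm_def
proof (rule lebm.PiM_eqI)
  fix A :: "nat \<Rightarrow> real set" assume A: "\<And>i. i \<in> {..<m} \<Longrightarrow> A i \<in> sets lborel"
  let ?L = "PiM {..<m} (\<lambda>_. lborel :: real measure)"
  have *: "dilate m r -` Pi\<^sub>E {..<m} A \<inter> space ?L = Pi\<^sub>E {..<m} (\<lambda>i. (\<lambda>t. r * t) -` A i)"
    by (auto simp: dilate_def space_PiM PiE_iff extensional_def)
  have "emeasure (distr ?L ?L (dilate m r)) (Pi\<^sub>E {..<m} A) = emeasure ?L (Pi\<^sub>E {..<m} (\<lambda>i. (\<lambda>t. r * t) -` A i))"
    using measurable_dilate[of m r] A by (subst emeasure_distr) (auto simp: * lebm_def intro!: sets_PiM_I_finite)
  also have "\<dots> = (\<Prod>i<m. emeasure lborel ((\<lambda>t. r * t) -` A i))"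
    using A by (intro lebm.emeasure_PiM) (use measurable_sets[of "\<lambda>t. r * t" borel borel] in auto)
  finally have "emeasure (scale_measure (ennreal (r ^ m)) (distr ?L ?L (dilate m r))) (Pi\<^sub>E {..<m} A) =
     ennreal (r ^ m) * (\<Prod>i<m. emeasure lborel ((\<lambda>t. r * t) -` A i))" by simp
  also have "\<dots> = (\<Prod>i<m. ennreal r * emeasure lborel ((\<lambda>t. r * t) -` A i))"
    using assms by (simp add: prod.distrib ennreal_power)
  also have "\<dots> = (\<Prod>i<m. emeasure lborel (A i))"
    using A assms by (intro prod.cong refl emeasure_lborel_dilate) auto
  finally show "emeasure (scale_measure (ennreal (r ^ m)) (distr ?L ?L (dilate m r))) (Pi\<^sub>E {..<m} A) = (\<Prod>i\<in>{..<m}. emeasure lborel (A i))" .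
qed simp_all

lemma nn_integral_dilate:
  assumes "r > 0" "f \<in> borel_measurable (lebm m)"
  shows "(\<integral>\<^sup>+x. f x \<partial>lebm m) = ennreal (r ^ m) * (\<integral>\<^sup>+x. f (dilate m r x) \<partial>lebm m)"
proof -
  have "(\<integral>\<^sup>+x. f x \<partial>lebm m) = (\<integral>\<^sup>+x. f x \<partial>scale_measure (ennreal (r ^ m)) (distr (lebm m) (lebm m) (dilate m r)))"
    by (simp add: lebm_dilate[OF assms(1)])
  also have "\<dots> = ennreal (r ^ m) * (\<integral>\<^sup>+x. f (dilate m r x) \<partial>lebm m)"
    using assms(2) by (simp add: nn_integral_scale_measure nn_integral_distr)
  finally show ?thesis .
qed

lemma vnorm_dilate: "r > 0 \<Longrightarrow> vnorm m (dilate m r x) = r * vnorm m x"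
proof -
  assume r: "r > 0"
  have "(\<Sum>i<m. (dilate m r x i)\<^sup>2) = r\<^sup>2 * (\<Sum>i<m. (x i)\<^sup>2)"
    unfolding sum_distrib_left by (intro sum.cong) (auto simp: dilate_def power_mult_distrib)
  then show ?thesis using r by (simp add: vnorm_def real_sqrt_mult)
qed

lemma hpoly_dilate:
  assumes "hpoly m d P"
  shows "P (dilate m r x) = complex_of_real (r ^ d) * P x"
proof -
  have "P (dilate m r x) = P (\<lambda>i. r * x i)" by (rule hpoly_cong_coords[OF assms]) (simp add: dilate_def)
  then show ?thesis using hpoly_homogeneous[OF assms] by simp
qed

lemma nn_integral_ball_homogeneous:
  assumes "R > 0" "q \<in> borel_measurable (lebm m)" "\<And>r x. r > 0 \<Longrightarrow> q (dilate m r x) = ennreal (r ^ d) * q x"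
  shows "(\<integral>\<^sup>+x. q x * indicator {..<R} (vnorm m x) \<partial>lebm m) =
     ennreal (R ^ m) * (ennreal (R ^ d) * (\<integral>\<^sup>+x. q x * indicator {..<1} (vnorm m x) \<partial>lebm m))"
proof -
  have [measurable]: "q \<in> borel_measurable (lebm m)" by fact
  have "(\<integral>\<^sup>+x. q x * indicator {..<R} (vnorm m x) \<partial>lebm m) =
    ennreal (R ^ m) * (\<integral>\<^sup>+x. q (dilate m R x) * indicator {..<R} (vnorm m (dilate m R x)) \<partial>lebm m)"
    by (rule nn_integral_dilate[OF assms(1)]) measurable
  also have "(\<lambda>x. q (dilate m R x) * indicator {..<R} (vnorm m (dilate m R x))) =
     (\<lambda>x. ennreal (R ^ d) * (q x * indicator {..<1} (vnorm m x)))"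
    using assms(1) by (auto simp: vnorm_dilate assms(3) indicator_def mult.assoc)
  also have "(\<integral>\<^sup>+x. ennreal (R ^ d) * (q x * indicator {..<1} (vnorm m x)) \<partial>lebm m) =
     ennreal (R ^ d) * (\<integral>\<^sup>+x. q x * indicator {..<1} (vnorm m x) \<partial>lebm m)"
    by (rule nn_integral_cmult) measurable
  finally show ?thesis .
qed

text \<open>The measures with densities \<open>p\<close> and \<open>q\<close> are pushed forward
  along |x|. The images agree and are finite on the half-lines \<open>{..<R}\<close>, which form an
  intersection-stable generator of the Borel sets, so they coincide and integrate every \<phi>
  alike.\<close>

lemma nn_integral_radial_eqI:
  assumes [measurable]: "p \<in> borel_measurable (lebm m)" "q \<in> borel_measurable (lebm m)" "\<phi> \<in> borel_measurable borel"
    and eq: "\<And>R. R > 0 \<Longrightarrow> (\<integral>\<^sup>+x. p x * indicator {..<R} (vnorm m x) \<partial>lebm m) = (\<integral>\<^sup>+x. q x * indicator {..<R} (vnorm m x) \<partial>lebm m)"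
    and fin: "\<And>R. R > 0 \<Longrightarrow> (\<integral>\<^sup>+x. p x * indicator {..<R} (vnorm m x) \<partial>lebm m) < \<infinity>"
  shows "(\<integral>\<^sup>+x. p x * \<phi> (vnorm m x) \<partial>lebm m) = (\<integral>\<^sup>+x. q x * \<phi> (vnorm m x) \<partial>lebm m)"
proof -
  define D where "D = (\<lambda>p. distr (density (lebm m) p) borel (vnorm m))"
  have D: "emeasure (D p) {..<R} = (\<integral>\<^sup>+x. p x * indicator {..<R} (vnorm m x) \<partial>lebm m)"
    if [measurable]: "p \<in> borel_measurable (lebm m)" for p R
    unfolding D_def by (subst emeasure_distr) (auto simp: emeasure_density intro!: nn_integral_cong split: split_indicator)
  have eq': "emeasure (D p) {..<R} = emeasure (D q) {..<R}" for R
  proof (cases "R > 0")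
    case False
    then have "indicator {..<R} (vnorm m x) = (0::ennreal)" for x using vnorm_nonneg[of m x] by (auto simp: indicator_def simp del: vnorm_nonneg)
    then show ?thesis unfolding D[OF assms(1)] D[OF assms(2)] by simp
  qed (simp add: D assms(1,2) eq)
  have sets_D: "sets (D p) = sigma_sets UNIV (range lessThan)" for p
  proof -
    have "sets (borel :: real measure) = sigma_sets UNIV (range lessThan)"
      by (rule trans[OF arg_cong[where f = sets, OF borel_Iio] sets_measure_of]) simp
    then show ?thesis unfolding D_def sets_distr .
  qed
  have "D p = D q"
  proof (rule measure_eqI_generator_eq[where E = "range lessThan" and \<Omega> = UNIV and A = "\<lambda>n. {..<real (Suc n)}"])
    show "Int_stable (range lessThan :: real set set)"
    proof (rule Int_stableI)
      fix A B :: "real set" assume "A \<in> range lessThan" "B \<in> range lessThan"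
      then obtain a b where "A = {..<a}" "B = {..<b}" by auto
      then have "A \<inter> B = {..<min a b}" by auto
      then show "A \<inter> B \<in> range lessThan" by blast
    qed
    show "sets (D p) = sigma_sets UNIV (range lessThan)" "sets (D q) = sigma_sets UNIV (range lessThan)"
      by (rule sets_D)+
    show "(\<Union>n. {..<real (Suc n)}) = UNIV"
    proof (intro set_eqI iffI UNIV_I)
      fix t :: real
      obtain n where "t < real n" using reals_Archimedean2 by blast
      then have "t \<in> {..<real (Suc n)}" by simp
      then show "t \<in> (\<Union>n. {..<real (Suc n)})" by blast
    qed
    show "emeasure (D p) {..<real (Suc n)} \<noteq> \<infinity>" for n
      using fin[of "real (Suc n)"] by (simp add: D[OF assms(1)])
  qed (insert eq', fast+)
  moreover have "(\<integral>\<^sup>+x. p x * \<phi> (vnorm m x) \<partial>lebm m) = (\<integral>\<^sup>+r. \<phi> r \<partial>D p)" if [measurable]: "p \<in> borel_measurable (lebm m)" for p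
    unfolding D_def by (simp add: nn_integral_distr nn_integral_density)
  ultimately show ?thesis using assms(1,2) by simp
qed

text \<open>The positive and negative parts of \<open>p\<close> are homogeneous, so each assigns to
  the ball of radius \<open>R\<close> the mass \<open>R ^ (m + d)\<close> times its mass on the unit
  ball. The vanishing Gaussian integral forces equal unit masses; then the radial distributions of
  both parts coincide, and any radial factor gives a vanishing integral.\<close>

lemma radial_integral_eq_0_real:
  fixes p :: "(nat \<Rightarrow> real) \<Rightarrow> real" and H :: "real \<Rightarrow> real"
  assumes [measurable]: "p \<in> borel_measurable (lebm m)" "H \<in> borel_measurable borel"
    and hom: "\<And>r x. r > 0 \<Longrightarrow> p (dilate m r x) = r ^ d * p x"
    and int: "integrable (lebm m) (\<lambda>x. p x * exp (- (vnorm m x)\<^sup>2 / 2))"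
    and zero: "integral\<^sup>L (lebm m) (\<lambda>x. p x * exp (- (vnorm m x)\<^sup>2 / 2)) = 0"
  shows "integral\<^sup>L (lebm m) (\<lambda>x. H (vnorm m x) * p x) = 0"
proof -
  define P Q where "P = (\<lambda>x. ennreal (p x))" and "Q = (\<lambda>x. ennreal (- p x))"
  define N where "N = (\<lambda>q R. \<integral>\<^sup>+x. q x * indicator {..<R::real} (vnorm m x) \<partial>lebm m)"
  define g where "g = (\<lambda>r::real. ennreal (exp (- r\<^sup>2 / 2)))"
  have [measurable]: "P \<in> borel_measurable (lebm m)" "Q \<in> borel_measurable (lebm m)" "g \<in> borel_measurable borel"
    unfolding P_def Q_def g_def by measurable
  have Pg: "P x * g (vnorm m x) = ennreal (p x * exp (- (vnorm m x)\<^sup>2 / 2))"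
    and Qg: "Q x * g (vnorm m x) = ennreal (- (p x * exp (- (vnorm m x)\<^sup>2 / 2)))" for x
    unfolding P_def Q_def g_def by (simp_all add: ennreal_mult''[symmetric])
  define I where "I = (\<integral>\<^sup>+x. P x * g (vnorm m x) \<partial>lebm m)"
  define I' where "I' = (\<integral>\<^sup>+x. Q x * g (vnorm m x) \<partial>lebm m)"
  have fin: "I < \<infinity>" "I' < \<infinity>"
    using int unfolding I_def I'_def Pg Qg real_integrable_def by (auto simp: less_top[symmetric])
  have II: "I = I'"
  proof -
    have "enn2real I - enn2real I' = 0"
      using zero unfolding real_lebesgue_integral_def[OF int] I_def I'_def Pg Qg .
    then have "ennreal (enn2real I) = ennreal (enn2real I')" by simp
    moreover have "ennreal (enn2real I) = I" "ennreal (enn2real I') = I'" using fin by simp_all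
    ultimately show ?thesis by (simp only:)
  qed
  have scal: "P (dilate m r x) = ennreal (r ^ d) * P x" "Q (dilate m r x) = ennreal (r ^ d) * Q x" if "r > 0" for r x
    unfolding P_def Q_def hom[OF that] using that by (simp_all add: ennreal_mult'[symmetric])
  have NR: "N P R = ennreal (R ^ m) * (ennreal (R ^ d) * N P 1)" "N Q R = ennreal (R ^ m) * (ennreal (R ^ d) * N Q 1)" if "R > 0" for R
    unfolding N_def by (rule nn_integral_ball_homogeneous[OF that]; use scal in \<open>simp\<close>)+
  \<comment> \<open>On the unit ball the Gaussian is at least \<open>exp (- 1 / 2)\<close>, so unit
    masses are bounded by Gaussian integrals and hence finite.\<close>
  have bound: "N q 1 \<le> ennreal (exp (1/2)) * (\<integral>\<^sup>+x. q x * g (vnorm m x) \<partial>lebm m)"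
    if [measurable]: "q \<in> borel_measurable (lebm m)" for q
  proof -
    have "N q 1 \<le> (\<integral>\<^sup>+x. ennreal (exp (1/2)) * (q x * g (vnorm m x)) \<partial>lebm m)"
      unfolding N_def
    proof (rule nn_integral_mono)
      fix x
      have "indicator {..<1} (vnorm m x) \<le> ennreal (exp (1/2)) * g (vnorm m x)"
      proof (cases "vnorm m x < 1")
        case True
        then have "(vnorm m x)\<^sup>2 \<le> 1" by (simp add: power_le_one)
        then have "1 \<le> exp (1/2) * exp (- (vnorm m x)\<^sup>2 / 2)" by (simp add: mult_exp_exp)
        then show ?thesis unfolding g_def by (simp add: ennreal_mult[symmetric] ennreal_1[symmetric] indicator_def del: ennreal_1)
      qed simp
      then have "q x * indicator {..<1} (vnorm m x) \<le> q x * (ennreal (exp (1/2)) * g (vnorm m x))"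
        by (rule mult_left_mono) simp
      then show "q x * indicator {..<1} (vnorm m x) \<le> ennreal (exp (1/2)) * (q x * g (vnorm m x))" by (simp add: mult_ac)
    qed
    also have "\<dots> = ennreal (exp (1/2)) * (\<integral>\<^sup>+x. q x * g (vnorm m x) \<partial>lebm m)"
      by (rule nn_integral_cmult) measurable
    finally show ?thesis .
  qed
  have c_fin: "N P 1 < \<infinity>" "N Q 1 < \<infinity>"
    using fin unfolding I_def I'_def
    by (auto intro!: le_less_trans[OF bound] simp: ennreal_mult_less_top)
  have "N P 1 = N Q 1"
  proof (cases "I = 0")
    case True
    then have "N P 1 = 0" "N Q 1 = 0" using bound[of P] bound[of Q] II unfolding I_def[symmetric] I'_def[symmetric] by simp_all
    then show ?thesis by simp
  next
    case False
    \<comment> \<open>Cross-multiplying with the unit masses gives two densities with the same mass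
      on every ball, hence with equal Gaussian integrals. As \<open>I = I'\<close> is finite and
      nonzero, it cancels and the unit masses agree.\<close>
    have "(\<integral>\<^sup>+x. (N Q 1 * P x) * g (vnorm m x) \<partial>lebm m) = (\<integral>\<^sup>+x. (N P 1 * Q x) * g (vnorm m x) \<partial>lebm m)"
    proof (rule nn_integral_radial_eqI)
      fix R :: real assume R: "R > 0"
      have 1: "(\<integral>\<^sup>+x. N Q 1 * P x * indicator {..<R} (vnorm m x) \<partial>lebm m) = N Q 1 * N P R"
        unfolding N_def mult.assoc by (rule nn_integral_cmult) measurable
      have 2: "(\<integral>\<^sup>+x. N P 1 * Q x * indicator {..<R} (vnorm m x) \<partial>lebm m) = N P 1 * N Q R"
        unfolding N_def mult.assoc by (rule nn_integral_cmult) measurable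
      show "(\<integral>\<^sup>+x. N Q 1 * P x * indicator {..<R} (vnorm m x) \<partial>lebm m) = (\<integral>\<^sup>+x. N P 1 * Q x * indicator {..<R} (vnorm m x) \<partial>lebm m)"
        unfolding 1 2 NR[OF R] by (simp only: mult_ac)
      show "(\<integral>\<^sup>+x. N Q 1 * P x * indicator {..<R} (vnorm m x) \<partial>lebm m) < \<infinity>"
        unfolding 1 NR[OF R] using c_fin by (simp add: ennreal_mult_less_top)
    qed measurable
    moreover have "(\<integral>\<^sup>+x. (c * q x) * g (vnorm m x) \<partial>lebm m) = c * (\<integral>\<^sup>+x. q x * g (vnorm m x) \<partial>lebm m)"
      if [measurable]: "q \<in> borel_measurable (lebm m)" for q c
      unfolding mult.assoc by (rule nn_integral_cmult) measurable
    ultimately have "N Q 1 * I = N P 1 * I'" unfolding I_def I'_def by simp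
    then have "N Q 1 * I = N P 1 * I" unfolding II .
    then have "I * N Q 1 = I * N P 1" by (simp only: mult.commute)
    then show ?thesis using False fin(1) unfolding ennreal_mult_cancel_left by auto
  qed
  then have NN: "N P R = N Q R" if "R > 0" for R using NR[OF that] by simp
  have rad: "(\<integral>\<^sup>+x. P x * \<phi> (vnorm m x) \<partial>lebm m) = (\<integral>\<^sup>+x. Q x * \<phi> (vnorm m x) \<partial>lebm m)" if "\<phi> \<in> borel_measurable borel" for \<phi>
  proof (rule nn_integral_radial_eqI)
    fix R :: real assume R: "R > 0"
    show "(\<integral>\<^sup>+x. P x * indicator {..<R} (vnorm m x) \<partial>lebm m) = (\<integral>\<^sup>+x. Q x * indicator {..<R} (vnorm m x) \<partial>lebm m)"
      using NN[OF R] unfolding N_def .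
    have "N P R < \<infinity>" unfolding NR(1)[OF R] using c_fin by (simp add: ennreal_mult_less_top)
    then show "(\<integral>\<^sup>+x. P x * indicator {..<R} (vnorm m x) \<partial>lebm m) < \<infinity>" unfolding N_def .
  qed (use that in measurable)
  let ?h = "\<lambda>r. ennreal (H r)" and ?k = "\<lambda>r. ennreal (- H r)"
  \<comment> \<open>\<open>H\<close> may change sign, so the positive part of the product collects
    the two combinations of equal sign, and the negative part those of opposite sign. Since
    \<open>P\<close> and \<open>Q\<close> are interchangeable under radial weights, both parts have
    the same integral.\<close>
  have pos: "ennreal (H (vnorm m x) * p x) = P x * ?h (vnorm m x) + Q x * ?k (vnorm m x)"
    and neg: "ennreal (- (H (vnorm m x) * p x)) = Q x * ?h (vnorm m x) + P x * ?k (vnorm m x)" for x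
  proof -
    have "ennreal (a * b) = ennreal b * ennreal a + ennreal (- b) * ennreal (- a)" for a b
    proof (cases "a \<ge> 0")
      case a: True
      show ?thesis
      proof (cases "b \<ge> 0")
        case True
        then have "ennreal (a * b) = ennreal a * ennreal b" using a by (intro ennreal_mult)
        then show ?thesis using a True by (simp add: ennreal_neg mult.commute)
      next
        case False
        then have "a * b \<le> 0" using a by (simp add: mult_nonneg_nonpos)
        then show ?thesis using a False by (simp add: ennreal_neg)
      qed
    next
      case a: False
      show ?thesis
      proof (cases "b \<ge> 0")
        case True
        then have "a * b \<le> 0" using a by (simp add: mult_nonpos_nonneg)
        then show ?thesis using a True by (simp add: ennreal_neg)
      next
        case False
        have "ennreal (- a * - b) = ennreal (- a) * ennreal (- b)" using a False by (intro ennreal_mult) auto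
        then show ?thesis using a False by (simp add: ennreal_neg mult.commute)
      qed
    qed
    from this[of "H (vnorm m x)" "p x"] this[of "H (vnorm m x)" "- p x"]
    show "ennreal (H (vnorm m x) * p x) = P x * ?h (vnorm m x) + Q x * ?k (vnorm m x)"
      "ennreal (- (H (vnorm m x) * p x)) = Q x * ?h (vnorm m x) + P x * ?k (vnorm m x)"
      by (simp_all add: P_def Q_def)
  qed
  show ?thesis
  proof (cases "integrable (lebm m) (\<lambda>x. H (vnorm m x) * p x)")
    case True
    show ?thesis unfolding real_lebesgue_integral_def[OF True] pos neg
      using rad[of ?h] rad[of ?k] by (simp add: nn_integral_add)
  \<comment> \<open>Without integrability the Bochner integral is 0 by convention.\<close>
  qed (simp add: not_integrable_integral_eq)
qed

lemma radial_integral_eq_0: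
  assumes "hpoly m d P" "gint m P = 0" and [measurable]: "H \<in> borel_measurable borel"
  shows "integral\<^sup>L (lebm m) (\<lambda>x. complex_of_real (H (vnorm m x)) * P x) = 0"
proof (cases "integrable (lebm m) (\<lambda>x. complex_of_real (H (vnorm m x)) * P x)")
  case True
  have [measurable]: "P \<in> borel_measurable (lebm m)" by (rule measurable_hpoly[OF assms(1)])
  have i: "integrable (lebm m) (\<lambda>x. P x * gauss m x)" by (rule integrable_hpoly_gauss[OF assms(1)])
  have "integral\<^sup>L (lebm m) (\<lambda>x. H (vnorm m x) * Re (P x)) = 0"
  proof (rule radial_integral_eq_0_real[where d = d])
    show "integrable (lebm m) (\<lambda>x. Re (P x) * exp (- (vnorm m x)\<^sup>2 / 2))"
      using integrable_Re[OF i] by (simp add: gauss_def)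
    show "integral\<^sup>L (lebm m) (\<lambda>x. Re (P x) * exp (- (vnorm m x)\<^sup>2 / 2)) = 0"
      using integral_Re[OF i] assms(2) by (simp add: gint_def gauss_def)
  qed (simp_all add: hpoly_dilate[OF assms(1)])
  moreover have "integral\<^sup>L (lebm m) (\<lambda>x. H (vnorm m x) * Im (P x)) = 0"
  proof (rule radial_integral_eq_0_real[where d = d])
    show "integrable (lebm m) (\<lambda>x. Im (P x) * exp (- (vnorm m x)\<^sup>2 / 2))"
      using integrable_Im[OF i] by (simp add: gauss_def)
    show "integral\<^sup>L (lebm m) (\<lambda>x. Im (P x) * exp (- (vnorm m x)\<^sup>2 / 2)) = 0"
      using integral_Im[OF i] assms(2) by (simp add: gint_def gauss_def)
  qed (simp_all add: hpoly_dilate[OF assms(1)])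
  ultimately show ?thesis using integral_Re[OF True] integral_Im[OF True] by (simp add: complex_eq_iff)
qed (simp add: not_integrable_integral_eq)

section \<open>Laguerre functions\<close>

lemma exp_binomial_sums:
  fixes t :: real
  shows "(\<lambda>i. t ^ i / fact i * real (i choose p)) sums (exp t * t ^ p / fact p)"
proof -
  have "(\<lambda>i. t ^ i / fact i) sums exp t"
    using exp_converges[of t] by (simp add: divide_inverse mult.commute)
  then have "(\<lambda>i. t ^ p / fact p * (t ^ i / fact i)) sums (t ^ p / fact p * exp t)"
    by (rule sums_mult)
  moreover have "t ^ p / fact p * (t ^ i / fact i) = t ^ (i + p) / fact (i + p) * real ((i + p) choose p)" for i
    by (simp add: binomial_fact power_add)
  ultimately have "(\<lambda>i. t ^ (i + p) / fact (i + p) * real ((i + p) choose p)) sums (exp t * t ^ p / fact p)"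
    by (simp add: mult.commute)
  then show ?thesis by (subst (asm) sums_zero_iff_shift) auto
qed

text \<open>Vandermonde's identity expands the Pochhammer symbol in the binomials
  \<open>i choose p\<close>, and each of these picks the factor \<open>t ^ p / fact p\<close> out of
  the exponential series. The result is a Laguerre polynomial at \<open>- t\<close>.\<close>

lemma exp_pochhammer_sums:
  fixes t :: real
  shows "(\<lambda>i. t ^ i / fact i * pochhammer (real i + \<nu> + 1) l) sums (fact l * exp t * laguerre l \<nu> (- t))"
proof -
  have 1: "pochhammer (real i + \<nu> + 1) l = fact l * (\<Sum>p\<le>l. real (i choose p) * ((real l + \<nu>) gchoose (l - p)))" for i
  proof -
    have "(real i + (real l + \<nu>)) gchoose l = pochhammer (real i + \<nu> + 1) l / fact l"
      unfolding gbinomial_pochhammer' by (simp add: algebra_simps)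
    moreover have "(\<Sum>p\<le>l. (real i gchoose p) * ((real l + \<nu>) gchoose (l - p))) = (real i + (real l + \<nu>)) gchoose l"
      unfolding atMost_atLeast0 by (rule gbinomial_Vandermonde)
    ultimately show ?thesis by (simp add: binomial_gbinomial)
  qed
  have "(\<lambda>i. \<Sum>p\<le>l. (fact l * ((real l + \<nu>) gchoose (l - p))) * (t ^ i / fact i * real (i choose p))) sums
    (\<Sum>p\<le>l. (fact l * ((real l + \<nu>) gchoose (l - p))) * (exp t * t ^ p / fact p))"
    by (intro sums_sum sums_mult exp_binomial_sums)
  also have "(\<lambda>i. \<Sum>p\<le>l. (fact l * ((real l + \<nu>) gchoose (l - p))) * (t ^ i / fact i * real (i choose p))) =
    (\<lambda>i. t ^ i / fact i * pochhammer (real i + \<nu> + 1) l)"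
    unfolding 1 sum_distrib_left by (intro ext sum.cong refl) simp
  also have "(\<Sum>p\<le>l. (fact l * ((real l + \<nu>) gchoose (l - p))) * (exp t * t ^ p / fact p)) = fact l * exp t * laguerre l \<nu> (- t)"
    unfolding laguerre_def sum_distrib_left by (intro sum.cong refl) (simp add: power_mult_distrib[symmetric])
  finally show ?thesis .
qed

text \<open>The left side arises when the monomials of a Laguerre polynomial are transformed one by
  one, each yielding a Laguerre polynomial at \<open>s / 2\<close>. Trinomial revision and an
  exchange of sums reduce it to a binomial sum for each power of \<open>s\<close>.\<close>

lemma laguerre_double_argument:
  "(\<Sum>l\<le>j. (-1) ^ l * ((real j + \<nu>) gchoose (j - l)) * 2 ^ l * laguerre l \<nu> (s / 2)) = (-1) ^ j * laguerre j \<nu> s"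
proof -
  let ?a = "real j + \<nu>"
  have "(\<Sum>l\<le>j. (-1) ^ l * (?a gchoose (j - l)) * 2 ^ l * laguerre l \<nu> (s / 2)) =
    (\<Sum>l\<le>j. \<Sum>p\<le>l. (-1) ^ l * (?a gchoose (j - l)) * 2 ^ l * ((-1) ^ p * ((real l + \<nu>) gchoose (l - p)) * (s / 2) ^ p / fact p))"
    by (simp add: laguerre_def sum_distrib_left)
  also have "\<dots> = (\<Sum>l\<le>j. \<Sum>p\<le>l. (?a gchoose (j - p)) * ((-1) ^ p * (s / 2) ^ p / fact p) * ((-2) ^ l * real ((j - p) choose (l - p))))"
  proof (intro sum.cong refl)
    fix l p assume "l \<in> {..j}" "p \<in> {..l}"
    then have lp: "l \<le> j" "p \<le> l" by auto
    have "(?a gchoose (j - p)) * (real (j - p) gchoose (j - l)) = (?a gchoose (j - l)) * (?a - real (j - l) gchoose (j - p - (j - l)))"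
      using lp by (intro gbinomial_trinomial_revision) auto
    moreover have "?a - real (j - l) = real l + \<nu>" "j - p - (j - l) = l - p" using lp by auto
    moreover have "real (j - p) gchoose (j - l) = real ((j - p) choose (l - p))"
    proof -
      have "j - l \<le> j - p" "j - p - (j - l) = l - p" using lp by auto
      then show ?thesis unfolding binomial_gbinomial[symmetric] using binomial_symmetric[of "j - l" "j - p"] by simp
    qed
    ultimately have e: "(?a gchoose (j - l)) * (real l + \<nu> gchoose (l - p)) = (?a gchoose (j - p)) * real ((j - p) choose (l - p))"
      by (simp add: add.commute)
    have "(-2 :: real) ^ l = (-1) ^ l * 2 ^ l" by (simp add: power_mult_distrib[symmetric])
    then show "(-1) ^ l * (?a gchoose (j - l)) * 2 ^ l * ((-1) ^ p * ((real l + \<nu>) gchoose (l - p)) * (s / 2) ^ p / fact p) =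
      (?a gchoose (j - p)) * ((-1) ^ p * (s / 2) ^ p / fact p) * ((-2) ^ l * real ((j - p) choose (l - p)))"
      using arg_cong[OF e, of "\<lambda>u. (-1) ^ l * 2 ^ l * ((-1) ^ p * (s / 2) ^ p / fact p) * u"] by (simp add: mult_ac)
  qed
  also have "\<dots> = (\<Sum>p\<le>j. \<Sum>l=p..j. (?a gchoose (j - p)) * ((-1) ^ p * (s / 2) ^ p / fact p) * ((-2) ^ l * real ((j - p) choose (l - p))))"
  proof -
    have "(\<Sum>l\<le>j. \<Sum>p\<le>l. f l p) = (\<Sum>p\<le>j. \<Sum>l=p..j. f l p)" for f :: "nat \<Rightarrow> nat \<Rightarrow> real"
    proof -
      have "(\<Sum>l\<le>j. \<Sum>p\<le>l. f l p) = (\<Sum>l\<le>j. \<Sum>p | p \<in> {..j} \<and> p \<le> l. f l p)"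
        by (intro sum.cong refl) auto
      also have "\<dots> = (\<Sum>p\<le>j. \<Sum>l | l \<in> {..j} \<and> p \<le> l. f l p)"
        by (rule sum.swap_restrict) auto
      also have "\<dots> = (\<Sum>p\<le>j. \<Sum>l=p..j. f l p)" by (intro sum.cong refl) auto
      finally show ?thesis .
    qed
    then show ?thesis .
  qed
  also have "\<dots> = (\<Sum>p\<le>j. (-1) ^ j * ((-1) ^ p * (?a gchoose (j - p)) * s ^ p / fact p))"
  proof (intro sum.cong refl)
    fix p assume "p \<in> {..j}"
    then obtain q where q: "j = q + p" by (metis atMost_iff le_iff_add add.commute)
    have "(\<Sum>l=0+p..q+p. (-2) ^ l * real ((j - p) choose (l - p))) = (\<Sum>k=0..q. (-2) ^ (k + p) * real ((j - p) choose (k + p - p)))"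
      by (rule sum.shift_bounds_cl_nat_ivl)
    then have "(\<Sum>l=p..j. (-2) ^ l * real ((j - p) choose (l - p))) = (\<Sum>k\<le>q. (-2) ^ p * (real (q choose k) * (-2) ^ k * 1 ^ (q - k)))"
      by (simp add: q power_add atMost_atLeast0 mult_ac)
    \<comment> \<open>The binomial theorem at -2 + 1 = -1: the origin of the sign
      \<open>(-1) ^ j\<close> in the eigenvalue.\<close>
    also have "\<dots> = (-2) ^ p * (-2 + 1) ^ q" unfolding binomial_ring[of "- 2 :: real" 1 q] sum_distrib_left ..
    finally have "(\<Sum>l=p..j. (-2) ^ l * real ((j - p) choose (l - p))) = (-2) ^ p * (-1) ^ q" by simp
    moreover have "(-2 :: real) ^ p = (-1) ^ p * 2 ^ p" by (simp add: power_mult_distrib[symmetric])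
    ultimately have e: "(\<Sum>l=p..j. (-2) ^ l * real ((j - p) choose (l - p))) = (-1) ^ j * 2 ^ p"
      by (simp add: q power_add mult_ac)
    show "(\<Sum>l=p..j. (?a gchoose (j - p)) * ((-1) ^ p * (s / 2) ^ p / fact p) * ((-2) ^ l * real ((j - p) choose (l - p)))) =
       (-1) ^ j * ((-1) ^ p * (?a gchoose (j - p)) * s ^ p / fact p)"
      unfolding sum_distrib_left[symmetric] e by (simp add: power_divide)
  qed
  also have "\<dots> = (-1) ^ j * laguerre j \<nu> s"
    by (simp add: laguerre_def sum_distrib_left)
  finally show ?thesis .
qed

lemma summable_pochhammer_Gamma:
  assumes "u \<ge> 0" "b > 0" "\<nu> \<ge> 0"
  shows "summable (\<lambda>i. u ^ i * pochhammer b i / (fact i * Gamma (real i + \<nu> + 1)))"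
proof (rule summable_ratio_test)
  \<comment> \<open>From this index on \<open>2 * u * (b + 1) \<le> i\<close>, which makes the ratio
    of consecutive terms at most 1/2.\<close>
  define N where "N = nat \<lceil>2 * u * (b + 1)\<rceil>"
  show "(1/2 :: real) < 1" by simp
  fix i assume "N \<le> i"
  then have i: "2 * u * (b + 1) \<le> real i" unfolding N_def by linarith
  have G: "Gamma (real i + \<nu> + 1) > 0" using assms by (intro Gamma_real_pos) auto
  have GS: "Gamma (real (Suc i) + \<nu> + 1) = (real i + \<nu> + 1) * Gamma (real i + \<nu> + 1)"
    using Gamma_pochhammer[of "real i + \<nu> + 1" 1] assms by (simp add: add_ac)
  have p0: "pochhammer b i \<ge> 0" using assms by (intro pochhammer_nonneg) auto
  define A where "A = u ^ i * pochhammer b i / (fact i * Gamma (real i + \<nu> + 1))"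
  have A: "A \<ge> 0" unfolding A_def using assms p0 G by auto
  have "u * (b + real i) / ((real i + 1) * (real i + \<nu> + 1)) \<le> 1/2"
  proof -
    have "b + real i \<le> (b + 1) * (real i + 1)" using assms by (simp add: algebra_simps)
    then have "2 * u * (b + real i) \<le> 2 * u * ((b + 1) * (real i + 1))" using assms by (intro mult_left_mono) auto
    then have "2 * (u * (b + real i)) \<le> 2 * u * (b + 1) * (real i + 1)" by (simp only: mult.assoc)
    also have "\<dots> \<le> real i * (real i + 1)" by (rule mult_right_mono[OF i]) simp
    also have "\<dots> \<le> (real i + \<nu> + 1) * (real i + 1)" using assms by (intro mult_right_mono) auto
    finally have "2 * (u * (b + real i)) \<le> (real i + \<nu> + 1) * (real i + 1)" .
    moreover have "(real i + 1) * (real i + \<nu> + 1) > 0" using assms by (intro mult_pos_pos) auto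
    ultimately show ?thesis by (simp add: pos_divide_le_eq mult.commute)
  qed
  then have "u * (b + real i) / ((real i + 1) * (real i + \<nu> + 1)) * A \<le> 1/2 * A"
    using A by (rule mult_right_mono)
  moreover have "u ^ Suc i * pochhammer b (Suc i) / (fact (Suc i) * Gamma (real (Suc i) + \<nu> + 1)) =
     u * (b + real i) / ((real i + 1) * (real i + \<nu> + 1)) * A"
    unfolding GS A_def by (simp add: pochhammer_Suc mult_ac add_ac)
  moreover have "u * (b + real i) / ((real i + 1) * (real i + \<nu> + 1)) * A \<ge> 0" using A assms by auto
  ultimately show "norm (u ^ Suc i * pochhammer b (Suc i) / (fact (Suc i) * Gamma (real (Suc i) + \<nu> + 1))) \<le>
     1/2 * norm (u ^ i * pochhammer b i / (fact i * Gamma (real i + \<nu> + 1)))"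
    using A unfolding A_def[symmetric] by (simp only: real_norm_def abs_of_nonneg)
qed

section \<open>Integrating the Bessel series term by term\<close>

lemma norm_gauss: "norm (gauss m x) = exp (- (vnorm m x)\<^sup>2 / 2)"
  by (simp add: gauss_def)

text \<open>The modulus of \<open>Q\<close> is not a polynomial, but |Q| \<le> 1 + |Q|^2, and |Q|^2
  is a homogeneous polynomial of degree \<open>2 * d\<close>. The bound is thus a sum of two exactly
  known moments.\<close>

lemma integral_norm_normsq_power:
  assumes "hpoly m d Q" "m > 0"
  obtains A B where "A \<ge> 0" "B \<ge> 0"
    "\<And>k. integral\<^sup>L (lebm m) (\<lambda>x. norm (complex_of_real ((vnorm m x)\<^sup>2) ^ k * Q x * gauss m x)) \<le>
      2 ^ k * (pochhammer (real m / 2) k * A + pochhammer (real d + real m / 2) k * B)"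
proof
  define QQ where "QQ = (\<lambda>x. Q x * cnj (Q x))"
  define A where "A = \<bar>Re (gint m (\<lambda>_. 1))\<bar>"
  define B where "B = \<bar>Re (gint m QQ)\<bar>"
  show "A \<ge> 0" "B \<ge> 0" by (simp_all add: A_def B_def)
  have hQQ: "hpoly m (d + d) QQ" unfolding QQ_def by (intro hpoly_mult hpoly_cnj assms)
  fix k
  let ?r = "\<lambda>x. complex_of_real ((vnorm m x)\<^sup>2) ^ k"
  have h1: "hpoly m (k * 2 + d) (\<lambda>x. ?r x * Q x)" and h2: "hpoly m (k * 2 + 0) (\<lambda>x. ?r x * 1)" and h3: "hpoly m (k * 2 + (d + d)) (\<lambda>x. ?r x * QQ x)"
    by (intro hpoly_mult hpoly_power hpoly_normsq assms hpoly_const hQQ)+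
  have i23: "integrable (lebm m) (\<lambda>x. ?r x * 1 * gauss m x + ?r x * QQ x * gauss m x)"
    by (intro Bochner_Integration.integrable_add integrable_hpoly_gauss[OF h2] integrable_hpoly_gauss[OF h3])
  have re: "Re (?r x * 1 * gauss m x + ?r x * QQ x * gauss m x) = ((vnorm m x)\<^sup>2) ^ k * exp (- (vnorm m x)\<^sup>2 / 2) * (1 + (norm (Q x))\<^sup>2)" for x
  proof -
    have "QQ x = complex_of_real ((norm (Q x))\<^sup>2)" unfolding QQ_def by (simp only: complex_norm_square)
    then have "?r x * 1 * gauss m x + ?r x * QQ x * gauss m x = complex_of_real (((vnorm m x)\<^sup>2) ^ k * exp (- (vnorm m x)\<^sup>2 / 2) * (1 + (norm (Q x))\<^sup>2))"
      by (simp add: gauss_def algebra_simps)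
    then show ?thesis by (simp only: Re_complex_of_real)
  qed
  have "integral\<^sup>L (lebm m) (\<lambda>x. norm (?r x * Q x * gauss m x)) \<le> integral\<^sup>L (lebm m) (\<lambda>x. Re (?r x * 1 * gauss m x + ?r x * QQ x * gauss m x))"
  proof (rule integral_mono)
    show "integrable (lebm m) (\<lambda>x. norm (?r x * Q x * gauss m x))"
      by (intro integrable_norm integrable_hpoly_gauss[OF h1])
    show "integrable (lebm m) (\<lambda>x. Re (?r x * 1 * gauss m x + ?r x * QQ x * gauss m x))"
      using integrable_Re[OF i23] .
    fix x
    have "norm (Q x) \<le> 1 + (norm (Q x))\<^sup>2"
      using zero_le_power2[of "norm (Q x) - 1/2"] by (simp add: power2_eq_square algebra_simps)
    then have "((vnorm m x)\<^sup>2) ^ k * exp (- (vnorm m x)\<^sup>2 / 2) * norm (Q x) \<le> ((vnorm m x)\<^sup>2) ^ k * exp (- (vnorm m x)\<^sup>2 / 2) * (1 + (norm (Q x))\<^sup>2)"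
      by (intro mult_left_mono) auto
    then show "norm (?r x * Q x * gauss m x) \<le> Re (?r x * 1 * gauss m x + ?r x * QQ x * gauss m x)"
      unfolding re by (simp add: norm_mult norm_power norm_gauss mult_ac)
  qed
  also have "\<dots> = Re (gint m (\<lambda>x. ?r x * 1) + gint m (\<lambda>x. ?r x * QQ x))"
    unfolding integral_Re[OF i23] gint_def
    by (subst Bochner_Integration.integral_add) (use integrable_hpoly_gauss[OF h2] integrable_hpoly_gauss[OF h3] in auto)
  also have "\<dots> = 2 ^ k * pochhammer (real m / 2) k * Re (gint m (\<lambda>_. 1)) + 2 ^ k * pochhammer (real d + real m / 2) k * Re (gint m QQ)"
    unfolding gint_normsq_power[OF hpoly_const] gint_normsq_power[OF hQQ] by (simp add: add_divide_distrib)
  also have "\<dots> \<le> 2 ^ k * pochhammer (real m / 2) k * A + 2 ^ k * pochhammer (real d + real m / 2) k * B"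
    unfolding A_def B_def by (intro add_mono mult_left_mono mult_nonneg_nonneg pochhammer_nonneg abs_ge_self) (use assms in auto)
  finally show "integral\<^sup>L (lebm m) (\<lambda>x. norm (?r x * Q x * gauss m x)) \<le> 2 ^ k * (pochhammer (real m / 2) k * A + pochhammer (real d + real m / 2) k * B)"
    by (simp add: algebra_simps)
qed

definition bcoef :: "real \<Rightarrow> nat \<Rightarrow> real \<Rightarrow> real" where
  "bcoef \<nu> i t = 2 powr (- \<nu>) * ((- t / 4) ^ i / (fact i * Gamma (real i + \<nu> + 1)))"

lemma bcoef_mult: "bcoef \<nu> i (r * s) = bcoef \<nu> i s * r ^ i"
proof -
  have e: "- (r * s) / 4 = (- s / 4) * r" by simp
  show ?thesis unfolding bcoef_def e power_mult_distrib by simp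
qed

lemma norm_bcoef: "\<nu> \<ge> 0 \<Longrightarrow> norm (bcoef \<nu> i t) = bcoef \<nu> i (- \<bar>t\<bar>)"
proof -
  assume "\<nu> \<ge> 0"
  then have "Gamma (real i + \<nu> + 1) > 0" by (intro Gamma_real_pos) auto
  then show ?thesis by (simp add: bcoef_def abs_mult power_abs)
qed

text \<open>Sum and integral are exchanged by absolute convergence: the \<open>i\<close>-th moment
  grows like \<open>2 ^ i\<close> times one Pochhammer symbol, while the Bessel coefficient contains
  \<open>4 ^ i\<close>, a factorial and a Gamma value in the denominator.\<close>

lemma bess_moment_integral:
  fixes l :: nat
  assumes "hpoly m d Q" "\<nu> \<ge> 0" "s \<ge> 0" "m > 0"
  defines "f \<equiv> \<lambda>x. complex_of_real ((vnorm m x)\<^sup>2) ^ l * complex_of_real (bess \<nu> ((vnorm m x)\<^sup>2 * s)) * Q x * gauss m x"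
  shows "integrable (lebm m) f"
    and "(\<lambda>i. complex_of_real (bcoef \<nu> i s * 2 ^ (i + l) * pochhammer (real (d + m) / 2) (i + l)) * gint m Q) sums integral\<^sup>L (lebm m) f"
proof -
  define F where "F = (\<lambda>i x. complex_of_real (bcoef \<nu> i s) * (complex_of_real ((vnorm m x)\<^sup>2) ^ (i + l) * Q x * gauss m x))"
  have h: "hpoly m (k * 2 + d) (\<lambda>x. complex_of_real ((vnorm m x)\<^sup>2) ^ k * Q x)" for k
    by (intro hpoly_mult hpoly_power hpoly_normsq assms)
  have int: "integrable (lebm m) (F i)" for i
    unfolding F_def by (intro integrable_mult_right integrable_hpoly_gauss[OF h])
  have sm: "summable (\<lambda>i. norm (F i x))" and Ff: "(\<Sum>i. F i x) = f x" for x
  proof -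
    let ?c = "complex_of_real ((vnorm m x)\<^sup>2) ^ l * Q x * gauss m x"
    have 1: "F i x = complex_of_real (bcoef \<nu> i ((vnorm m x)\<^sup>2 * s)) * ?c" for i
      unfolding F_def bcoef_mult by (simp add: power_add)
    have "summable (\<lambda>i. norm (bcoef \<nu> i ((vnorm m x)\<^sup>2 * s)))"
      unfolding norm_bcoef[OF assms(2)] unfolding bcoef_def by (rule bess_summable[OF assms(2)])
    then show "summable (\<lambda>i. norm (F i x))" unfolding 1 norm_mult norm_of_real real_norm_def by (intro summable_mult2)
    have "(\<lambda>i. bcoef \<nu> i ((vnorm m x)\<^sup>2 * s)) sums bess \<nu> ((vnorm m x)\<^sup>2 * s)"
      unfolding bess_def bcoef_def by (rule summable_sums[OF bess_summable[OF assms(2)]])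
    then have "(\<lambda>i. complex_of_real (bcoef \<nu> i ((vnorm m x)\<^sup>2 * s)) * ?c) sums (complex_of_real (bess \<nu> ((vnorm m x)\<^sup>2 * s)) * ?c)"
      by (intro sums_mult2 sums_of_real)
    then show "(\<Sum>i. F i x) = f x" unfolding 1 f_def by (simp add: sums_iff mult_ac)
  qed
  obtain A B where AB: "A \<ge> 0" "B \<ge> 0"
    "\<And>k. integral\<^sup>L (lebm m) (\<lambda>x. norm (complex_of_real ((vnorm m x)\<^sup>2) ^ k * Q x * gauss m x)) \<le>
      2 ^ k * (pochhammer (real m / 2) k * A + pochhammer (real d + real m / 2) k * B)"
    by (rule integral_norm_normsq_power[OF assms(1,4)]) blast
  have sI: "summable (\<lambda>i. integral\<^sup>L (lebm m) (\<lambda>x. norm (F i x)))"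
  proof (rule summable_comparison_test'[where N = 0])
    let ?g = "\<lambda>b i. (s / 2) ^ i * pochhammer (b + real l) i / (fact i * Gamma (real i + \<nu> + 1))"
    show "summable (\<lambda>i. 2 powr (- \<nu>) * (2 ^ l * ((pochhammer (real m / 2) l * A) * ?g (real m / 2) i + (pochhammer (real d + real m / 2) l * B) * ?g (real d + real m / 2) i)))"
      using assms by (intro summable_mult summable_add summable_pochhammer_Gamma) auto
    fix i
    have G: "Gamma (real i + \<nu> + 1) > 0" using assms by (intro Gamma_real_pos) auto
    have "norm (integral\<^sup>L (lebm m) (\<lambda>x. norm (F i x))) = norm (bcoef \<nu> i s) * integral\<^sup>L (lebm m) (\<lambda>x. norm (complex_of_real ((vnorm m x)\<^sup>2) ^ (i + l) * Q x * gauss m x))"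
      unfolding F_def norm_mult[of "complex_of_real (bcoef \<nu> i s)"] by (simp add: integral_nonneg_AE)
    also have "\<dots> \<le> norm (bcoef \<nu> i s) * (2 ^ (i + l) * (pochhammer (real m / 2) (i + l) * A + pochhammer (real d + real m / 2) (i + l) * B))"
      by (intro mult_left_mono AB) auto
    also have "norm (bcoef \<nu> i s) = 2 powr (- \<nu>) * ((s / 4) ^ i / (fact i * Gamma (real i + \<nu> + 1)))"
      unfolding norm_bcoef[OF assms(2)] unfolding bcoef_def using assms by simp
    also have "2 powr (- \<nu>) * ((s / 4) ^ i / (fact i * Gamma (real i + \<nu> + 1))) * (2 ^ (i + l) * (pochhammer (real m / 2) (i + l) * A + pochhammer (real d + real m / 2) (i + l) * B)) =
      2 powr (- \<nu>) * (2 ^ l * ((pochhammer (real m / 2) l * A) * ?g (real m / 2) i + (pochhammer (real d + real m / 2) l * B) * ?g (real d + real m / 2) i))"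
    proof -
      have p: "pochhammer b (i + l) = pochhammer b l * pochhammer (b + real l) i" for b :: real
        using pochhammer_product'[of b l i] by (simp add: add.commute)
      have "(s / 4) ^ i * 2 ^ i = (s / 2) ^ i" by (simp add: power_mult_distrib[symmetric])
      then have w: "(s / 4) ^ i * 2 ^ (i + l) = 2 ^ l * (s / 2) ^ i" by (simp add: power_add mult_ac)
      have alg: "c * (S / G) * (T * (a * p * A + b * q * B)) = c * (L * ((a * A) * (W * p / G) + (b * B) * (W * q / G)))"
        if "S * T = L * W" for c S G T a p b q L W :: real
      proof -
        have "c * (S / G) * (T * (a * p * A + b * q * B)) = c * ((S * T) * (a * p * A + b * q * B) / G)" by simp
        then show ?thesis unfolding that by (simp add: algebra_simps add_divide_distrib)
      qed
      show ?thesis unfolding p by (rule alg[OF w])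
    qed
    finally show "norm (integral\<^sup>L (lebm m) (\<lambda>x. norm (F i x))) \<le> 2 powr (- \<nu>) * (2 ^ l * ((pochhammer (real m / 2) l * A) * ?g (real m / 2) i + (pochhammer (real d + real m / 2) l * B) * ?g (real d + real m / 2) i))" .
  qed
  have "integrable (lebm m) (\<lambda>x. \<Sum>i. F i x)"
    by (rule integrable_suminf[OF int]) (use sm sI in auto)
  then show "integrable (lebm m) f" unfolding Ff .
  have "(\<lambda>i. integral\<^sup>L (lebm m) (F i)) sums integral\<^sup>L (lebm m) (\<lambda>x. \<Sum>i. F i x)"
    by (rule sums_integral[OF int]) (use sm sI in auto)
  moreover have "integral\<^sup>L (lebm m) (F i) = complex_of_real (bcoef \<nu> i s * 2 ^ (i + l) * pochhammer (real (d + m) / 2) (i + l)) * gint m Q" for i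
  proof -
    have "integral\<^sup>L (lebm m) (F i) = complex_of_real (bcoef \<nu> i s) * gint m (\<lambda>x. complex_of_real ((vnorm m x)\<^sup>2) ^ (i + l) * Q x)"
      unfolding F_def gint_def by simp
    then show ?thesis unfolding gint_normsq_power[OF assms(1)] by simp
  qed
  ultimately show "(\<lambda>i. complex_of_real (bcoef \<nu> i s * 2 ^ (i + l) * pochhammer (real (d + m) / 2) (i + l)) * gint m Q) sums integral\<^sup>L (lebm m) f"
    unfolding Ff by simp
qed

lemma laguerre_gauss_expand:
  "complex_of_real (laguerre j a t) * G = (\<Sum>l\<le>j. complex_of_real ((-1) ^ l * ((real j + a) gchoose (j - l)) / fact l) * (complex_of_real t ^ l * G))"
  unfolding laguerre_def of_real_sum sum_distrib_right by (intro sum.cong refl) simp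

lemma integrable_laguerre_bess:
  assumes "hpoly m d Q" "\<nu> \<ge> 0" "s \<ge> 0" "m > 0"
  shows "integrable (lebm m) (\<lambda>x. complex_of_real (laguerre j a ((vnorm m x)\<^sup>2)) * (complex_of_real (bess \<nu> ((vnorm m x)\<^sup>2 * s)) * Q x * gauss m x))"
  unfolding laguerre_gauss_expand
  using bess_moment_integral(1)[OF assms] by (intro Bochner_Integration.integrable_sum integrable_mult_right) (simp add: mult.assoc)

lemma integrable_laguerre_hpoly:
  assumes "hpoly m d Q"
  shows "integrable (lebm m) (\<lambda>x. complex_of_real (laguerre j a ((vnorm m x)\<^sup>2)) * (Q x * gauss m x))"
  unfolding laguerre_gauss_expand
  using integrable_hpoly_gauss[OF hpoly_mult[OF hpoly_power[OF hpoly_normsq] assms]]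
  by (intro Bochner_Integration.integrable_sum integrable_mult_right) (simp add: mult.assoc)

text \<open>The Hankel transform of a Laguerre function, with the radial integral replaced by a Gaussian one.\<close>
lemma integral_laguerre_bess:
  assumes "hpoly m d Q" "\<nu> = real (d + m) / 2 - 1" "s \<ge> 0" "m \<ge> 2"
  shows "integral\<^sup>L (lebm m) (\<lambda>x. complex_of_real (laguerre j \<nu> ((vnorm m x)\<^sup>2)) * (complex_of_real (bess \<nu> ((vnorm m x)\<^sup>2 * s)) * Q x * gauss m x)) =
    complex_of_real (2 powr (- \<nu>) / Gamma (\<nu> + 1) * ((-1) ^ j * laguerre j \<nu> s * exp (- s / 2))) * gint m Q"
proof -
  have nu: "\<nu> \<ge> 0" using assms by simp
  have m: "m > 0" using assms by simp
  let ?K = "2 powr (- \<nu>) / Gamma (\<nu> + 1)"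
  have I: "integral\<^sup>L (lebm m) (\<lambda>x. complex_of_real ((vnorm m x)\<^sup>2) ^ l * (complex_of_real (bess \<nu> ((vnorm m x)\<^sup>2 * s)) * Q x * gauss m x)) =
     complex_of_real (?K * 2 ^ l * (fact l * exp (- s / 2) * laguerre l \<nu> (s / 2))) * gint m Q" for l
  proof -
    \<comment> \<open>Since \<open>\<nu> + 1 = (d + m) / 2\<close>, the Pochhammer symbol of the
      moment cancels the Gamma value of the Bessel coefficient, and an exponential series with a
      polynomial factor remains.\<close>
    have c: "bcoef \<nu> i s * 2 ^ (i + l) * pochhammer (real (d + m) / 2) (i + l) = ?K * 2 ^ l * ((- s / 2) ^ i / fact i * pochhammer (real i + \<nu> + 1) l)" for i
    proof -
      have nz: "pochhammer (\<nu> + 1) i > 0" using nu by (intro pochhammer_pos) auto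
      have G: "Gamma (real i + \<nu> + 1) = pochhammer (\<nu> + 1) i * Gamma (\<nu> + 1)"
        using Gamma_pochhammer[of "\<nu> + 1" i] nu by (simp add: add_ac)
      have dm: "real (d + m) / 2 = \<nu> + 1" using assms(2) by simp
      have p: "pochhammer (real (d + m) / 2) (i + l) = pochhammer (\<nu> + 1) i * pochhammer (real i + \<nu> + 1) l"
        unfolding dm using pochhammer_product'[of "\<nu> + 1" i l] by (simp add: add_ac)
      have w: "(- s / 4) ^ i * 2 ^ (i + l) = 2 ^ l * (- s / 2) ^ i"
      proof -
        have "(- s / 4) ^ i * 2 ^ i = (- s / 2) ^ i" by (simp add: power_mult_distrib[symmetric])
        then show ?thesis by (simp add: power_add mult_ac)
      qed
      have "bcoef \<nu> i s * 2 ^ (i + l) * pochhammer (real (d + m) / 2) (i + l) =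
        2 powr (- \<nu>) * (((- s / 4) ^ i * 2 ^ (i + l)) / (fact i * (pochhammer (\<nu> + 1) i * Gamma (\<nu> + 1)))) * (pochhammer (\<nu> + 1) i * pochhammer (real i + \<nu> + 1) l)"
        unfolding bcoef_def G p by simp
      also have "\<dots> = ?K * 2 ^ l * ((- s / 2) ^ i / fact i * pochhammer (real i + \<nu> + 1) l)"
        unfolding w using nz by (simp add: mult_ac)
      finally show ?thesis .
    qed
    have "(\<lambda>i. ?K * 2 ^ l * ((- s / 2) ^ i / fact i * pochhammer (real i + \<nu> + 1) l)) sums (?K * 2 ^ l * (fact l * exp (- s / 2) * laguerre l \<nu> (s / 2)))"
      using exp_pochhammer_sums[of "- s / 2" \<nu> l] by (intro sums_mult) simp
    then have "(\<lambda>i. complex_of_real (bcoef \<nu> i s * 2 ^ (i + l) * pochhammer (real (d + m) / 2) (i + l)) * gint m Q) sums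
       (complex_of_real (?K * 2 ^ l * (fact l * exp (- s / 2) * laguerre l \<nu> (s / 2))) * gint m Q)"
      unfolding c by (intro sums_mult2 sums_of_real)
    from sums_unique2[OF bess_moment_integral(2)[OF assms(1) nu assms(3) m] this] show ?thesis by (simp add: mult.assoc)
  qed
  have "integral\<^sup>L (lebm m) (\<lambda>x. complex_of_real (laguerre j \<nu> ((vnorm m x)\<^sup>2)) * (complex_of_real (bess \<nu> ((vnorm m x)\<^sup>2 * s)) * Q x * gauss m x)) =
    (\<Sum>l\<le>j. complex_of_real ((-1) ^ l * ((real j + \<nu>) gchoose (j - l)) / fact l) *
      (complex_of_real (?K * 2 ^ l * (fact l * exp (- s / 2) * laguerre l \<nu> (s / 2))) * gint m Q))"
  proof -
    have i: "integrable (lebm m) (\<lambda>x. complex_of_real ((vnorm m x)\<^sup>2) ^ l * (complex_of_real (bess \<nu> ((vnorm m x)\<^sup>2 * s)) * Q x * gauss m x))" for l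
      using bess_moment_integral(1)[OF assms(1) nu assms(3) m] by (simp add: mult.assoc)
    show ?thesis
      unfolding laguerre_gauss_expand Bochner_Integration.integral_sum[OF integrable_mult_right[OF i]] integral_mult_right_zero I ..
  qed
  also have "\<dots> = (\<Sum>l\<le>j. complex_of_real ((?K * exp (- s / 2)) * ((-1) ^ l * ((real j + \<nu>) gchoose (j - l)) * 2 ^ l * laguerre l \<nu> (s / 2)))) * gint m Q"
    unfolding sum_distrib_right by (intro sum.cong refl) simp
  also have "\<dots> = complex_of_real (?K * ((-1) ^ j * laguerre j \<nu> s * exp (- s / 2))) * gint m Q"
    unfolding of_real_sum[symmetric] sum_distrib_left[symmetric] laguerre_double_argument by (simp add: mult_ac)
  finally show ?thesis .
qed

section \<open>Eigenvalues of the transform\<close>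

lemma cl_mult_one:
  assumes "cl_valued m v"
  shows "cl_mult m cl_one v C = v C"
proof (cases "C \<subseteq> {..<m}")
  case True
  have "(\<Sum>A\<in>Pow {..<m}. cl_sign A ((A - C) \<union> (C - A)) * cl_one A * v ((A - C) \<union> (C - A))) =
    (\<Sum>A\<in>Pow {..<m}. if A = {} then v C else 0)"
    by (intro sum.cong refl) (auto simp: cl_one_def cl_sign_def)
  then show ?thesis using True by (simp add: cl_mult_def)
next
  case False
  then show ?thesis using assms by (simp add: cl_mult_def cl_valued_def)
qed

lemma cl_mult_add_scal_left:
  "cl_mult m (cl_add (cl_scal s u) (cl_scal t w)) v C = s * cl_mult m u v C + t * cl_mult m w v C"
proof -
  have "(\<Sum>A\<in>I. g A * (s * u A + t * w A) * v' A) = s * (\<Sum>A\<in>I. g A * u A * v' A) + t * (\<Sum>A\<in>I. g A * w A * v' A)"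
    for I and g v' :: "nat set \<Rightarrow> complex"
    unfolding sum_distrib_left sum.distrib[symmetric] by (intro sum.cong refl) (simp add: algebra_simps)
  then show ?thesis by (simp add: cl_mult_def cl_add_def cl_scal_def)
qed

lemma cl_mult_scal_right: "cl_mult m u (cl_scal c v) C = c * cl_mult m u v C"
  by (simp add: cl_mult_def cl_scal_def sum_distrib_left mult_ac)

lemma kern_mult:
  assumes "cl_valued m v"
  shows "cl_mult m (kern m a b x y) v C =
    (\<Sum>k. serA m a k x y) * v C + (\<Sum>k. serB m b k x y) * cl_mult m (cl_wedge m x y) v C"
  unfolding kern_def cl_mult_add_scal_left cl_mult_one[OF assms] ..

section \<open>Cut-off integrals of the kernel series\<close>

definition cut :: "real \<Rightarrow> real \<Rightarrow> real" where
  "cut R r = (if r \<le> R then 1 else 0)"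

lemma measurable_cut [measurable]: "cut R \<in> borel_measurable borel"
  unfolding cut_def[abs_def] by measurable

lemma integrable_cut:
  fixes f :: "(nat \<Rightarrow> real) \<Rightarrow> complex"
  assumes "integrable (lebm m) f"
  shows "integrable (lebm m) (\<lambda>x. complex_of_real (cut R (vnorm m x)) * f x)"
proof (rule Bochner_Integration.integrable_bound[OF assms])
  have [measurable]: "f \<in> borel_measurable (lebm m)" using assms by auto
  show "(\<lambda>x. complex_of_real (cut R (vnorm m x)) * f x) \<in> borel_measurable (lebm m)" by measurable
qed (auto simp: cut_def)

lemma integral_cut_LIMSEQ:
  fixes f :: "(nat \<Rightarrow> real) \<Rightarrow> complex"
  assumes "integrable (lebm m) f"
  shows "(\<lambda>n. integral\<^sup>L (lebm m) (\<lambda>x. complex_of_real (cut (real n) (vnorm m x)) * f x)) \<longlonglongrightarrow> integral\<^sup>L (lebm m) f"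
proof (rule integral_dominated_convergence[where w = "\<lambda>x. norm (f x)"])
  have [measurable]: "f \<in> borel_measurable (lebm m)" using assms by auto
  show "f \<in> borel_measurable (lebm m)" by measurable
  show "(\<lambda>x. complex_of_real (cut (real n) (vnorm m x)) * f x) \<in> borel_measurable (lebm m)" for n by measurable
  show "integrable (lebm m) (\<lambda>x. norm (f x))" using assms by simp
  show "AE x in lebm m. norm (complex_of_real (cut (real n) (vnorm m x)) * f x) \<le> norm (f x)" for n
    by (auto simp: cut_def)
  have "(\<lambda>n. complex_of_real (cut (real n) (vnorm m x)) * f x) \<longlonglongrightarrow> f x" for x
  proof (rule tendsto_eventually)
    obtain N where "vnorm m x \<le> real N" using real_arch_simple by blast
    then have "complex_of_real (cut (real n) (vnorm m x)) * f x = f x" if "n \<ge> N" for n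
      using that by (simp add: cut_def)
    then show "\<forall>\<^sub>F n in sequentially. complex_of_real (cut (real n) (vnorm m x)) * f x = f x"
      by (auto simp: eventually_sequentially)
  qed
  then show "AE x in lebm m. (\<lambda>n. complex_of_real (cut (real n) (vnorm m x)) * f x) \<longlonglongrightarrow> f x" by simp
qed

text \<open>The series is only known to converge uniformly on compact sets, hence the cut-off.\<close>
lemma integral_cut_series:
  fixes T :: "nat \<Rightarrow> (nat \<Rightarrow> real) \<Rightarrow> complex"
  assumes G: "integrable (lebm m) G"
    and TG: "\<And>k. integrable (lebm m) (\<lambda>x. T k x * G x)"
    and summ: "\<And>x. summable (\<lambda>k. T k x)"
    and unif: "uniformly_convergent_on {x. vnorm m x \<le> R} (\<lambda>n x. \<Sum>k<n. T k x)"
    and zero: "\<And>k. k \<ge> n0 \<Longrightarrow> integral\<^sup>L (lebm m) (\<lambda>x. complex_of_real (cut R (vnorm m x)) * (T k x * G x)) = 0"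
  shows "integrable (lebm m) (\<lambda>x. complex_of_real (cut R (vnorm m x)) * ((\<Sum>k. T k x) * G x))"
    and "integral\<^sup>L (lebm m) (\<lambda>x. complex_of_real (cut R (vnorm m x)) * ((\<Sum>k. T k x) * G x)) =
      (\<Sum>k<n0. integral\<^sup>L (lebm m) (\<lambda>x. complex_of_real (cut R (vnorm m x)) * (T k x * G x)))"
proof -
  let ?c = "\<lambda>x. complex_of_real (cut R (vnorm m x))"
  let ?S = "\<lambda>n x. \<Sum>k<n. T k x" and ?f = "\<lambda>x. \<Sum>k. T k x"
  from unif obtain l where l: "uniform_limit {x. vnorm m x \<le> R} ?S l sequentially"
    unfolding uniformly_convergent_on_def by blast
  have lf: "l x = ?f x" if "vnorm m x \<le> R" for x
  proof (rule LIMSEQ_unique)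
    show "(\<lambda>n. ?S n x) \<longlonglongrightarrow> l x" using tendsto_uniform_limitI[OF l] that by simp
    show "(\<lambda>n. ?S n x) \<longlonglongrightarrow> ?f x" by (rule summable_LIMSEQ[OF summ])
  qed
  \<comment> \<open>From index \<open>N\<close> on all partial sums are within 1 of the limit on the
    ball, hence within 2 of the \<open>N\<close>-th one. This gives the dominating function
    \<open>w\<close> for the sequence \<open>s\<close>, which starts at \<open>N\<close>.\<close>
  from uniform_limitD[OF l, of 1] obtain N where N: "\<And>n x. n \<ge> N \<Longrightarrow> vnorm m x \<le> R \<Longrightarrow> dist (?S n x) (l x) < 1"
    unfolding eventually_sequentially by auto
  define s where "s = (\<lambda>i x. ?c x * (?S (i + N) x * G x))"
  define w where "w = (\<lambda>x. norm (?S N x * G x) + 2 * norm (G x))"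
  have iS: "integrable (lebm m) (\<lambda>x. ?S n x * G x)" for n
    unfolding sum_distrib_right using TG by (intro Bochner_Integration.integrable_sum)
  have int_s: "integrable (lebm m) (s i)" for i
    unfolding s_def by (rule integrable_cut[OF iS])
  have w: "integrable (lebm m) w"
    unfolding w_def using iS[of N] G by (intro Bochner_Integration.integrable_add integrable_mult_right integrable_norm)
  have lim: "(\<lambda>i. s i x) \<longlonglongrightarrow> ?c x * (?f x * G x)" for x
    unfolding s_def by (intro tendsto_intros LIMSEQ_ignore_initial_segment[OF summable_LIMSEQ[OF summ]])
  have bound: "norm (s i x) \<le> w x" for i x
  proof (cases "vnorm m x \<le> R")
    case True
    have "dist (?S (i + N) x) (?S N x) \<le> dist (?S (i + N) x) (l x) + dist (?S N x) (l x)"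
      by (rule dist_triangle2)
    also have "\<dots> \<le> 2" using N[of "i + N" x] N[of N x] True by simp
    finally have "norm (?S (i + N) x) \<le> norm (?S N x) + 2"
      using norm_triangle_ineq2[of "?S (i + N) x" "?S N x"] by (simp add: dist_norm)
    then have "norm (?S (i + N) x) * norm (G x) \<le> (norm (?S N x) + 2) * norm (G x)"
      by (rule mult_right_mono) simp
    then show ?thesis using True by (simp add: s_def w_def cut_def norm_mult algebra_simps)
  next
    case False
    then show ?thesis by (simp add: s_def w_def cut_def)
  qed
  have mf: "(\<lambda>x. ?c x * (?f x * G x)) \<in> borel_measurable (lebm m)"
    by (rule borel_measurable_LIMSEQ_metric[OF _ lim]) (use int_s in auto)
  have ms: "s i \<in> borel_measurable (lebm m)" for i using int_s by auto
  show "integrable (lebm m) (\<lambda>x. ?c x * (?f x * G x))"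
    by (rule integrable_dominated_convergence[where s = s, OF mf ms w]) (auto simp: lim bound)
  have conv: "(\<lambda>i. integral\<^sup>L (lebm m) (s i)) \<longlonglongrightarrow> integral\<^sup>L (lebm m) (\<lambda>x. ?c x * (?f x * G x))"
    by (rule integral_dominated_convergence[where s = s, OF mf ms w]) (auto simp: lim bound)
  \<comment> \<open>By \<open>zero\<close> the integrals of the partial sums are eventually
    constant, so the limit is a finite sum.\<close>
  have "integral\<^sup>L (lebm m) (s i) = (\<Sum>k<n0. integral\<^sup>L (lebm m) (\<lambda>x. ?c x * (T k x * G x)))" if "i \<ge> n0" for i
  proof -
    have "integral\<^sup>L (lebm m) (s i) = (\<Sum>k<i + N. integral\<^sup>L (lebm m) (\<lambda>x. ?c x * (T k x * G x)))"
      unfolding s_def sum_distrib_right sum_distrib_left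
      by (rule Bochner_Integration.integral_sum) (rule integrable_cut[OF TG])
    also have "\<dots> = (\<Sum>k<n0. integral\<^sup>L (lebm m) (\<lambda>x. ?c x * (T k x * G x)))"
      by (rule sum.mono_neutral_right) (use that zero in auto)
    finally show ?thesis .
  qed
  then have "(\<lambda>i. integral\<^sup>L (lebm m) (s i)) \<longlonglongrightarrow> (\<Sum>k<n0. integral\<^sup>L (lebm m) (\<lambda>x. ?c x * (T k x * G x)))"
    by (intro tendsto_eventually) (auto simp: eventually_sequentially)
  from LIMSEQ_unique[OF conv this]
  show "integral\<^sup>L (lebm m) (\<lambda>x. ?c x * (?f x * G x)) = (\<Sum>k<n0. integral\<^sup>L (lebm m) (\<lambda>x. ?c x * (T k x * G x)))" .
qed

text \<open>The convergence is uniform in both variables jointly; for fixed \<open>y\<close> the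
  radius is enlarged to contain |y|.\<close>

lemma series_conv_fix_y:
  assumes "series_conv m F"
  shows "summable (\<lambda>k. F k x y)"
    and "uniformly_convergent_on {x. vnorm m x \<le> R} (\<lambda>n x. \<Sum>k<n. F k x y)"
proof -
  show "summable (\<lambda>k. F k x y)" using assms unfolding series_conv_def by (blast intro: summable_norm_cancel)
  let ?R = "max R (vnorm m y)"
  from assms obtain l where l: "uniform_limit {(x, y). vnorm m x \<le> ?R \<and> vnorm m y \<le> ?R} (\<lambda>n (x, y). \<Sum>k<n. F k x y) l sequentially"
    unfolding series_conv_def uniformly_convergent_on_def by blast
  have "uniform_limit {x. vnorm m x \<le> R} (\<lambda>n x. \<Sum>k<n. F k x y) (\<lambda>x. l (x, y)) sequentially"
    unfolding uniform_limit_iff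
  proof (intro allI impI)
    fix e :: real assume "e > 0"
    from uniform_limitD[OF l this]
    show "\<forall>\<^sub>F n in sequentially. \<forall>x\<in>{x. vnorm m x \<le> R}. dist (\<Sum>k<n. F k x y) (l (x, y)) < e"
      by (rule eventually_mono) auto
  qed
  then show "uniformly_convergent_on {x. vnorm m x \<le> R} (\<lambda>n x. \<Sum>k<n. F k x y)"
    unfolding uniformly_convergent_on_def by blast
qed

lemma measurable_bess [measurable]: "bess \<nu> \<in> borel_measurable borel"
  unfolding bess_def[abs_def] by measurable

lemma measurable_laguerre [measurable]: "laguerre j a \<in> borel_measurable borel"
  unfolding laguerre_def[abs_def] by measurable

text \<open>The product of the normalisation of the transform, the Hankel constant of
  \<open>integral_laguerre_bess\<close>, the reproducing constant of
  \<open>gint_zonal_harmonic\<close> and the total Gaussian mass. The powers of 2 combine to 2,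
  which cancels the 2 of the normalisation.\<close>

lemma transform_constant:
  assumes "m \<ge> 3"
  shows "Gamma (real m / 2) / (2 * pi powr (real m / 2)) *
    (2 powr (- (real d + lam m)) / Gamma (real d + lam m + 1) * (2 ^ d * Gamma (real d + lam m) / Gamma (lam m)) * sqrt (2 * pi) ^ m)
    = lam m / (lam m + real d)"
proof -
  define a where "a = lam m"
  have a: "a > 0" using assms by (simp add: a_def lam_def)
  have m: "real m / 2 = a + 1" by (simp add: a_def lam_def field_simps)
  have "sqrt (2 * pi) ^ m = (2 * pi) powr (real m / 2)"
    by (simp add: powr_half_sqrt[symmetric] powr_realpow[symmetric] powr_powr)
  also have "\<dots> = 2 powr (a + 1) * pi powr (a + 1)" unfolding m by (simp add: powr_mult)
  finally have s: "sqrt (2 * pi) ^ m = 2 powr (a + 1) * pi powr (a + 1)" .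
  have p: "2 powr (- (real d + a)) * 2 ^ d * 2 powr (a + 1) = (2::real)"
    by (simp add: powr_realpow[symmetric] powr_add[symmetric])
  have g1: "Gamma (a + 1) = a * Gamma a" using Gamma_pochhammer[of a 1] a by simp
  have g2: "Gamma (real d + a + 1) = (real d + a) * Gamma (real d + a)" using Gamma_pochhammer[of "real d + a" 1] a by simp
  have nz: "Gamma a \<noteq> 0" "Gamma (real d + a) \<noteq> 0" "pi powr (a + 1) \<noteq> 0" "real d + a \<noteq> 0" "real d + a > 0"
    using a Gamma_real_nonzero[of a] Gamma_real_nonzero[of "real d + a"] by simp_all
  have "Gamma (real m / 2) / (2 * pi powr (real m / 2)) *
    (2 powr (- (real d + a)) / Gamma (real d + a + 1) * (2 ^ d * Gamma (real d + a) / Gamma a) * sqrt (2 * pi) ^ m)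
    = (2 powr (- (real d + a)) * 2 ^ d * 2 powr (a + 1)) * (a * Gamma a / (2 * pi powr (a + 1)) *
      (Gamma (real d + a) / ((real d + a) * Gamma (real d + a)) / Gamma a * pi powr (a + 1)))"
    unfolding m s g1 g2 by simp
  also have "\<dots> = a / (a + real d)"
  proof -
    have "2 * (a * G / (2 * P) * (H / (D * H) / G * P)) = a / D"
      if "G \<noteq> 0" "H \<noteq> 0" "P \<noteq> 0" for G H P D :: real
      using that by simp
    from this[OF nz(1-3)] show ?thesis unfolding p add.commute[of a "real d"] .
  qed
  finally show ?thesis unfolding a_def .
qed

definition laguerre_gauss :: "nat \<Rightarrow> real \<Rightarrow> nat \<Rightarrow> ((nat \<Rightarrow> real) \<Rightarrow> cl) \<Rightarrow> (nat \<Rightarrow> real) \<Rightarrow> cl" where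
  "laguerre_gauss m \<nu> j f x = cl_scal (complex_of_real (laguerre j \<nu> ((vnorm m x)\<^sup>2) * exp (- (vnorm m x)\<^sup>2 / 2))) (f x)"

text \<open>On every ball only the terms with Bessel order \<open>d + \<lambda>\<close> contribute,
  and the cut-off is removed afterwards. The whole-space integral then is the Hankel transform of a
  Laguerre function against a polynomial of degree \<open>2 * d\<close>, whose Gaussian integral is
  a multiple of \<open>f y\<close>.\<close>

lemma transf_laguerre_gauss:
  assumes m: "m \<ge> 3" and f: "gamma_eigen m d \<mu> f" and conv: "kern_conv m a b"
    and ok: "integrand_ok m (kern m a b) (laguerre_gauss m (real d + lam m) j f)"
  shows "transf m (kern m a b) (laguerre_gauss m (real d + lam m) j f) y =
    cl_scal ((-1) ^ j * (complex_of_real (lam m / (lam m + real d)) * a d + complex_of_real (\<mu> / (2 * (lam m + real d))) * b d))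
      (laguerre_gauss m (real d + lam m) j f y)"
proof
  fix C
  define \<nu> where "\<nu> = real d + lam m"
  define s where "s = (vnorm m y)\<^sup>2"
  let ?h = "\<lambda>r. laguerre j \<nu> (r\<^sup>2) * exp (- r\<^sup>2 / 2)"
  let ?L = "\<lambda>x. complex_of_real (laguerre j \<nu> ((vnorm m x)\<^sup>2))"
  let ?F = "laguerre_gauss m \<nu> j f"
  define W where "W = (\<lambda>x. cl_mult m (cl_wedge m x y) (f x) C)"
  have lam: "lam m > 0" using m by (simp add: lam_def)
  have s0: "s \<ge> 0" by (simp add: s_def)
  have cv: "\<And>x. cl_valued m (f x)" and hf: "\<And>C. hpoly m d (\<lambda>x. f x C)" and H: "\<And>C. harmonic m (\<lambda>x. f x C)"
    and mu0: "d = 0 \<Longrightarrow> \<mu> = 0"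
    using f by (auto simp: gamma_eigen_def)
  have hW: "hpoly m (Suc d) W" unfolding W_def by (rule hpoly_wedge_mult[OF cv hf])
  have cvF: "cl_valued m (?F x)" for x using cv by (simp add: laguerre_gauss_def cl_valued_def cl_scal_def)
  define GA where "GA = (\<lambda>x. ?L x * (f x C * gauss m x))"
  define GB where "GB = (\<lambda>x. ?L x * (W x * gauss m x))"
  have FA: "?F x C = GA x" for x by (simp add: laguerre_gauss_def cl_scal_def GA_def gauss_def)
  have FB: "cl_mult m (cl_wedge m x y) (?F x) C = GB x" for x
    by (simp add: laguerre_gauss_def cl_mult_scal_right GB_def gauss_def W_def)
  let ?TA = "\<lambda>k x. serA m a k x y" and ?TB = "\<lambda>k x. serB m b k x y"
  define QA where "QA = (\<lambda>k x. zonal m (lam m) k y x * f x C)"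
  define QB where "QB = (\<lambda>k x. zonal m (lam m + 1) k y x * W x)"
  have hQA: "hpoly m (k + d) (QA k)" for k unfolding QA_def by (intro hpoly_mult hpoly_zonal hf)
  have hQB: "hpoly m (k + Suc d) (QB k)" for k unfolding QB_def by (intro hpoly_mult hpoly_zonal hW)
  let ?E = "\<lambda>\<kappa> Q x. ?L x * (complex_of_real (bess \<kappa> ((vnorm m x)\<^sup>2 * s)) * Q x * gauss m x)"
  have TGA: "?TA k x * GA x = a k * ?E (real k + lam m) (QA k) x" for k x
    unfolding serA_eq[OF m] GA_def QA_def s_def by (simp add: mult_ac)
  have TGB: "?TB k x * GB x = b (Suc k) * ?E (real (Suc k) + lam m) (QB k) x" for k x
    unfolding serB_eq[OF m] GB_def QB_def s_def by (simp add: mult_ac)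
  have iA: "integrable (lebm m) (\<lambda>x. ?TA k x * GA x)" for k
    unfolding TGA using lam m s0 by (intro integrable_mult_right integrable_laguerre_bess[OF hQA]) auto
  have iB: "integrable (lebm m) (\<lambda>x. ?TB k x * GB x)" for k
    unfolding TGB using lam m s0 by (intro integrable_mult_right integrable_laguerre_bess[OF hQB]) auto
  have iGA: "integrable (lebm m) GA" unfolding GA_def by (rule integrable_laguerre_hpoly[OF hf])
  have iGB: "integrable (lebm m) GB" unfolding GB_def by (rule integrable_laguerre_hpoly[OF hW])
  have gQA: "gint m (QA k) = (if k = d then complex_of_real (2 ^ d * Gamma (real d + lam m) / Gamma (lam m)) * f y C * gint m (\<lambda>_. 1) else 0)" for k
    unfolding QA_def by (rule gint_zonal_harmonic[OF m hf H])
  have gQB: "gint m (QB k) = complex_of_real (\<mu> / (2 * lam m)) * gint m (QA (Suc k))" for k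
    unfolding QB_def QA_def W_def by (rule gint_zonal_wedge[OF m f])
  \<comment> \<open>Cut-off, Laguerre, Gaussian and Bessel factors depend on |x| only, so a
    homogeneous factor with vanishing Gaussian integral makes the integral vanish on each
    ball.\<close>
  have radial: "integral\<^sup>L (lebm m) (\<lambda>x. complex_of_real (cut R (vnorm m x)) * (c * ?E \<kappa> Q x)) = 0"
    if "hpoly m e Q" "gint m Q = 0" for R c \<kappa> e Q
  proof -
    have "integral\<^sup>L (lebm m) (\<lambda>x. complex_of_real ((\<lambda>r. cut R r * (?h r * bess \<kappa> (r\<^sup>2 * s))) (vnorm m x)) * Q x) = 0"
      by (rule radial_integral_eq_0[OF that]) measurable
    then have "integral\<^sup>L (lebm m) (\<lambda>x. c * (complex_of_real ((\<lambda>r. cut R r * (?h r * bess \<kappa> (r\<^sup>2 * s))) (vnorm m x)) * Q x)) = 0"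
      by simp
    then show ?thesis by (simp add: gauss_def mult_ac)
  qed
  \<comment> \<open>Index \<open>d - 1\<close> of the wedge series carries \<open>b d\<close> and
    order \<open>d + \<lambda>\<close>, as \<open>serB\<close> is shifted by one; for
    \<open>d = 0\<close> no wedge term contributes. Both products have degree \<open>2 * d\<close>,
    since the wedge itself is linear in \<open>x\<close>.\<close>
  define Q where "Q = (\<lambda>x. a d * QA d x + (if d = 0 then 0 else b d * QB (d - 1) x))"
  have hQ: "hpoly m (d + d) Q"
  proof (cases "d = 0")
    case True
    then show ?thesis unfolding Q_def using hpoly_scale[OF hQA[of d]] by simp
  next
    case False
    then have "d - 1 + Suc d = d + d" by simp
    then show ?thesis unfolding Q_def using False hpoly_add[OF hpoly_scale[OF hQA[of d]] hpoly_scale[OF hQB[of "d - 1", unfolded \<open>d - 1 + Suc d = d + d\<close>]]] by simp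
  qed
  have gQ: "gint m Q = (a d + complex_of_real (\<mu> / (2 * lam m)) * b d) * gint m (QA d)"
  proof (cases "d = 0")
    case True
    then show ?thesis unfolding Q_def using mu0 by (simp add: gint_scale)
  next
    case False
    then show ?thesis unfolding Q_def using gint_add[OF hpoly_scale[OF hQA[of d]] hpoly_scale[OF hQB[of "d - 1"]]] gQB[of "d - 1"]
      by (simp add: gint_scale algebra_simps)
  qed
  have EQ: "?E \<nu> Q x = ?TA d x * GA x + (if d = 0 then 0 else ?TB (d - 1) x * GB x)" for x
  proof -
    have "d \<noteq> 0 \<Longrightarrow> real (Suc (d - 1)) = real d" "d \<noteq> 0 \<Longrightarrow> Suc (d - 1) = d" by auto
    then show ?thesis unfolding TGA TGB Q_def \<nu>_def by (simp add: algebra_simps)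
  qed
  have iE: "integrable (lebm m) (?E \<nu> Q)"
    using lam m s0 by (intro integrable_laguerre_bess[OF hQ]) (auto simp: \<nu>_def)
  have K: "cl_mult m (kern m a b x y) (?F x) C = (\<Sum>k. ?TA k x) * GA x + (\<Sum>k. ?TB k x) * GB x" for x
    unfolding kern_mult[OF cvF] FA FB ..
  have iK: "integrable (lebm m) (\<lambda>x. cl_mult m (kern m a b x y) (?F x) C)"
    using ok unfolding integrand_ok_def \<nu>_def by blast
  have cutK: "integral\<^sup>L (lebm m) (\<lambda>x. complex_of_real (cut R (vnorm m x)) * cl_mult m (kern m a b x y) (?F x) C) =
     integral\<^sup>L (lebm m) (\<lambda>x. complex_of_real (cut R (vnorm m x)) * ?E \<nu> Q x)" for R
  proof -
    let ?c = "\<lambda>x. complex_of_real (cut R (vnorm m x))"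
    let ?IA = "\<lambda>k. integral\<^sup>L (lebm m) (\<lambda>x. ?c x * (?TA k x * GA x))"
    let ?IB = "\<lambda>k. integral\<^sup>L (lebm m) (\<lambda>x. ?c x * (?TB k x * GB x))"
    have zA: "?IA k = 0" if "k \<noteq> d" for k
      unfolding TGA by (rule radial[OF hQA]) (simp add: gQA that)
    have zB: "?IB k = 0" if "Suc k \<noteq> d" for k
      unfolding TGB by (rule radial[OF hQB]) (simp add: gQB gQA that)
    have cA: "series_conv m (serA m a)" and cB: "series_conv m (serB m b)" using conv by (auto simp: kern_conv_def)
    note A = integral_cut_series[OF iGA iA series_conv_fix_y[OF cA], where R = R and ?n0.0 = "Suc d"]
    note B = integral_cut_series[OF iGB iB series_conv_fix_y[OF cB], where R = R and ?n0.0 = d]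
    have A1: "integrable (lebm m) (\<lambda>x. ?c x * ((\<Sum>k. ?TA k x) * GA x))" by (rule A(1)) (rule zA, simp)
    have B1: "integrable (lebm m) (\<lambda>x. ?c x * ((\<Sum>k. ?TB k x) * GB x))" by (rule B(1)) (rule zB, simp)
    have A2: "integral\<^sup>L (lebm m) (\<lambda>x. ?c x * ((\<Sum>k. ?TA k x) * GA x)) = (\<Sum>k<Suc d. ?IA k)" by (rule A(2)) (rule zA, simp)
    have B2: "integral\<^sup>L (lebm m) (\<lambda>x. ?c x * ((\<Sum>k. ?TB k x) * GB x)) = (\<Sum>k<d. ?IB k)" by (rule B(2)) (rule zB, simp)
    have sA: "(\<Sum>k<Suc d. ?IA k) = ?IA d" using zA by simp
    have sB: "(\<Sum>k<d. ?IB k) = (if d = 0 then 0 else ?IB (d - 1))"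
    proof (cases d)
      case (Suc e)
      then have "(\<Sum>k<e. ?IB k) = 0" using zB by (intro sum.neutral) auto
      then show ?thesis using Suc by simp
    qed simp
    have "integral\<^sup>L (lebm m) (\<lambda>x. ?c x * cl_mult m (kern m a b x y) (?F x) C) = ?IA d + (if d = 0 then 0 else ?IB (d - 1))"
      unfolding K distrib_left Bochner_Integration.integral_add[OF A1 B1] A2 B2 sA sB ..
    also have "\<dots> = integral\<^sup>L (lebm m) (\<lambda>x. ?c x * ?E \<nu> Q x)"
    proof (cases "d = 0")
      case True
      then show ?thesis unfolding EQ by simp
    next
      case False
      then show ?thesis unfolding EQ
        using Bochner_Integration.integral_add[OF integrable_cut[OF iA[of d]] integrable_cut[OF iB[of "d - 1"]], of R R]
        by (simp only: if_False distrib_left)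
    qed
    finally show ?thesis .
  qed
  \<comment> \<open>Both integrands are integrable over the whole space, the left one by
    \<open>ok\<close>, so the equal cut-off integrals have equal limits.\<close>
  have "integral\<^sup>L (lebm m) (\<lambda>x. cl_mult m (kern m a b x y) (?F x) C) = integral\<^sup>L (lebm m) (?E \<nu> Q)"
    by (rule LIMSEQ_unique[OF integral_cut_LIMSEQ[OF iK, unfolded cutK] integral_cut_LIMSEQ[OF iE]])
  also have "\<dots> = complex_of_real (2 powr (- \<nu>) / Gamma (\<nu> + 1) * ((-1) ^ j * laguerre j \<nu> s * exp (- s / 2))) * gint m Q"
    by (rule integral_laguerre_bess[OF hQ _ s0]) (use m in \<open>auto simp: \<nu>_def lam_def field_simps\<close>)
  also have "gint m Q = (a d + complex_of_real (\<mu> / (2 * lam m)) * b d) *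
     (complex_of_real (2 ^ d * Gamma (real d + lam m) / Gamma (lam m)) * f y C * complex_of_real (sqrt (2 * pi) ^ m))"
    unfolding gQ gQA gint_one by simp
  finally have I: "integral\<^sup>L (lebm m) (\<lambda>x. cl_mult m (kern m a b x y) (?F x) C) =
    complex_of_real (2 powr (- \<nu>) / Gamma (\<nu> + 1) * ((-1) ^ j * laguerre j \<nu> s * exp (- s / 2))) *
    ((a d + complex_of_real (\<mu> / (2 * lam m)) * b d) *
     (complex_of_real (2 ^ d * Gamma (real d + lam m) / Gamma (lam m)) * f y C * complex_of_real (sqrt (2 * pi) ^ m)))" .
  let ?c0 = "Gamma (real m / 2) / (2 * pi powr (real m / 2))"
  have const: "complex_of_real (?c0 * (2 powr (- \<nu>) / Gamma (\<nu> + 1) * (2 ^ d * Gamma (real d + lam m) / Gamma (lam m)) * sqrt (2 * pi) ^ m)) =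
     complex_of_real (lam m / (lam m + real d))"
    unfolding \<nu>_def transform_constant[OF m] ..
  have "transf m (kern m a b) ?F y C = complex_of_real (?c0 * (2 powr (- \<nu>) / Gamma (\<nu> + 1) * (2 ^ d * Gamma (real d + lam m) / Gamma (lam m)) * sqrt (2 * pi) ^ m)) *
    ((a d + complex_of_real (\<mu> / (2 * lam m)) * b d) * (complex_of_real ((-1) ^ j * laguerre j \<nu> s * exp (- s / 2)) * f y C))"
    unfolding transf_def I of_real_mult by (simp only: mult_ac)
  also have "\<dots> = (complex_of_real (lam m / (lam m + real d)) * a d + (complex_of_real (lam m / (lam m + real d)) * complex_of_real (\<mu> / (2 * lam m))) * b d) *
     ((-1) ^ j * ?F y C)"
  proof -
    have F: "?F y C = complex_of_real (laguerre j \<nu> s) * complex_of_real (exp (- s / 2)) * f y C"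
      by (simp add: laguerre_gauss_def cl_scal_def s_def)
    have sg: "complex_of_real ((-1) ^ j * laguerre j \<nu> s * exp (- s / 2)) = (-1) ^ j * complex_of_real (laguerre j \<nu> s) * complex_of_real (exp (- s / 2))"
      by simp
    have "p * ((u + q * v) * (e * l * t * w)) = (p * u + (p * q) * v) * (e * (l * t * w))" for p q u v e l t w :: complex
      by (simp add: algebra_simps)
    then show ?thesis unfolding const F sg .
  qed
  also have "complex_of_real (lam m / (lam m + real d)) * complex_of_real (\<mu> / (2 * lam m)) = complex_of_real (\<mu> / (2 * (lam m + real d)))"
  proof -
    have "lam m / (lam m + real d) * (\<mu> / (2 * lam m)) = \<mu> / (2 * (lam m + real d))" using lam by (simp add: field_simps)
    then show ?thesis by (simp only: of_real_mult[symmetric])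
  qed
  finally show "transf m (kern m a b) (laguerre_gauss m (real d + lam m) j f) y C =
    cl_scal ((-1) ^ j * (complex_of_real (lam m / (lam m + real d)) * a d + complex_of_real (\<mu> / (2 * (lam m + real d))) * b d))
      (laguerre_gauss m (real d + lam m) j f y) C"
    unfolding \<nu>_def cl_scal_def by (simp only: mult_ac)
qed

section \<open>Inversion on the basis functions\<close>

lemma transf_scal: "transf m K (\<lambda>x. cl_scal c (F x)) y = cl_scal c (transf m K F y)"
  unfolding transf_def cl_mult_scal_right by (simp add: cl_scal_def mult_ac)

lemma psi_even:
  assumes "even J"
  shows "psi m J k M = laguerre_gauss m (real k + lam m) (J div 2) M"
proof -
  have "real m / 2 + real k - 1 = real k + lam m" by (simp add: lam_def field_simps)
  then show ?thesis using assms by (simp only: psi_def[abs_def] laguerre_gauss_def[abs_def] if_True)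
qed

text \<open>The factor x raises the degree to k + 1, so the Laguerre parameter m/2 + k is again the
  degree plus \<lambda>, as in the even case.\<close>

lemma psi_odd:
  assumes "odd J"
  shows "psi m J k M = laguerre_gauss m (real (Suc k) + lam m) (J div 2) (\<lambda>x. vec_mult m x (M x))"
proof -
  have "real m / 2 + real k = real (Suc k) + lam m" by (simp add: lam_def field_simps)
  then show ?thesis using assms by (simp only: psi_def[abs_def] laguerre_gauss_def[abs_def] cl_mult_vec if_False)
qed

text \<open>The inverse coefficients solve the linear system that asks
  \<open>p * a' - q * b'\<close> and \<open>p * a' + r * b'\<close> to be the two factors of
  \<open>N\<close>, interchanged and divided by \<open>N\<close>. Subtraction gives
  \<open>b' = - \<beta> / N\<close>, and \<open>p = r - q\<close> then turns the first equation into
  \<open>a' = (\<alpha> + \<beta>) / N\<close>.\<close>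

lemma eigenvalues_inverse:
  fixes p q r \<alpha> \<beta> N :: complex
  assumes "p = r - q" "N = (p * \<alpha> - q * \<beta>) * (p * \<alpha> + r * \<beta>)" "N \<noteq> 0"
  shows "(p * \<alpha> - q * \<beta>) * (p * ((\<alpha> + \<beta>) / N) - q * (- \<beta> / N)) = 1"
    and "(p * \<alpha> + r * \<beta>) * (p * ((\<alpha> + \<beta>) / N) + r * (- \<beta> / N)) = 1"
proof -
  have "(p * \<alpha> - q * \<beta>) * (p * ((\<alpha> + \<beta>) / N) - q * (- \<beta> / N)) = (p * \<alpha> - q * \<beta>) * (p * \<alpha> + (p + q) * \<beta>) / N"
    using assms(3) by (simp add: field_simps)
  also have "p + q = r" using assms(1) by simp
  finally show "(p * \<alpha> - q * \<beta>) * (p * ((\<alpha> + \<beta>) / N) - q * (- \<beta> / N)) = 1" using assms(2,3) by simp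
  have "(p * \<alpha> + r * \<beta>) * (p * ((\<alpha> + \<beta>) / N) + r * (- \<beta> / N)) = (p * \<alpha> + r * \<beta>) * (p * \<alpha> - (r - p) * \<beta>) / N"
    using assms(3) by (simp add: field_simps)
  also have "r - p = q" using assms(1) by simp
  finally show "(p * \<alpha> + r * \<beta>) * (p * ((\<alpha> + \<beta>) / N) + r * (- \<beta> / N)) = 1" using assms(2,3) by (simp add: mult.commute)
qed

lemma transf_inverse_pair:
  assumes "\<And>y. transf m K F y = cl_scal e (F y)" "\<And>y. transf m K' F y = cl_scal e' (F y)" "e * e' = 1"
  shows "transf m K' (transf m K F) = F"
proof
  fix y
  have "transf m K F = (\<lambda>y. cl_scal e (F y))" using assms(1) by blast
  then have "transf m K' (transf m K F) y = cl_scal e (cl_scal e' (F y))" by (simp add: transf_scal assms(2))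
  then show "transf m K' (transf m K F) y = F y" using assms(3) by (simp add: cl_scal_def mult.assoc[symmetric])
qed

theorem theorem3p3:
  fixes m :: nat and \<alpha> \<beta> :: "nat \<Rightarrow> complex"
  assumes m3: "m \<ge> 3"
    and beta0: "\<beta> 0 = 0"
    and convK: "kern_conv m \<alpha> \<beta>"
    and Nnz: "\<forall>k. Nk m \<alpha> \<beta> k \<noteq> 0"
    and convKinv: "kern_conv m (\<lambda>k. (\<alpha> k + \<beta> k) / Nk m \<alpha> \<beta> k) (\<lambda>k. - \<beta> k / Nk m \<alpha> \<beta> k)"
    and welldef: "\<forall>J k M. spherical_monogenic m k M \<longrightarrow>
        integrand_ok m (Kminus m \<alpha> \<beta>) (psi m J k M) \<and>
        integrand_ok m (Kminus_inv m \<alpha> \<beta>) (psi m J k M) \<and>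
        integrand_ok m (Kminus_inv m \<alpha> \<beta>) (transf m (Kminus m \<alpha> \<beta>) (psi m J k M)) \<and>
        integrand_ok m (Kminus m \<alpha> \<beta>) (transf m (Kminus_inv m \<alpha> \<beta>) (psi m J k M))"
  shows "\<forall>J k M. spherical_monogenic m k M \<longrightarrow>
     transf m (Kminus_inv m \<alpha> \<beta>) (transf m (Kminus m \<alpha> \<beta>) (psi m J k M)) = psi m J k M \<and>
     transf m (Kminus m \<alpha> \<beta>) (transf m (Kminus_inv m \<alpha> \<beta>) (psi m J k M)) = psi m J k M"
proof (intro allI impI)
  fix J k M assume sm: "spherical_monogenic m k M"
  note mono = spherical_monogenic_imp_monogenic[OF sm]
  have lam: "lam m > 0" using m3 by (simp add: lam_def)
  have ok: "integrand_ok m (kern m \<alpha> \<beta>) (psi m J k M)"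
    "integrand_ok m (kern m (\<lambda>k. (\<alpha> k + \<beta> k) / Nk m \<alpha> \<beta> k) (\<lambda>k. - \<beta> k / Nk m \<alpha> \<beta> k)) (psi m J k M)"
    using welldef sm unfolding Kminus_def Kminus_inv_def by blast+
  \<comment> \<open>Even \<open>J\<close> gives \<open>f = M\<close> with \<open>d = k\<close>, odd
    \<open>J\<close> gives x M with \<open>d = k + 1\<close>; from here on both parities are treated
    alike.\<close>
  obtain d \<mu> f where f: "gamma_eigen m d \<mu> f" and psi: "psi m J k M = laguerre_gauss m (real d + lam m) (J div 2) f"
    and mu: "\<mu> = - real d \<or> \<mu> = real d + 2 * lam m"
  proof (cases "even J")
    case True
    show ?thesis by (rule that[OF gamma_eigen_monogenic[OF mono] psi_even[OF True]]) simp
  next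
    case False
    show ?thesis by (rule that[OF gamma_eigen_vec_mult_monogenic[OF mono] psi_odd[OF False]]) (simp add: lam_def field_simps)
  qed
  define E where "E = (\<lambda>a b :: nat \<Rightarrow> complex. (-1) ^ (J div 2) *
    (complex_of_real (lam m / (lam m + real d)) * a d + complex_of_real (\<mu> / (2 * (lam m + real d))) * b d))"
  let ?a' = "\<lambda>k. (\<alpha> k + \<beta> k) / Nk m \<alpha> \<beta> k" and ?b' = "\<lambda>k. - \<beta> k / Nk m \<alpha> \<beta> k"
  have T: "transf m (Kminus m \<alpha> \<beta>) (psi m J k M) y = cl_scal (E \<alpha> \<beta>) (psi m J k M y)" for y
    using ok(1) unfolding psi Kminus_def E_def by (rule transf_laguerre_gauss[OF m3 f convK])
  have T': "transf m (Kminus_inv m \<alpha> \<beta>) (psi m J k M) y = cl_scal (E ?a' ?b') (psi m J k M y)" for y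
    using ok(2) unfolding psi Kminus_inv_def E_def by (rule transf_laguerre_gauss[OF m3 f convKinv])
  have EE: "E \<alpha> \<beta> * E ?a' ?b' = 1"
  proof -
    define p q r where "p = complex_of_real (lam m / (lam m + real d))"
      and "q = complex_of_real (real d / (2 * (lam m + real d)))"
      and "r = complex_of_real ((real d + 2 * lam m) / (2 * (lam m + real d)))"
    have "lam m / (lam m + real d) = (real d + 2 * lam m) / (2 * (lam m + real d)) - real d / (2 * (lam m + real d))"
    proof -
      have "a / b = (c + 2 * a) / (2 * b) - c / (2 * b)" for a b c :: real
        by (simp add: diff_divide_distrib[symmetric])
      then show ?thesis .
    qed
    then have pqr: "p = r - q" unfolding p_def q_def r_def of_real_diff[symmetric] by (rule arg_cong)
    have N: "Nk m \<alpha> \<beta> d = (p * \<alpha> d - q * \<beta> d) * (p * \<alpha> d + r * \<beta> d)"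
      unfolding Nk_def p_def q_def r_def ..
    note inv = eigenvalues_inverse[OF pqr N Nnz[rule_format]]
    \<comment> \<open>Both eigenvalues carry the sign \<open>(-1) ^ (J div 2)\<close>, which squares
      to 1.\<close>
    have sq: "(-1) ^ n * u * ((-1) ^ n * v) = u * v" for n and u v :: complex
      by (simp add: mult.assoc[symmetric] mult.commute[of u])
    from mu show ?thesis
    proof
      assume "\<mu> = - real d"
      then have "complex_of_real (\<mu> / (2 * (lam m + real d))) = - q" by (simp add: q_def)
      then show ?thesis unfolding E_def sq p_def[symmetric] using inv(1) by simp
    next
      assume "\<mu> = real d + 2 * lam m"
      then have "complex_of_real (\<mu> / (2 * (lam m + real d))) = r" by (simp only: r_def)
      then show ?thesis unfolding E_def sq p_def[symmetric] using inv(2) by simp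
    qed
  qed
  show "transf m (Kminus_inv m \<alpha> \<beta>) (transf m (Kminus m \<alpha> \<beta>) (psi m J k M)) = psi m J k M \<and>
     transf m (Kminus m \<alpha> \<beta>) (transf m (Kminus_inv m \<alpha> \<beta>) (psi m J k M)) = psi m J k M"
    using transf_inverse_pair[OF T T' EE] transf_inverse_pair[OF T' T] EE by (simp add: mult.commute)
qed

end
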